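(* Let $N_{\mathrm{sur}}\in\mathbb{N}$ be any fixed number of inner surrogate iterations, let $\tau>\|B^{-1}\|$, let $p^0\in K$, and let $(p^n)_{n\in\mathbb{N}_0}$ be the iterates of the parallel decomposition algorithm (with $\sigma\in(0,\tfrac1M]$) or of the sequential decomposition algorithm (with $\sigma\in(0,1]$), where the subproblems are solved using the surrogate approximation algorithm with $N_{\mathrm{sur}}$ iterations, i.e. in each substep $\tilde v_i^n$ is the output of that algorithm. Let $\hat p\in K$ be a minimizer of $\mathcal{D}$ over $K$. Then $\mathcal{D}(p^n)\to\mathcal{D}(\hat p)$ as $n\to\infty$. Furthermore $$\mathcal{D}(p^n)-\mathcal{D}(\hat p)\le\begin{cases}\left(1-\frac{\rho\sigma}{2\alpha}\right)^n\big(\mathcal{D}(p^0)-\mathcal{D}(\hat p)\big)&\text{if } n\le n_0,\\[1ex] \frac{2\Phi^2}{\rho\sigma}\,\alpha^2\,(n-n_0+1)^{-1}&\text{if } n\ge n_0,\end{cases}$$ where $\alpha:=1+M\sigma\sqrt{2-\rho+2\sqrt{1-\rho}}$ for the sequential algorithm and $\alpha:=1$ for the parallel algorithm, $\Phi:=\sqrt{\|B^{-1}\|}\,\|\Lambda\|\,C_\theta R_{\hat p}$ with $C_\theta:=\big(\sum_{i=1}^M\|\theta_i\|^2\big)^{1/2}$ and $R_{\hat p}:=\sup\{\|p-\hat p\|_V:p\in K,\ \mathcal{D}(p)\le\mathcal{D}(p^0)\}<\infty$, $n_0:=\min\{n\in\mathbb{N}_0:\mathcal{D}(p^n)-\mathcal{D}(\hat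 p)<\Phi^2\alpha\}$, and $$\rho=1-(1-\eta)^{N_{\mathrm{sur}}},\qquad \eta=\begin{cases}\frac{1}{4\|\tau I-B^{-1}\|\|B\|}&\text{if }\|\tau I-B^{-1}\|\|B\|\ge\tfrac12,\\ 1-\|\tau I-B^{-1}\|\|B\|&\text{else.}\end{cases}$$
   Context: Setting. $\Omega\subset\mathbb{R}^d$ ($d\in\mathbb{N}$) is open, bounded and simply connected with Lipschitz boundary, $m\in\mathbb{N}$, $\lambda>0$, $\beta\ge0$, $g\in L^2(\Omega)$, and $T:L^2(\Omega)^m\to L^2(\Omega)$ is bounded linear with adjoint $T^*$. $W:=L^2(\Omega)^m$; $V:=H_0^{\mathrm{div}}(\Omega)^m$ is the Hilbert space of $p\in L^2(\Omega)^{d\times m}$ whose columns have divergence in $L^2(\Omega)$ and vanishing normal trace on $\partial\Omega$, with norm $\|p\|_V^2=\|p\|_{L^2}^2+\|\mathrm{div}\,p\|_{L^2}^2$. $\Lambda:V\to W$, $\Lambda p=\mathrm{div}\,p$ (column-wise). $B:=T^*T+\beta I:W\to W$; it is assumed that there is $c_B>0$ with $\|Tu\|_{L^2}^2+\beta\|u\|_W^2\ge c_B\|u\|_W^2$ for all $u\in W$, so $B$ is boundedly invertible. For a positive self-adjoint bounded operator $A$ on $W$, $\|w\|_A^2:=\langle w,Aw\rangle_W$. $K:=\{p\in V:|p(x)|_F\le\lambda\text{ for a.e. }x\in\Omega\}$ with $|\cdot|_F$ the Frobenius norm, and $\mathcal{D}(p):=\tfrac12\|\Lambda p-T^*g\|_{B^{-1}}^2$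 for $p\in V$. $\|\cdot\|$ applied to operators is the operator norm. Decomposition. $M\in\mathbb{N}$ and $\theta_i:V\to V$, $i=1,\dots,M$, are bounded linear operators with $I=\sum_{i=1}^M\theta_i$ and $K=\sum_{i=1}^M\theta_iK$. Parallel decomposition algorithm: for $n=0,1,2,\dots$, set $p_{i-1}^n:=p^n$ for all $i=1,\dots,M$, compute $\tilde v_i^n\in\theta_iK$ for each $i$, and set $p^{n+1}=p^n+\sum_{i=1}^M\sigma(\tilde v_i^n-\theta_ip^n)$. Sequential decomposition algorithm: for $n=0,1,2,\dots$ set $p_0^n=p^n$; for $i=1,\dots,M$ (in order) compute $\tilde v_i^n\in\theta_iK$ and set $p_i^n=p_{i-1}^n+\sigma(\tilde v_i^n-\theta_ip^n)$; finally set $p^{n+1}=p_M^n$. Surrogate approximation algorithm (computing $\tilde v_i^n$ as an approximate minimizer of $v_i\mapsto\mathcal{D}(p_{i-1}^n+(v_i-\theta_ip^n))$ over $\theta_iK$): with $$\mathcal{D}_i^{s,n}(v_i,w_i):=\mathcal{D}\big(p_{i-1}^n+(v_i-\theta_ip^n)\big)+\tfrac12\|\Lambda(v_i-w_i)\|_{\tau I-B^{-1}}^2,$$ set $v_i^{n,0}=\theta_ip_{i-1}^n$; for $\ell=0,1,\dots,N_{\mathrm{sur}}-1$ choose $v_i^{n,\ell+1}\in\arg\min_{v_i\in\theta_iK}\mathcal{D}_i^{s,n}(v_i,v_i^{n,\ell})$; output $\tilde v_i^n=v_i^{n,N_{\mathrm{sur}}}$.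
   Formalization: In the sequential algorithm the inner iteration starts at v_i^{n,0}=θ_i p^n, or at θ_i p_{i-1}^n only if D(p_{i-1}^n+θ_i p_{i-1}^n−θ_i p^n) ≤ D(p_{i-1}^n); with the unrestricted start θ_i p_{i-1}^n convergence can fail. *)

theory Defs
  imports "HOL-Analysis.Analysis"
begin

section \<open>The space of square-integrable functions\<close>

definition sq_integrable :: "('a::euclidean_space \<Rightarrow> 'b::euclidean_space) \<Rightarrow> bool" where
  "sq_integrable f \<longleftrightarrow>
     f \<in> borel_measurable lebesgue \<and> integrable lebesgue (\<lambda>x. (norm (f x))\<^sup>2)"

definition L2_rel :: "('a::euclidean_space \<Rightarrow> 'b::euclidean_space) \<Rightarrow> ('a \<Rightarrow> 'b) \<Rightarrow> bool" where
  "L2_rel f g \<longleftrightarrow> sq_integrable f \<and> sq_integrable g \<and> (AE x in lebesgue. f x = g x)"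

lemma sq_integrable_zero: "sq_integrable (\<lambda>x. 0)"
  by (simp add: sq_integrable_def)

lemma sq_integrable_scaleR:
  assumes "sq_integrable f" shows "sq_integrable (\<lambda>x. c *\<^sub>R f x)"
  using assms by (auto simp: sq_integrable_def power_mult_distrib)

lemma sq_integrable_add:
  assumes "sq_integrable f" "sq_integrable g"
  shows "sq_integrable (\<lambda>x. f x + g x)"
proof -
  have [measurable]: "f \<in> borel_measurable lebesgue" "g \<in> borel_measurable lebesgue"
    using assms by (auto simp: sq_integrable_def)
  have le: "(norm (a + b))\<^sup>2 \<le> 2 * (norm a)\<^sup>2 + 2 * (norm b)\<^sup>2" for a b :: 'b
  proof -
    have "(norm (a + b))\<^sup>2 \<le> (norm a + norm b)\<^sup>2"
      by (intro power_mono norm_triangle_ineq norm_ge_zero)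
    also have "\<dots> \<le> 2 * (norm a)\<^sup>2 + 2 * (norm b)\<^sup>2"
      using sum_squares_bound[of "norm a" "norm b"] by (simp add: power2_sum)
    finally show ?thesis .
  qed
  have "integrable lebesgue (\<lambda>x. 2 * (norm (f x))\<^sup>2 + 2 * (norm (g x))\<^sup>2)"
    using assms by (auto simp: sq_integrable_def)
  then have "integrable lebesgue (\<lambda>x. (norm (f x + g x))\<^sup>2)"
    by (rule Bochner_Integration.integrable_bound) (use le in auto)
  then show ?thesis by (simp add: sq_integrable_def)
qed

lemma sq_integrable_inner:
  assumes "sq_integrable f" "sq_integrable g"
  shows "integrable lebesgue (\<lambda>x. f x \<bullet> g x)"
proof -
  have [measurable]: "f \<in> borel_measurable lebesgue" "g \<in> borel_measurable lebesgue"
    using assms by (auto simp: sq_integrable_def)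
  have le: "\<bar>a \<bullet> b\<bar> \<le> (norm a)\<^sup>2 + (norm b)\<^sup>2" for a b :: 'b
  proof -
    have "\<bar>a \<bullet> b\<bar> \<le> norm a * norm b" by (rule Cauchy_Schwarz_ineq2)
    moreover have "2 * (norm a * norm b) \<le> (norm a)\<^sup>2 + (norm b)\<^sup>2"
      using sum_squares_bound[of "norm a" "norm b"] by simp
    moreover have "0 \<le> norm a * norm b" by simp
    ultimately show ?thesis by linarith
  qed
  have "integrable lebesgue (\<lambda>x. (norm (f x))\<^sup>2 + (norm (g x))\<^sup>2)"
    using assms by (auto simp: sq_integrable_def)
  then show ?thesis
    by (rule Bochner_Integration.integrable_bound) (use le in auto)
qed

quotient_type (overloaded) ('a, 'b) L2 =
  "'a::euclidean_space \<Rightarrow> 'b::euclidean_space" / partial: L2_rel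
proof (rule part_equivpI)
  show "\<exists>f::'a \<Rightarrow> 'b. L2_rel f f"
    using sq_integrable_zero by (auto simp: L2_rel_def)
  show "symp (L2_rel :: ('a \<Rightarrow> 'b) \<Rightarrow> _)"
    by (auto simp: L2_rel_def symp_def)
  show "transp (L2_rel :: ('a \<Rightarrow> 'b) \<Rightarrow> _)"
    unfolding transp_def L2_rel_def by (metis (mono_tags, lifting) AE_mp AE_I2)
qed

instantiation L2 :: (euclidean_space, euclidean_space) real_vector
begin

lift_definition zero_L2 :: "('a, 'b) L2" is "\<lambda>x. 0"
  by (simp add: L2_rel_def sq_integrable_zero)

lift_definition plus_L2 :: "('a, 'b) L2 \<Rightarrow> ('a, 'b) L2 \<Rightarrow> ('a, 'b) L2"
  is "\<lambda>f g x. f x + g x"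
  by (auto simp: L2_rel_def intro: sq_integrable_add)

lift_definition scaleR_L2 :: "real \<Rightarrow> ('a, 'b) L2 \<Rightarrow> ('a, 'b) L2"
  is "\<lambda>c f x. c *\<^sub>R f x"
  by (auto simp: L2_rel_def intro: sq_integrable_scaleR)

lift_definition uminus_L2 :: "('a, 'b) L2 \<Rightarrow> ('a, 'b) L2"
  is "\<lambda>f x. - f x"
  using sq_integrable_scaleR[of _ "-1"] by (auto simp: L2_rel_def)

lift_definition minus_L2 :: "('a, 'b) L2 \<Rightarrow> ('a, 'b) L2 \<Rightarrow> ('a, 'b) L2"
  is "\<lambda>f g x. f x - g x"
  using sq_integrable_add[OF _ sq_integrable_scaleR[of _ "-1"]] by (auto simp: L2_rel_def)

instance
proof
  fix f g h :: "('a, 'b) L2" and a b :: real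
  show "f + g + h = f + (g + h)"
    by transfer (auto simp: L2_rel_def add.assoc intro!: sq_integrable_add)
  show "f + g = g + f"
    by transfer (auto simp: L2_rel_def add.commute intro!: sq_integrable_add)
  show "0 + f = f"
    by transfer (auto simp: L2_rel_def)
  show "- f + f = 0"
    by transfer (auto simp: L2_rel_def sq_integrable_zero)
  show "f - g = f + - g"
    by transfer (use sq_integrable_add[OF _ sq_integrable_scaleR[of _ "-1"]] in
        \<open>auto simp: L2_rel_def\<close>)
  show "a *\<^sub>R (f + g) = a *\<^sub>R f + a *\<^sub>R g"
    by transfer (auto simp: L2_rel_def scaleR_add_right
        intro!: sq_integrable_add sq_integrable_scaleR)
  show "(a + b) *\<^sub>R f = a *\<^sub>R f + b *\<^sub>R f"
    by transfer (auto simp: L2_rel_def scaleR_add_left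
        intro!: sq_integrable_add sq_integrable_scaleR)
  show "a *\<^sub>R b *\<^sub>R f = (a * b) *\<^sub>R f"
    by transfer (auto simp: L2_rel_def intro!: sq_integrable_scaleR)
  show "1 *\<^sub>R f = f"
    by transfer (auto simp: L2_rel_def)
qed

end

instantiation L2 :: (euclidean_space, euclidean_space) real_inner
begin

lift_definition inner_L2 :: "('a, 'b) L2 \<Rightarrow> ('a, 'b) L2 \<Rightarrow> real"
  is "\<lambda>f g. integral\<^sup>L lebesgue (\<lambda>x. f x \<bullet> g x)"
proof -
  fix f f' g g' :: "'a \<Rightarrow> 'b"
  assume a: "L2_rel f f'" "L2_rel g g'"
  then have [measurable]: "f \<in> borel_measurable lebesgue" "g \<in> borel_measurable lebesgue"
    "f' \<in> borel_measurable lebesgue" "g' \<in> borel_measurable lebesgue"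
    by (auto simp: L2_rel_def sq_integrable_def)
  show "integral\<^sup>L lebesgue (\<lambda>x. f x \<bullet> g x) = integral\<^sup>L lebesgue (\<lambda>x. f' x \<bullet> g' x)"
    by (rule integral_cong_AE) (use a in \<open>auto simp: L2_rel_def\<close>)
qed

definition norm_L2 :: "('a, 'b) L2 \<Rightarrow> real" where
  "norm_L2 f = sqrt (f \<bullet> f)"

definition sgn_L2 :: "('a, 'b) L2 \<Rightarrow> ('a, 'b) L2" where
  "sgn_L2 f = f /\<^sub>R norm f"

definition dist_L2 :: "('a, 'b) L2 \<Rightarrow> ('a, 'b) L2 \<Rightarrow> real" where
  "dist_L2 f g = norm (f - g)"

definition uniformity_L2 :: "(('a, 'b) L2 \<times> ('a, 'b) L2) filter" where
  "uniformity_L2 = (INF e\<in>{0<..}. principal {(f, g). dist f g < e})"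

definition open_L2 :: "('a, 'b) L2 set \<Rightarrow> bool" where
  "open_L2 U \<longleftrightarrow> (\<forall>f\<in>U. eventually (\<lambda>(f', g). f' = f \<longrightarrow> g \<in> U) uniformity)"

instance
proof
  fix f g h :: "('a, 'b) L2" and a :: real and U :: "('a, 'b) L2 set"
  show "dist f g = norm (f - g)" by (rule dist_L2_def)
  show "sgn f = f /\<^sub>R norm f" by (rule sgn_L2_def)
  show "uniformity = (INF e\<in>{0<..}. principal {(x::('a, 'b) L2, y). dist x y < e})"
    by (rule uniformity_L2_def)
  show "open U = (\<forall>x\<in>U. eventually (\<lambda>(x', y). x' = x \<longrightarrow> y \<in> U) uniformity)"
    by (rule open_L2_def)
  show "norm f = sqrt (f \<bullet> f)" by (rule norm_L2_def)
  show "f \<bullet> g = g \<bullet> f"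
    by transfer (simp add: inner_commute)
  show "(f + g) \<bullet> h = f \<bullet> h + g \<bullet> h"
    by transfer (simp add: L2_rel_def inner_add_left sq_integrable_inner)
  show "(a *\<^sub>R f) \<bullet> g = a * (f \<bullet> g)"
    by transfer simp
  show "0 \<le> f \<bullet> f"
    by transfer simp
  show "(f \<bullet> f = 0) = (f = 0)"
  proof transfer
    fix f :: "'a \<Rightarrow> 'b"
    assume f: "L2_rel f f"
    then have "integrable lebesgue (\<lambda>x. f x \<bullet> f x)"
      by (simp add: L2_rel_def sq_integrable_inner)
    then have "(integral\<^sup>L lebesgue (\<lambda>x. f x \<bullet> f x) = 0) = (AE x in lebesgue. f x \<bullet> f x = 0)"
      by (intro integral_nonneg_eq_0_iff_AE) auto
    then show "(integral\<^sup>L lebesgue (\<lambda>x. f x \<bullet> f x) = 0) = L2_rel f (\<lambda>x. 0)"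
      using f by (simp add: L2_rel_def sq_integrable_zero)
  qed
qed

end

text \<open>
  For an element \<open>f\<close> of \<open>L2\<close>, \<open>rep_L2 f\<close> is some representative; everything below depends on
  it only up to null sets. The space \<open>L\<^sup>2(\<Omega>)\<close> is identified, through extension by zero, with the
  closed subspace of those classes on the whole space that vanish almost everywhere outside \<open>\<Omega>\<close>.
  Norm and inner product of \<open>L\<^sup>2(\<Omega>)\<close> are then those of \<open>L2\<close>.
\<close>

definition L2_on :: "'a set \<Rightarrow> ('a::euclidean_space, 'b::euclidean_space) L2 set" where
  "L2_on \<Omega> = {f. AE x in lebesgue. x \<notin> \<Omega> \<longrightarrow> rep_L2 f x = 0}"


section \<open>Domains with Lipschitz boundary\<close>

text \<open>
  Near each boundary point, \<open>\<Omega>\<close> is the strict epigraph of a Lipschitz function over the hyperplane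
  orthogonal to some unit vector \<open>e\<close> (coordinate-free form of: after a rigid motion, the epigraph
  of a Lipschitz function of the first \<open>d - 1\<close> variables).
\<close>

definition lipschitz_boundary :: "'a::euclidean_space set \<Rightarrow> bool" where
  "lipschitz_boundary \<Omega> \<longleftrightarrow>
     (\<forall>x\<^sub>0\<in>frontier \<Omega>. \<exists>r>0. \<exists>e. \<exists>h. \<exists>L. norm e = 1 \<and>
        L-lipschitz_on {y. y \<bullet> e = 0} h \<and>
        \<Omega> \<inter> ball x\<^sub>0 r = {y \<in> ball x\<^sub>0 r. h (y - (y \<bullet> e) *\<^sub>R e) < y \<bullet> e})"


section \<open>Weak derivatives and the space of fields with vanishing normal trace\<close>

definition gradient :: "(real^'d \<Rightarrow> real) \<Rightarrow> real^'d \<Rightarrow> real^'d" where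
  "gradient \<phi> x = (\<chi> i. frechet_derivative \<phi> (at x) (axis i 1))"

primrec Ck :: "nat \<Rightarrow> (real^'d \<Rightarrow> real) \<Rightarrow> bool" where
  "Ck 0 \<phi> \<longleftrightarrow> continuous_on UNIV \<phi>"
| "Ck (Suc k) \<phi> \<longleftrightarrow>
     (\<forall>x. \<phi> differentiable (at x)) \<and> (\<forall>i. Ck k (\<lambda>x. gradient \<phi> x $ i))"

definition test_fun :: "(real^'d) set \<Rightarrow> (real^'d \<Rightarrow> real) \<Rightarrow> bool" where
  "test_fun \<Omega> \<phi> \<longleftrightarrow> (\<forall>k. Ck k \<phi>) \<and> (\<exists>S\<subseteq>\<Omega>. compact S \<and> (\<forall>x. x \<notin> S \<longrightarrow> \<phi> x = 0))"

text \<open>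
  A field in \<open>L\<^sup>2(\<Omega>)\<^sup>d\<^sup>\<times>\<^sup>m\<close> has type \<open>(real^'d, real^'m^'d) L2\<close>: the outer index \<open>'d\<close> numbers the
  rows, \<open>'m\<close> the columns. The norm of \<open>real^'m^'d\<close> is the Frobenius norm.
\<close>

definition has_weak_div ::
    "(real^'d) set \<Rightarrow> (real^'d, real^'m^'d) L2 \<Rightarrow> (real^'d, real^'m) L2 \<Rightarrow> bool" where
  "has_weak_div \<Omega> p v \<longleftrightarrow> (\<forall>\<phi>. test_fun \<Omega> \<phi> \<longrightarrow> (\<forall>j.
     (LINT x:\<Omega>|lebesgue. column j (rep_L2 p x) \<bullet> gradient \<phi> x) =
     - (LINT x:\<Omega>|lebesgue. (rep_L2 v x $ j) * \<phi> x)))"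

definition weak_div ::
    "(real^'d) set \<Rightarrow> (real^'d, real^'m^'d) L2 \<Rightarrow> (real^'d, real^'m) L2" where
  "weak_div \<Omega> p = (THE v. v \<in> L2_on \<Omega> \<and> has_weak_div \<Omega> p v)"

definition has_weak_grad ::
    "(real^'d) set \<Rightarrow> (real^'d, real) L2 \<Rightarrow> (real^'d, real^'d) L2 \<Rightarrow> bool" where
  "has_weak_grad \<Omega> u G \<longleftrightarrow> (\<forall>\<phi>. test_fun \<Omega> \<phi> \<longrightarrow> (\<forall>i.
     (LINT x:\<Omega>|lebesgue. rep_L2 u x * gradient \<phi> x $ i) =
     - (LINT x:\<Omega>|lebesgue. (rep_L2 G x $ i) * \<phi> x)))"

definition Hdiv :: "(real^'d) set \<Rightarrow> (real^'d, real^'m^'d) L2 set" where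
  "Hdiv \<Omega> = {p \<in> L2_on \<Omega>. \<exists>v\<in>L2_on \<Omega>. has_weak_div \<Omega> p v}"

text \<open>
  The normal trace of column \<open>j\<close> of \<open>p \<in> Hdiv \<Omega>\<close> is the functional that Green's formula
  assigns to (the boundary values of) \<open>u \<in> H\<^sup>1(\<Omega>)\<close>, where \<open>G\<close> is the weak gradient of \<open>u\<close>.
  It vanishes iff it is zero on all of \<open>H\<^sup>1(\<Omega>)\<close>.
\<close>

definition normal_trace ::
    "(real^'d) set \<Rightarrow> (real^'d, real^'m^'d) L2 \<Rightarrow> 'm \<Rightarrow>
     (real^'d, real) L2 \<Rightarrow> (real^'d, real^'d) L2 \<Rightarrow> real" where
  "normal_trace \<Omega> p j u G =
     (LINT x:\<Omega>|lebesgue. column j (rep_L2 p x) \<bullet> rep_L2 G x) +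
     (LINT x:\<Omega>|lebesgue. (rep_L2 (weak_div \<Omega> p) x $ j) * rep_L2 u x)"

definition Hdiv0 :: "(real^'d) set \<Rightarrow> (real^'d, real^'m^'d) L2 set" where
  "Hdiv0 \<Omega> = {p \<in> Hdiv \<Omega>. \<forall>u\<in>L2_on \<Omega>. \<forall>G\<in>L2_on \<Omega>.
     has_weak_grad \<Omega> u G \<longrightarrow> (\<forall>j. normal_trace \<Omega> p j u G = 0)}"

definition Hdiv_norm :: "(real^'d) set \<Rightarrow> (real^'d, real^'m^'d) L2 \<Rightarrow> real" where
  "Hdiv_norm \<Omega> p = sqrt ((norm p)\<^sup>2 + (norm (weak_div \<Omega> p))\<^sup>2)"

definition admissible :: "(real^'d) set \<Rightarrow> real \<Rightarrow> (real^'d, real^'m^'d) L2 set" where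
  "admissible \<Omega> lam = {p \<in> Hdiv0 \<Omega>. AE x in lebesgue. x \<in> \<Omega> \<longrightarrow> norm (rep_L2 p x) \<le> lam}"


section \<open>Operators between subspaces\<close>

text \<open>
  Operators are functions on the whole type of which only the values on a carrier subspace matter;
  the norms are passed explicitly because \<open>Hdiv_norm \<Omega>\<close> is not the norm of the type.
\<close>

definition bounded_linear_between ::
    "'a::real_vector set \<Rightarrow> ('a \<Rightarrow> real) \<Rightarrow> 'b::real_vector set \<Rightarrow> ('b \<Rightarrow> real) \<Rightarrow> ('a \<Rightarrow> 'b) \<Rightarrow> bool" where
  "bounded_linear_between X nX Y nY f \<longleftrightarrow>
     f ` X \<subseteq> Y \<and>
     (\<forall>x\<in>X. \<forall>y\<in>X. f (x + y) = f x + f y) \<and>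
     (\<forall>c. \<forall>x\<in>X. f (c *\<^sub>R x) = c *\<^sub>R f x) \<and>
     (\<exists>C. \<forall>x\<in>X. nY (f x) \<le> C * nX x)"

definition op_norm :: "'a set \<Rightarrow> ('a \<Rightarrow> real) \<Rightarrow> ('b \<Rightarrow> real) \<Rightarrow> ('a \<Rightarrow> 'b) \<Rightarrow> real" where
  "op_norm X nX nY f = (SUP x\<in>X. nY (f x) / nX x)"

definition energy_sq :: "('a::real_inner \<Rightarrow> 'a) \<Rightarrow> 'a \<Rightarrow> real" where
  "energy_sq A w = w \<bullet> A w"


section \<open>The algorithms\<close>

text \<open>
  \<open>surrogate_approx \<Lambda> A D C N q a w\<^sub>0 v\<close>: starting from \<open>w\<^sub>0\<close>, some run of \<open>N\<close> surrogate iterations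
  for minimizing \<open>v \<mapsto> D (q + (v - a))\<close> over \<open>C\<close> ends in \<open>v\<close>. It is a relation since
  the minimizers need not be unique.
\<close>

definition surrogate_approx ::
    "('v::real_vector \<Rightarrow> 'w::real_inner) \<Rightarrow> ('w \<Rightarrow> 'w) \<Rightarrow> ('v \<Rightarrow> real) \<Rightarrow> 'v set \<Rightarrow> nat \<Rightarrow>
     'v \<Rightarrow> 'v \<Rightarrow> 'v \<Rightarrow> 'v \<Rightarrow> bool" where
  "surrogate_approx \<Lambda> A D C N q a w\<^sub>0 v \<longleftrightarrow>
     (\<exists>w :: nat \<Rightarrow> 'v. w 0 = w\<^sub>0 \<and>
        (\<forall>l<N. is_arg_min (\<lambda>z. D (q + (z - a)) + 1/2 * energy_sq A (\<Lambda> (z - w l)))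
                 (\<lambda>z. z \<in> C) (w (Suc l))) \<and>
        v = w N)"

definition parallel_iterates ::
    "('v::real_vector \<Rightarrow> 'w::real_inner) \<Rightarrow> ('w \<Rightarrow> 'w) \<Rightarrow> ('v \<Rightarrow> real) \<Rightarrow> 'v set \<Rightarrow>
     (nat \<Rightarrow> 'v \<Rightarrow> 'v) \<Rightarrow> nat \<Rightarrow> real \<Rightarrow> nat \<Rightarrow> (nat \<Rightarrow> 'v) \<Rightarrow> bool" where
  "parallel_iterates \<Lambda> A D K \<theta> M \<sigma> N p \<longleftrightarrow>
     (\<exists>v :: nat \<Rightarrow> nat \<Rightarrow> 'v. \<forall>n.
        (\<forall>i\<in>{1..M}. surrogate_approx \<Lambda> A D (\<theta> i ` K) N (p n) (\<theta> i (p n)) (\<theta> i (p n)) (v n i)) \<and>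
        p (Suc n) = p n + (\<Sum>i=1..M. \<sigma> *\<^sub>R (v n i - \<theta> i (p n))))"

text \<open>
  \<open>q n i\<close> is the intermediate iterate after the first \<open>i\<close> subproblems of outer step \<open>n\<close>. The inner
  iteration for subproblem \<open>i\<close> starts at \<open>\<theta> i (p n)\<close>, i.e. at zero increment, where the
  subproblem objective has the value \<open>D (q n (i - 1))\<close>; starting at \<open>\<theta> i (q n (i - 1))\<close> is also
  allowed if that does not exceed this value. Unrestricted use of the latter start can
  increase \<open>D\<close>, and then \<open>D (p n)\<close> need not converge to the minimum.
\<close>

definition sequential_start ::
    "('v::real_vector \<Rightarrow> real) \<Rightarrow> ('v \<Rightarrow> 'v) \<Rightarrow> 'v \<Rightarrow> 'v \<Rightarrow> 'v \<Rightarrow> bool" where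
  "sequential_start D \<theta>\<^sub>i p\<^sub>n q w\<^sub>0 \<longleftrightarrow>
     w\<^sub>0 = \<theta>\<^sub>i p\<^sub>n \<or> (w\<^sub>0 = \<theta>\<^sub>i q \<and> D (q + (w\<^sub>0 - \<theta>\<^sub>i p\<^sub>n)) \<le> D q)"

definition sequential_iterates ::
    "('v::real_vector \<Rightarrow> 'w::real_inner) \<Rightarrow> ('w \<Rightarrow> 'w) \<Rightarrow> ('v \<Rightarrow> real) \<Rightarrow> 'v set \<Rightarrow>
     (nat \<Rightarrow> 'v \<Rightarrow> 'v) \<Rightarrow> nat \<Rightarrow> real \<Rightarrow> nat \<Rightarrow> (nat \<Rightarrow> 'v) \<Rightarrow> bool" where
  "sequential_iterates \<Lambda> A D K \<theta> M \<sigma> N p \<longleftrightarrow>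
     (\<exists>(v :: nat \<Rightarrow> nat \<Rightarrow> 'v) (q :: nat \<Rightarrow> nat \<Rightarrow> 'v). \<forall>n.
        q n 0 = p n \<and>
        (\<forall>i\<in>{1..M}.
           (\<exists>w\<^sub>0. sequential_start D (\<theta> i) (p n) (q n (i - 1)) w\<^sub>0 \<and>
              surrogate_approx \<Lambda> A D (\<theta> i ` K) N (q n (i - 1)) (\<theta> i (p n)) w\<^sub>0 (v n i)) \<and>
           q n i = q n (i - 1) + \<sigma> *\<^sub>R (v n i - \<theta> i (p n))) \<and>
        p (Suc n) = q n M)"

end

theory Submission
  imports Defs
begin

text \<open>
  Since \<open>D\<close> is quadratic, testing a surrogate step against the point at parameter \<open>1 / (\<kappa> + 1)\<close> on
  the segment to an arbitrary competitor, with \<open>\<kappa> = \<bar>\<tau> I - B\<^sup>-\<^sup>1\<bar> \<bar>B\<bar>\<close>, contracts the gap to that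
  competitor by \<open>\<kappa> / (\<kappa> + 1) \<le> 1 - \<eta>\<close>; no minimizer of the subproblem has to exist. Hence every
  subproblem realizes at least a fraction \<open>\<rho>\<close> of the decrease possible for any competitor.
  Choosing the competitors \<open>\<theta>\<^sub>i\<close> of a point at parameter \<open>t\<close> on the segment from the iterate to the
  minimizer and summing over \<open>i\<close> bounds the total decrease below by \<open>\<rho>\<sigma> (t \<delta> - t\<^sup>2 \<Phi>\<^sup>2 / 2)\<close>, where \<open>\<delta>\<close>
  is the current gap. In the sequential case there is an additional error from the intermediate
  updates, which is controlled by the decrease itself and is the source of \<open>\<alpha>\<close>. Optimizing in
  \<open>t \<in> [0, 1]\<close> gives a linear rate while \<open>\<delta> \<ge> \<Phi>\<^sup>2 \<alpha>\<close> and a quadratic recursion for \<open>\<delta>\<close> afterwards.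
  On the analytic side, completeness of \<open>L\<^sup>2\<close> makes \<open>B\<close> invertible, and the fundamental lemma of the
  calculus of variations makes the weak divergence unique and therefore linear.
\<close>

section \<open>Quadratic objectives\<close>

text \<open>The form behind all estimates, \<open>\<Lambda> x \<bullet> Binv (\<Lambda> y)\<close>,
  is only semidefinite: divergence-free fields have zero energy. Hence the argument treats
  \<open>V\<close> as a vector space with an energy and avoids strict convexity; completeness is
  used for \<open>W\<close>, to invert \<open>B\<close>. The norm of \<open>V\<close> enters through
  \<Phi> and the finiteness of \<open>R\<close>. Origin of \<alpha>: in the sequential algorithm the
  test directions belong to the old iterate, while the derivative is taken at the intermediate one.
  The two derivatives differ by the energy product of the increments made so far, damped by
  \<sigma>, with the direction. An increment with decrease \<open>g\<close> has energy at most
  \<open>2 / \<rho> * (1 + sqrt (1 - \<rho>))\<^sup>2 * g\<close>, and Cauchy-Schwarz over the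
  indices costs \<open>sqrt M\<close> for the increments and again for the directions. Together this
  is \<open>\<alpha> - 1\<close>, because \<open>2 - \<rho> + 2 * sqrt (1 - \<rho>)\<close> is the
  square of \<open>1 + sqrt (1 - \<rho>)\<close>. Working with a form on a carrier also gives
  Cauchy-Schwarz for \<open>x \<bullet> B y\<close> on \<open>W\<close> from the same
  locale.\<close>

locale quadratic_objective =
  fixes V :: "'v::real_vector set" and a :: "'v \<Rightarrow> 'v \<Rightarrow> real" and l D :: "'v \<Rightarrow> real" and c\<^sub>0 :: real
  assumes subspace_V: "subspace V"
    and form_add: "\<lbrakk>x \<in> V; y \<in> V; z \<in> V\<rbrakk> \<Longrightarrow> a (x + y) z = a x z + a y z"
    and form_scale: "\<lbrakk>x \<in> V; z \<in> V\<rbrakk> \<Longrightarrow> a (r *\<^sub>R x) z = r * a x z"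
    and form_sym: "\<lbrakk>x \<in> V; y \<in> V\<rbrakk> \<Longrightarrow> a x y = a y x"
    and form_nonneg: "x \<in> V \<Longrightarrow> 0 \<le> a x x"
    and l_add: "\<lbrakk>x \<in> V; y \<in> V\<rbrakk> \<Longrightarrow> l (x + y) = l x + l y"
    and l_scale: "x \<in> V \<Longrightarrow> l (r *\<^sub>R x) = r * l x"
    and D_eq: "x \<in> V \<Longrightarrow> D x = a x x / 2 - l x + c\<^sub>0"
begin

lemmas V_closed = subspace_V[THEN subspace_add] subspace_V[THEN subspace_diff]
  subspace_V[THEN subspace_scale] subspace_V[THEN subspace_0] subspace_V[THEN subspace_sum]

text \<open>The derivative of \<open>D\<close> at \<open>q\<close> in direction
  \<open>d\<close>.\<close>

definition dD :: "'v \<Rightarrow> 'v \<Rightarrow> real" where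
  "dD q d = a q d - l d"

lemma form_add_right: "\<lbrakk>x \<in> V; y \<in> V; z \<in> V\<rbrakk> \<Longrightarrow> a z (x + y) = a z x + a z y"
  by (simp add: form_sym[of z] form_add V_closed)

lemma form_scale_right: "\<lbrakk>x \<in> V; z \<in> V\<rbrakk> \<Longrightarrow> a z (r *\<^sub>R x) = r * a z x"
  by (simp add: form_sym[of z] form_scale V_closed)

lemma form_zero_left: "z \<in> V \<Longrightarrow> a 0 z = 0"
  using form_scale[of z z 0] by simp

lemma l_zero: "l 0 = 0"
  using l_scale[of 0 0] V_closed(4) by simp

lemma form_sum_left:
  "\<lbrakk>\<And>i. i \<in> I \<Longrightarrow> f i \<in> V; z \<in> V\<rbrakk> \<Longrightarrow> a (\<Sum>i\<in>I. f i) z = (\<Sum>i\<in>I. a (f i) z)"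
  by (induction I rule: infinite_finite_induct) (auto simp: form_zero_left form_add V_closed)

lemma l_sum:
  "(\<And>i. i \<in> I \<Longrightarrow> f i \<in> V) \<Longrightarrow> l (\<Sum>i\<in>I. f i) = (\<Sum>i\<in>I. l (f i))"
  by (induction I rule: infinite_finite_induct) (auto simp: l_zero l_add V_closed)

lemma dD_sum:
  assumes "\<And>i. i \<in> I \<Longrightarrow> f i \<in> V" "q \<in> V"
  shows "dD q (\<Sum>i\<in>I. f i) = (\<Sum>i\<in>I. dD q (f i))"
  using assms
  by (simp add: dD_def form_sym[of q] V_closed form_sum_left l_sum sum_subtractf)

lemma D_line:
  assumes "q \<in> V" "d \<in> V"
  shows "D (q + t *\<^sub>R d) = D q + t * dD q d + t\<^sup>2 / 2 * a d d"
  using assms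
  by (simp add: D_eq V_closed dD_def form_add form_add_right form_scale form_scale_right
      l_add l_scale form_sym[of d q] power2_eq_square algebra_simps)

lemma D_add:
  assumes "q \<in> V" "d \<in> V"
  shows "D (q + d) = D q + dD q d + a d d / 2"
  using D_line[OF assms, of 1] by simp

lemma dD_diff:
  assumes "q \<in> V" "q' \<in> V" "d \<in> V"
  shows "dD q d = dD q' d + a (q - q') d"
  using assms form_add[of "q - q'" q' d] by (simp add: dD_def V_closed)

text \<open>The convexity defect is an exact multiple of the energy. It pays for the penalty in
  \<open>surrogate_step\<close>, and in \<open>increment_bound\<close> it converts decrease into
  step length.\<close>

lemma D_line_segment:
  assumes "q \<in> V" "d \<in> V"
  shows "D (q + t *\<^sub>R d) = (1 - t) * D q + t * D (q + d) - t * (1 - t) / 2 * a d d"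
  unfolding D_line[OF assms] D_add[OF assms] by (simp add: power2_eq_square field_simps)

lemma D_line_le:
  assumes "q \<in> V" "d \<in> V" "0 \<le> t" "t \<le> 1"
  shows "D (q + t *\<^sub>R d) \<le> (1 - t) * D q + t * D (q + d)"
proof -
  have "0 \<le> t * (1 - t) / 2 * a d d"
    using assms form_nonneg by (intro mult_nonneg_nonneg) auto
  then show ?thesis using D_line_segment[OF assms(1,2), of t] by linarith
qed

lemma D_convex: "convex_on V D"
proof (rule convex_onI)
  show "convex V" using subspace_V by (rule subspace_imp_convex)
  fix t :: real and x y assume *: "0 < t" "t < 1" "x \<in> V" "y \<in> V"
  have "(1 - t) *\<^sub>R x + t *\<^sub>R y = x + t *\<^sub>R (y - x)" by (simp add: algebra_simps)
  then show "D ((1 - t) *\<^sub>R x + t *\<^sub>R y) \<le> (1 - t) * D x + t * D y"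
    using D_line_le[of x "y - x" t] * by (simp add: V_closed)
qed

text \<open>Nonnegativity of a quadratic polynomial in \<open>t\<close>. Since the form may be
  degenerate, \<open>a y y = 0\<close> needs its own argument: the polynomial is then affine, hence
  bounded below only if its slope vanishes.\<close>

lemma form_Cauchy_Schwarz_sq:
  assumes "x \<in> V" "y \<in> V"
  shows "(a x y)\<^sup>2 \<le> a x x * a y y"
proof -
  have expand: "a (x + t *\<^sub>R y) (x + t *\<^sub>R y) = a x x + 2 * t * a x y + t\<^sup>2 * a y y" for t
    using assms by (simp add: form_add form_add_right form_scale form_scale_right V_closed
        form_sym[of y x] power2_eq_square algebra_simps)
  have nn: "0 \<le> a x x + 2 * t * a x y + t\<^sup>2 * a y y" for t
    using form_nonneg[of "x + t *\<^sub>R y"] assms by (simp add: expand V_closed)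
  show ?thesis
  proof (cases "a y y = 0")
    case True
    have "a x y = 0"
    proof (rule ccontr)
      assume "a x y \<noteq> 0"
      \<comment> \<open>At this \<open>t\<close> the affine polynomial has the value -1.\<close>
      then show False using nn[of "- (a x x + 1) / (2 * a x y)"] True by (simp add: field_simps)
    qed
    then show ?thesis using True by simp
  next
    case False
    then have pos: "a y y > 0" using form_nonneg[OF assms(2)] by simp
    have "0 \<le> a x x - (a x y)\<^sup>2 / a y y"
      using nn[of "- a x y / a y y"] pos by (simp add: field_simps power2_eq_square)
    then show ?thesis using pos by (simp add: field_simps)
  qed
qed

lemma form_Cauchy_Schwarz:
  assumes "x \<in> V" "y \<in> V"
  shows "\<bar>a x y\<bar> \<le> sqrt (a x x) * sqrt (a y y)"
  using real_sqrt_le_mono[OF form_Cauchy_Schwarz_sq[OF assms]] by (simp add: real_sqrt_mult)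

text \<open>Testing against \<open>w + t (v - w)\<close> with \<open>t = 1 / (\<kappa> + 1)\<close> makes the surrogate penalty cancel
  against the convexity gain, so no exact minimizer of the subproblem is needed.\<close>

lemma surrogate_step:
  fixes s :: "'v \<Rightarrow> real"
  assumes C: "C \<subseteq> V" "convex C" and V: "q \<in> V" "c \<in> V" and in_C: "w \<in> C" "v \<in> C"
    and \<kappa>: "0 \<le> \<kappa>"
    and s_nonneg: "\<And>x. x \<in> V \<Longrightarrow> 0 \<le> s x"
    and s_scale: "\<And>t x. x \<in> V \<Longrightarrow> s (t *\<^sub>R x) = t\<^sup>2 * s x"
    and s_le: "\<And>x. x \<in> V \<Longrightarrow> s x \<le> \<kappa> * a x x"
    and min: "is_arg_min (\<lambda>z. D (q + (z - c)) + 1/2 * s (z - w)) (\<lambda>z. z \<in> C) w'"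
  shows "D (q + (w' - c)) - D (q + (v - c)) \<le> \<kappa> / (\<kappa> + 1) * (D (q + (w - c)) - D (q + (v - c)))"
proof -
  define t where "t = 1 / (\<kappa> + 1)"
  have t: "0 \<le> t" "t \<le> 1" "t * (\<kappa> + 1) = 1" "1 - t = \<kappa> / (\<kappa> + 1)"
    using \<kappa> by (auto simp: t_def field_simps)
  define d where "d = v - w"
  have mem: "w \<in> V" "v \<in> V" "d \<in> V" "w' \<in> C" "w' \<in> V"
    using C in_C min by (auto simp: d_def is_arg_min_def intro!: V_closed)
  have "w + t *\<^sub>R d = (1 - t) *\<^sub>R w + t *\<^sub>R v" by (simp add: d_def algebra_simps)
  then have "w + t *\<^sub>R d \<in> C" using convexD_alt[OF C(2) in_C t(1,2)] by simp
  then have "D (q + (w' - c)) + 1/2 * s (w' - w) \<le> D (q + (w + t *\<^sub>R d - c)) + 1/2 * s (t *\<^sub>R d)"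
    using min by (force simp: is_arg_min_linorder)
  moreover have "0 \<le> s (w' - w)" using s_nonneg mem V_closed by simp
  moreover have "D (q + (w + t *\<^sub>R d - c)) =
      (1 - t) * D (q + (w - c)) + t * D (q + (v - c)) - t * (1 - t) / 2 * a d d"
    using D_line_segment[of "q + (w - c)" d t] mem V V_closed by (simp add: d_def algebra_simps)
  moreover have "1/2 * s (t *\<^sub>R d) \<le> t * (1 - t) / 2 * a d d"
  proof -
    have "s (t *\<^sub>R d) \<le> t\<^sup>2 * (\<kappa> * a d d)"
      using s_le[OF mem(3)] by (simp add: s_scale mem mult_left_mono)
    also have "t\<^sup>2 * (\<kappa> * a d d) = t * (t * \<kappa>) * a d d" by (simp add: power2_eq_square)
    also have "t * \<kappa> = 1 - t" using t(3) by (simp add: algebra_simps)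
    finally show ?thesis by simp
  qed
  ultimately have "D (q + (w' - c)) \<le> (1 - t) * D (q + (w - c)) + t * D (q + (v - c))" by linarith
  then show ?thesis unfolding t(4)[symmetric] by (simp add: algebra_simps)
qed

text \<open>The competitor stays fixed while the start of each step moves, so the contraction
  factors multiply. The gap may be negative, but it is only ever multiplied by the nonnegative
  factor \<open>\<kappa> / (\<kappa> + 1)\<close>.\<close>

lemma surrogate_iterate:
  fixes s :: "'v \<Rightarrow> real"
  assumes C: "C \<subseteq> V" "convex C" and V: "q \<in> V" "c \<in> V" and in_C: "w 0 \<in> C" "v \<in> C"
    and \<kappa>: "0 \<le> \<kappa>"
    and s_nonneg: "\<And>x. x \<in> V \<Longrightarrow> 0 \<le> s x"
    and s_scale: "\<And>t x. x \<in> V \<Longrightarrow> s (t *\<^sub>R x) = t\<^sup>2 * s x"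
    and s_le: "\<And>x. x \<in> V \<Longrightarrow> s x \<le> \<kappa> * a x x"
    and min: "\<And>k. k < N \<Longrightarrow>
      is_arg_min (\<lambda>z. D (q + (z - c)) + 1/2 * s (z - w k)) (\<lambda>z. z \<in> C) (w (Suc k))"
  shows "w N \<in> C \<and> D (q + (w N - c)) - D (q + (v - c))
    \<le> (\<kappa> / (\<kappa> + 1)) ^ N * (D (q + (w 0 - c)) - D (q + (v - c)))"
  using min
proof (induction N)
  case 0
  then show ?case using in_C by simp
next
  case (Suc N)
  have IH: "w N \<in> C" "D (q + (w N - c)) - D (q + (v - c))
    \<le> (\<kappa> / (\<kappa> + 1)) ^ N * (D (q + (w 0 - c)) - D (q + (v - c)))"
    using Suc by auto
  have "w (Suc N) \<in> C" using Suc.prems[of N] by (auto simp: is_arg_min_def)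
  moreover have "D (q + (w (Suc N) - c)) - D (q + (v - c))
    \<le> \<kappa> / (\<kappa> + 1) * (D (q + (w N - c)) - D (q + (v - c)))"
    by (rule surrogate_step[OF C V IH(1) in_C(2) \<kappa> s_nonneg s_scale s_le Suc.prems]) auto
  moreover have "\<kappa> / (\<kappa> + 1) * (D (q + (w N - c)) - D (q + (v - c)))
    \<le> \<kappa> / (\<kappa> + 1) * ((\<kappa> / (\<kappa> + 1)) ^ N * (D (q + (w 0 - c)) - D (q + (v - c))))"
    using IH(2) \<kappa> by (intro mult_left_mono) auto
  ultimately show ?case by (simp add: mult.assoc)
qed

text \<open>The fraction is measured from \<open>D q\<close>, the value at zero increment; this is
  why the start may not exceed that value.\<close>

lemma surrogate_approx_opt:
  assumes C: "C \<subseteq> V" "convex C" and V: "q \<in> V" "c \<in> V" and w\<^sub>0: "w\<^sub>0 \<in> C" "D (q + (w\<^sub>0 - c)) \<le> D q"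
    and \<kappa>: "0 \<le> \<kappa>" "\<kappa> / (\<kappa> + 1) \<le> 1 - \<eta>" and \<eta>: "0 \<le> \<eta>"
    and S_nonneg: "\<And>x. x \<in> V \<Longrightarrow> 0 \<le> energy_sq S (\<Lambda> x)"
    and S_scale: "\<And>t x. x \<in> V \<Longrightarrow> energy_sq S (\<Lambda> (t *\<^sub>R x)) = t\<^sup>2 * energy_sq S (\<Lambda> x)"
    and S_le: "\<And>x. x \<in> V \<Longrightarrow> energy_sq S (\<Lambda> x) \<le> \<kappa> * a x x"
    and run: "surrogate_approx \<Lambda> S D C N q c w\<^sub>0 v" and u: "u \<in> C"
  shows "(1 - (1 - \<eta>) ^ N) * (D q - D (q + (u - c))) \<le> D q - D (q + (v - c))"
proof -
  obtain w where w: "w 0 = w\<^sub>0" "v = w N"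
    and min: "\<And>l. l < N \<Longrightarrow> is_arg_min (\<lambda>z. D (q + (z - c)) + 1/2 * energy_sq S (\<Lambda> (z - w l)))
        (\<lambda>z. z \<in> C) (w (Suc l))"
    using run unfolding surrogate_approx_def by blast
  define r where "r = (\<kappa> / (\<kappa> + 1)) ^ N"
  have r: "0 \<le> r" "r \<le> (1 - \<eta>) ^ N"
    unfolding r_def using \<kappa> by (auto intro!: power_mono)
  have iter: "D (q + (v - c)) - D (q + (u' - c)) \<le> r * (D (q + (w\<^sub>0 - c)) - D (q + (u' - c)))"
    if "u' \<in> C" for u'
    using surrogate_iterate[where w = w and s = "\<lambda>x. energy_sq S (\<Lambda> x)", OF C V _ that \<kappa>(1) S_nonneg S_scale S_le min] w w\<^sub>0(1)
    unfolding r_def by simp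
  \<comment> \<open>With the start itself as competitor the initial gap is zero, so the run cannot
    increase \<open>D\<close>.\<close>
  have descent: "D (q + (v - c)) \<le> D q" using iter[OF w\<^sub>0(1)] w\<^sub>0(2) by simp
  show ?thesis
  \<comment> \<open>Replacing \<open>r\<close> by the larger \<open>(1 - \<eta>) ^ N\<close>
    requires a nonnegative gap. For a worse competitor the claimed decrease is nonpositive, and
    descent suffices.\<close>
  proof (cases "D (q + (u - c)) \<le> D q")
    case True
    have "r * (D (q + (w\<^sub>0 - c)) - D (q + (u - c))) \<le> r * (D q - D (q + (u - c)))"
      using w\<^sub>0(2) r(1) by (intro mult_left_mono) auto
    also have "\<dots> \<le> (1 - \<eta>) ^ N * (D q - D (q + (u - c)))"
      using r(2) True by (intro mult_right_mono) auto
    finally show ?thesis using iter[OF u] by (simp add: left_diff_distrib)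
  next
    case False
    have "0 \<le> \<kappa> / (\<kappa> + 1)" using \<kappa> by simp
    then have "(1 - \<eta>) ^ N \<le> 1" using \<kappa>(2) \<eta> by (intro power_le_one) linarith+
    then have "(1 - (1 - \<eta>) ^ N) * (D q - D (q + (u - c))) \<le> 0"
      using False by (intro mult_nonneg_nonpos) auto
    then show ?thesis using descent by linarith
  qed
qed

text \<open>The decrease along the segment from \<open>c\<close> to \<open>w\<close> is quadratic in the step, and by approximate
  optimality of \<open>w\<close> it cannot exceed \<open>h / \<rho>\<close>. This controls the length of the step without
  reference to an exact minimizer.\<close>

lemma increment_bound:
  assumes C: "C \<subseteq> V" "convex C" and V: "q \<in> V" and in_C: "c \<in> C" "w \<in> C"
    and \<rho>: "0 < \<rho>" "\<rho> \<le> 1"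
    and h: "h = D q - D (q + (w - c))"
    and opt: "\<And>v. v \<in> C \<Longrightarrow> \<rho> * (D q - D (q + (v - c))) \<le> h"
  shows "a (w - c) (w - c) \<le> 2 / \<rho> * (1 + sqrt (1 - \<rho>))\<^sup>2 * h"
proof -
  define d where "d = w - c"
  have dV: "d \<in> V" using C in_C by (auto simp: d_def intro!: V_closed)
  define r where "r = sqrt (1 - \<rho>)"
  have r: "0 \<le> r" "r\<^sup>2 = 1 - \<rho>" using \<rho> by (auto simp: r_def)
  have h0: "0 \<le> h" using opt[OF in_C(1)] by simp
  define y where "y = a d d / 2"
  have y: "0 \<le> y" using form_nonneg[OF dV] by (simp add: y_def)
  have ge1: "1 \<le> (1 + r)\<^sup>2 / \<rho>"
  proof -
    have "1 \<le> (1 + r)\<^sup>2" using r(1) by (simp add: one_le_power)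
    then show ?thesis using \<rho> by (simp add: field_simps)
  qed
  have "y \<le> (1 + r)\<^sup>2 / \<rho> * h"
  proof (cases "y \<le> h")
    case True
    also have "h \<le> (1 + r)\<^sup>2 / \<rho> * h" using mult_right_mono[OF ge1 h0] by simp
    finally show ?thesis .
  next
    case False
    then have ypos: "0 < y" using h0 by linarith
    \<comment> \<open>The maximizer of the decrease \<open>t * (h + y) - t\<^sup>2 * y\<close>; it
      is at most 1 because \<open>h < y\<close>.\<close>
    define t where "t = (h + y) / (2 * y)"
    have t: "0 \<le> t" "t \<le> 1" using False h0 ypos by (auto simp: t_def field_simps)
    have "c + t *\<^sub>R d = (1 - t) *\<^sub>R c + t *\<^sub>R w" by (simp add: d_def algebra_simps)
    then have "c + t *\<^sub>R d \<in> C" using C(2) in_C t by (simp add: convex_alt)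
    from opt[OF this] have "\<rho> * (D q - D (q + t *\<^sub>R d)) \<le> h" by simp
    moreover have "D q - D (q + t *\<^sub>R d) = t * (h + y) - t\<^sup>2 * y"
    proof -
      have "D (q + d) = D q - h" using h by (simp add: d_def)
      show ?thesis
        unfolding D_line_segment[OF V dV] \<open>D (q + d) = D q - h\<close>
        by (simp add: y_def power2_eq_square field_simps)
    qed
    moreover have "t * (h + y) - t\<^sup>2 * y = (h + y)\<^sup>2 / (4 * y)"
      using ypos by (simp add: t_def power2_eq_square field_simps)
    ultimately have "\<rho> * ((h + y)\<^sup>2 / (4 * y)) \<le> h" by simp
    then have "\<rho> * (h + y)\<^sup>2 \<le> 4 * y * h" using ypos by (simp add: field_simps)
    \<comment> \<open>A quadratic inequality in \<open>y\<close>: completing the square bounds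
      \<open>y\<close> by the larger root \<open>(2 - \<rho> + 2 * r) * h / \<rho>\<close>, whose
      numerator is \<open>(1 + r)\<^sup>2 * h\<close>.\<close>
    then have "\<rho> * (\<rho> * (h + y)\<^sup>2) \<le> \<rho> * (4 * y * h)" using \<rho> by (intro mult_left_mono) auto
    moreover have "(2 * r * h)\<^sup>2 = 4 * (1 - \<rho>) * h\<^sup>2" using r(2) by (simp add: power_mult_distrib)
    ultimately have "(\<rho> * y - (2 - \<rho>) * h)\<^sup>2 \<le> (2 * r * h)\<^sup>2"
      by (simp add: power2_eq_square algebra_simps)
    then have "\<rho> * y - (2 - \<rho>) * h \<le> 2 * r * h"
      using r(1) h0 by (intro power2_le_imp_le[of "\<rho> * y - (2 - \<rho>) * h"]) auto
    also have "2 * r * h = (1 + r)\<^sup>2 * h - (2 - \<rho>) * h"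
      using r(2) by (simp add: power2_sum left_diff_distrib[symmetric])
    finally have "\<rho> * y \<le> (1 + r)\<^sup>2 * h" by simp
    then show ?thesis using \<rho> by (simp add: field_simps)
  qed
  then show ?thesis by (simp add: y_def d_def r_def ac_simps)
qed

end

section \<open>Scalar inequalities and recursions for the gap\<close>

lemma sum_le_sqrt_card:
  fixes f :: "'a \<Rightarrow> real"
  shows "(\<Sum>i\<in>I. f i) \<le> sqrt (card I) * sqrt (\<Sum>i\<in>I. (f i)\<^sup>2)"
proof -
  have "(\<Sum>i\<in>I. f i) \<le> sqrt ((\<Sum>i\<in>I. f i)\<^sup>2)" by simp
  also have "\<dots> \<le> sqrt ((\<Sum>i\<in>I. (f i)\<^sup>2) * card I)"
    by (intro real_sqrt_le_mono sum_squared_le_sum_of_squares)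
  finally show ?thesis by (simp add: real_sqrt_mult mult.commute)
qed

text \<open>With \<open>\<alpha> = 1\<close> this is the parallel case; the term with \<open>\<alpha> - 1\<close> accounts for
  the intermediate updates of the sequential algorithm.\<close>

lemma decrease_from_model:
  fixes G \<delta> \<Phi> \<alpha> \<rho> :: real
  assumes \<rho>: "0 < \<rho>" and \<alpha>: "1 \<le> \<alpha>" and \<Phi>: "0 \<le> \<Phi>" and \<delta>: "0 \<le> \<delta>" and G: "0 \<le> G"
    and model: "\<And>t. \<lbrakk>0 \<le> t; t \<le> 1\<rbrakk> \<Longrightarrow>
      G \<ge> \<rho> * (t * \<delta> - t\<^sup>2 * \<Phi>\<^sup>2 / 2 - t * (\<alpha> - 1) * sqrt (2 * G / \<rho>) * \<Phi>)"
  shows "\<Phi>\<^sup>2 * \<alpha> \<le> \<delta> \<Longrightarrow> \<rho> * \<delta> / (2 * \<alpha>) \<le> G"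
    and "\<lbrakk>\<delta> \<le> \<Phi>\<^sup>2 * \<alpha>; 0 < \<Phi>\<rbrakk> \<Longrightarrow> \<rho> * \<delta>\<^sup>2 / (2 * \<Phi>\<^sup>2 * \<alpha>\<^sup>2) \<le> G"
proof -
  \<comment> \<open>In terms of \<open>H\<close> both claims become
    \<open>u\<^sup>2 \<le> H\<^sup>2\<close> for a suitable \<open>u\<close>.\<close>
  define H where "H = sqrt (2 * G / \<rho>)"
  have H: "0 \<le> H" "G = \<rho> * (H\<^sup>2 / 2)" using G \<rho> by (auto simp: H_def)
  have m: "t * \<delta> - t\<^sup>2 * \<Phi>\<^sup>2 / 2 - t * (\<alpha> - 1) * H * \<Phi> \<le> H\<^sup>2 / 2" if "0 \<le> t" "t \<le> 1" for t
    using model[OF that, folded H_def] \<rho> unfolding H(2) by simp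
  show "\<rho> * \<delta> / (2 * \<alpha>) \<le> G" if "\<Phi>\<^sup>2 * \<alpha> \<le> \<delta>"
  proof -
    \<comment> \<open>Far from the minimum \<open>t = 1\<close> is tested. If \<open>H < u\<close>,
      the error term is at most \<open>(\<alpha> - 1) * u\<^sup>2\<close>, and the model leaves
      \<open>u\<^sup>2 / 2 \<le> H\<^sup>2 / 2\<close>, a contradiction.\<close>
    define u where "u = sqrt (\<delta> / \<alpha>)"
    have u: "0 \<le> u" "\<delta> = u\<^sup>2 * \<alpha>" using \<alpha> \<delta> by (auto simp: u_def)
    have "\<Phi>\<^sup>2 \<le> u\<^sup>2" using that \<alpha> u(2) by simp
    then have "\<Phi> \<le> u" using u(1) by (rule power2_le_imp_le)
    have "u \<le> H"
    proof (rule ccontr)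
      assume "\<not> u \<le> H"
      then have "H < u" by simp
      have "H * \<Phi> \<le> u * u" using \<open>H < u\<close> \<open>\<Phi> \<le> u\<close> \<Phi> H(1) by (intro mult_mono) auto
      then have "(\<alpha> - 1) * (H * \<Phi>) \<le> (\<alpha> - 1) * (u * u)" using \<alpha> by (intro mult_left_mono) auto
      moreover have "\<delta> - \<Phi>\<^sup>2 / 2 - (\<alpha> - 1) * (H * \<Phi>) \<le> H\<^sup>2 / 2" using m[of 1] by (simp add: mult.assoc)
      ultimately have "u\<^sup>2 * \<alpha> - u\<^sup>2 / 2 - (\<alpha> - 1) * (u * u) \<le> H\<^sup>2 / 2"
        using \<open>\<Phi>\<^sup>2 \<le> u\<^sup>2\<close> u(2) by linarith
      then have "u\<^sup>2 \<le> H\<^sup>2" by (simp add: power2_eq_square algebra_simps)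
      then show False using \<open>H < u\<close> H(1) by (simp add: power2_le_iff_abs_le)
    qed
    then have "u\<^sup>2 \<le> H\<^sup>2" using u(1) by (simp add: power_mono)
    then show ?thesis using \<rho> \<alpha> unfolding H(2) u(2) by simp
  qed
  show "\<rho> * \<delta>\<^sup>2 / (2 * \<Phi>\<^sup>2 * \<alpha>\<^sup>2) \<le> G" if "\<delta> \<le> \<Phi>\<^sup>2 * \<alpha>" "0 < \<Phi>"
  proof -
    define u where "u = \<delta> / (\<Phi> * \<alpha>)"
    have u: "0 \<le> u" "\<delta> = u * (\<Phi> * \<alpha>)" using \<alpha> \<delta> that by (auto simp: u_def)
    \<comment> \<open>This is \<open>\<delta> / (\<Phi>\<^sup>2 * \<alpha>)\<close>, at most 1
      exactly in the near regime. With \<open>t * \<Phi> = u\<close> the same contradiction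
      arises.\<close>
    define t where "t = u / \<Phi>"
    have t: "0 \<le> t" "u = t * \<Phi>" using u that by (auto simp: t_def)
    have "t \<le> 1"
      using that \<alpha> by (simp add: t_def u_def field_simps power2_eq_square)
    have "u \<le> H"
    proof (rule ccontr)
      assume "\<not> u \<le> H"
      then have "H < u" by simp
      have "t * \<delta> = u\<^sup>2 * \<alpha>" using u(2) t(2) by (simp add: power2_eq_square)
      moreover have "t\<^sup>2 * \<Phi>\<^sup>2 = u\<^sup>2" using t(2) by (simp add: power_mult_distrib)
      moreover have "t * (\<alpha> - 1) * H * \<Phi> = (\<alpha> - 1) * (u * H)" using t(2) by simp
      moreover have "(\<alpha> - 1) * (u * H) \<le> (\<alpha> - 1) * (u * u)"
        using \<alpha> \<open>H < u\<close> u(1) by (intro mult_left_mono) auto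
      ultimately have "u\<^sup>2 * \<alpha> - u\<^sup>2 / 2 - (\<alpha> - 1) * (u * u) \<le> H\<^sup>2 / 2"
        using m[OF t(1) \<open>t \<le> 1\<close>] by linarith
      then have "u\<^sup>2 \<le> H\<^sup>2" by (simp add: power2_eq_square algebra_simps)
      then show False using \<open>H < u\<close> H(1) by (simp add: power2_le_iff_abs_le)
    qed
    then have "u\<^sup>2 \<le> H\<^sup>2" using u(1) by (simp add: power_mono)
    moreover have "\<rho> * \<delta>\<^sup>2 / (2 * \<Phi>\<^sup>2 * \<alpha>\<^sup>2) = \<rho> * (u\<^sup>2 / 2)"
      using that \<alpha> by (simp add: u_def power_divide power_mult_distrib)
    ultimately show ?thesis using \<rho> unfolding H(2) by simp
  qed
qed

text \<open>The map \<open>s - s\<^sup>2\<close> is not monotone on the unit interval, so it is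
  majorized by \<open>s / (1 + s)\<close>, which is monotone and sends \<open>1 / (k + 1)\<close> to
  \<open>1 / (k + 2)\<close>.\<close>

lemma quadratic_recursion_bound:
  fixes x :: "nat \<Rightarrow> real"
  assumes "\<And>k. 0 \<le> x k" and "x 0 \<le> 1" and "\<And>k. x (Suc k) \<le> x k - (x k)\<^sup>2"
  shows "x k \<le> 1 / (real k + 1)"
proof (induction k)
  case 0
  then show ?case using assms(2) by simp
next
  case (Suc k)
  have "(x k - (x k)\<^sup>2) * (1 + x k) = x k - x k * (x k)\<^sup>2"
    by (simp add: power2_eq_square algebra_simps)
  also have "\<dots> \<le> x k" using assms(1)[of k] by simp
  finally have "x k - (x k)\<^sup>2 \<le> x k / (1 + x k)" using assms(1)[of k] by (simp add: field_simps)
  also have "\<dots> \<le> 1 / (real (Suc k) + 1)"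
    using Suc assms(1)[of k] by (simp add: field_simps)
  finally show ?case using assms(3)[of k] by linarith
qed

lemma two_phase_rate:
  fixes \<delta> :: "nat \<Rightarrow> real" and \<rho> \<sigma> \<alpha> \<Phi> :: real
  assumes \<rho>: "0 < \<rho>" "\<rho> \<le> 1" and \<sigma>: "0 < \<sigma>" "\<sigma> \<le> 1" and \<alpha>: "1 \<le> \<alpha>" and \<Phi>: "0 \<le> \<Phi>"
    and \<delta>: "\<And>n. 0 \<le> \<delta> n"
    and far: "\<And>n. \<Phi>\<^sup>2 * \<alpha> \<le> \<delta> n \<Longrightarrow> \<delta> (Suc n) \<le> \<delta> n - \<sigma> * (\<rho> * \<delta> n / (2 * \<alpha>))"
    and near: "\<And>n. \<lbrakk>\<delta> n \<le> \<Phi>\<^sup>2 * \<alpha>; 0 < \<Phi>\<rbrakk> \<Longrightarrow>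
        \<delta> (Suc n) \<le> \<delta> n - \<sigma> * (\<rho> * (\<delta> n)\<^sup>2 / (2 * \<Phi>\<^sup>2 * \<alpha>\<^sup>2))"
    and zero: "\<And>n. \<Phi> = 0 \<Longrightarrow> \<delta> n = 0"
  defines "n\<^sub>0 \<equiv> LEAST n. \<delta> n < \<Phi>\<^sup>2 * \<alpha>"
  shows "\<delta> \<longlonglongrightarrow> 0"
    and "n \<le> n\<^sub>0 \<Longrightarrow> \<delta> n \<le> (1 - \<rho> * \<sigma> / (2 * \<alpha>)) ^ n * \<delta> 0"
    and "n\<^sub>0 \<le> n \<Longrightarrow> \<delta> n \<le> 2 * \<Phi>\<^sup>2 / (\<rho> * \<sigma>) * \<alpha>\<^sup>2 * inverse (real n - real n\<^sub>0 + 1)"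
proof -
  define \<gamma> where "\<gamma> = 1 - \<rho> * \<sigma> / (2 * \<alpha>)"
  have \<rho>\<sigma>: "0 < \<rho> * \<sigma>" "\<rho> * \<sigma> \<le> 1" using \<rho> \<sigma> by (auto intro: mult_le_one)
  then have \<gamma>: "0 \<le> \<gamma>" "\<gamma> < 1" using \<alpha> by (auto simp: \<gamma>_def field_simps)
  have step: "\<delta> (Suc n) \<le> \<gamma> * \<delta> n" if "\<Phi>\<^sup>2 * \<alpha> \<le> \<delta> n" for n
    using far[OF that] by (simp add: \<gamma>_def algebra_simps)
  \<comment> \<open>The threshold is required only at indices before \<open>n\<close>, so the linear
    bound includes \<open>n\<^sub>0\<close> itself.\<close>
  have linear: "\<delta> n \<le> \<gamma> ^ n * \<delta> 0" if "\<And>k. k < n \<Longrightarrow> \<Phi>\<^sup>2 * \<alpha> \<le> \<delta> k" for n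
    using that
  proof (induction n)
    case (Suc n)
    then have "\<delta> n \<le> \<gamma> ^ n * \<delta> 0" by simp
    then have "\<gamma> * \<delta> n \<le> \<gamma> * (\<gamma> ^ n * \<delta> 0)" using \<gamma> by (intro mult_left_mono)
    then show ?case using step[of n] Suc.prems[of n] by simp
  qed simp
  have goal: "\<delta> \<longlonglongrightarrow> 0 \<and> (\<forall>n. (n \<le> n\<^sub>0 \<longrightarrow> \<delta> n \<le> \<gamma> ^ n * \<delta> 0) \<and>
     (n\<^sub>0 \<le> n \<longrightarrow> \<delta> n \<le> 2 * \<Phi>\<^sup>2 / (\<rho> * \<sigma>) * \<alpha>\<^sup>2 * inverse (real n - real n\<^sub>0 + 1)))"
  proof (cases "\<Phi> = 0")
    \<comment> \<open>Here the set defining \<open>n\<^sub>0\<close> is empty and the least element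
      unspecified; both bounds hold for any value because the gap vanishes identically.\<close>
    case True
    then have "\<delta> = (\<lambda>_. 0)" using zero by auto
    then show ?thesis using True by auto
  next
    case False
    then have \<Phi>pos: "0 < \<Phi>" using \<Phi> by simp
    \<comment> \<open>Otherwise the linear rate would persist forever and push the gap below the
      positive threshold.\<close>
    have ex: "\<exists>n. \<delta> n < \<Phi>\<^sup>2 * \<alpha>"
    proof (rule ccontr)
      assume "\<not> ?thesis"
      then have ge: "\<And>n. \<Phi>\<^sup>2 * \<alpha> \<le> \<delta> n" by (auto simp: not_less)
      then have "\<And>n. \<Phi>\<^sup>2 * \<alpha> \<le> \<gamma> ^ n * \<delta> 0" using linear order_trans by blast
      moreover have "(\<lambda>n. \<gamma> ^ n * \<delta> 0) \<longlonglongrightarrow> 0"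
        using LIMSEQ_realpow_zero[OF \<gamma>] by (rule tendsto_mult_left_zero)
      ultimately have "\<Phi>\<^sup>2 * \<alpha> \<le> 0" by (intro LIMSEQ_le_const) auto
      moreover have "0 < \<Phi>\<^sup>2 * \<alpha>" using \<Phi>pos \<alpha> by simp
      ultimately show False by simp
    qed
    have n\<^sub>0: "\<delta> n\<^sub>0 < \<Phi>\<^sup>2 * \<alpha>" unfolding n\<^sub>0_def by (rule LeastI_ex[OF ex])
    have before: "\<Phi>\<^sup>2 * \<alpha> \<le> \<delta> k" if "k < n\<^sub>0" for k
      using not_less_Least[of k "\<lambda>n. \<delta> n < \<Phi>\<^sup>2 * \<alpha>"] that by (simp add: n\<^sub>0_def)
    \<comment> \<open>Scaling by \<open>c\<close> normalizes the near recursion to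
      \<open>x - x\<^sup>2\<close>. At \<open>n\<^sub>0\<close> the scaled gap is at most
      \<open>\<rho> * \<sigma> / (2 * \<alpha>)\<close>, hence at most 1, and \<open>1 / c\<close>
      is the constant of the sublinear bound.\<close>
    define c where "c = \<rho> * \<sigma> / (2 * \<Phi>\<^sup>2 * \<alpha>\<^sup>2)"
    have cpos: "0 < c" using \<rho>\<sigma> \<Phi>pos \<alpha> by (simp add: c_def)
    have after: "\<delta> (n\<^sub>0 + k) < \<Phi>\<^sup>2 * \<alpha>" for k
    proof (induction k)
      case (Suc k)
      have "0 \<le> \<sigma> * (\<rho> * (\<delta> (n\<^sub>0 + k))\<^sup>2 / (2 * \<Phi>\<^sup>2 * \<alpha>\<^sup>2))" using \<sigma> \<rho> by simp
      then show ?case using near[of "n\<^sub>0 + k"] Suc \<Phi>pos by simp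
    qed (use n\<^sub>0 in simp)
    have rate: "c * \<delta> (n\<^sub>0 + k) \<le> 1 / (real k + 1)" for k
    proof (rule quadratic_recursion_bound)
      show "0 \<le> c * \<delta> (n\<^sub>0 + k)" for k using cpos \<delta> by simp
      have "c * \<delta> (n\<^sub>0 + 0) \<le> c * (\<Phi>\<^sup>2 * \<alpha>)" using n\<^sub>0 cpos by simp
      also have "\<dots> = \<rho> * \<sigma> / (2 * \<alpha>)"
        using \<Phi>pos \<alpha> by (simp add: c_def power2_eq_square)
      also have "\<dots> \<le> 1" using \<rho>\<sigma> \<alpha> by (simp add: field_simps)
      finally show "c * \<delta> (n\<^sub>0 + 0) \<le> 1" .
      fix k
      have "\<delta> (n\<^sub>0 + Suc k) \<le> \<delta> (n\<^sub>0 + k) - c * (\<delta> (n\<^sub>0 + k))\<^sup>2"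
        using near[of "n\<^sub>0 + k"] after[of k] \<Phi>pos by (simp add: c_def ac_simps)
      then have "c * \<delta> (n\<^sub>0 + Suc k) \<le> c * (\<delta> (n\<^sub>0 + k) - c * (\<delta> (n\<^sub>0 + k))\<^sup>2)"
        using cpos by simp
      then show "c * \<delta> (n\<^sub>0 + Suc k) \<le> c * \<delta> (n\<^sub>0 + k) - (c * \<delta> (n\<^sub>0 + k))\<^sup>2"
        by (simp add: power2_eq_square algebra_simps)
    qed
    have bound: "\<delta> (n\<^sub>0 + k) \<le> 1 / c * (1 / (real k + 1))" for k
      using mult_left_mono[OF rate[of k], of "1 / c"] cpos by simp
    have "(\<lambda>k. 1 / c * (1 / (real k + 1))) \<longlonglongrightarrow> 1 / c * 0"
      by (intro tendsto_mult tendsto_const) (use LIMSEQ_inverse_real_of_nat in \<open>simp add: inverse_eq_divide add.commute\<close>)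
    then have lim: "(\<lambda>k. 1 / c * (1 / (real k + 1))) \<longlonglongrightarrow> 0" by simp
    have "(\<lambda>k. \<delta> (k + n\<^sub>0)) \<longlonglongrightarrow> 0"
      by (rule tendsto_sandwich[OF always_eventually always_eventually tendsto_const lim])
        (use \<delta> bound in \<open>auto simp only: add.commute\<close>)
    then have "\<delta> \<longlonglongrightarrow> 0" by (rule LIMSEQ_offset)
    moreover have "\<delta> n \<le> 2 * \<Phi>\<^sup>2 / (\<rho> * \<sigma>) * \<alpha>\<^sup>2 * inverse (real n - real n\<^sub>0 + 1)" if "n\<^sub>0 \<le> n" for n
    proof -
      have "1 / c = 2 * \<Phi>\<^sup>2 / (\<rho> * \<sigma>) * \<alpha>\<^sup>2" by (simp add: c_def)
      then show ?thesis
        using bound[of "n - n\<^sub>0"] that by (simp add: of_nat_diff inverse_eq_divide)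
    qed
    ultimately show ?thesis using linear before by auto
  qed
  show "\<delta> \<longlonglongrightarrow> 0" using goal by blast
  show "n \<le> n\<^sub>0 \<Longrightarrow> \<delta> n \<le> (1 - \<rho> * \<sigma> / (2 * \<alpha>)) ^ n * \<delta> 0"
    using goal by (simp add: \<gamma>_def)
  show "n\<^sub>0 \<le> n \<Longrightarrow> \<delta> n \<le> 2 * \<Phi>\<^sup>2 / (\<rho> * \<sigma>) * \<alpha>\<^sup>2 * inverse (real n - real n\<^sub>0 + 1)"
    using goal by blast
qed

section \<open>Decomposition algorithms\<close>

lemma surrogate_approx_mem: "\<lbrakk>surrogate_approx \<Lambda> A D C N q c w\<^sub>0 v; 1 \<le> N\<rbrakk> \<Longrightarrow> v \<in> C"
  by (cases N) (auto simp: surrogate_approx_def is_arg_min_def)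

text \<open>The \<eta> of the theorem is at most the rate \<open>1 / (\<kappa> + 1)\<close> obtained
  from the segment test: \<open>\<kappa> + 1 \<le> 4 * \<kappa>\<close> if
  \<open>\<kappa> \<ge> 1/2\<close>, and \<open>1 - \<kappa> \<le> 1 / (\<kappa> + 1)\<close>
  otherwise.\<close>

lemma surrogate_rate:
  fixes \<kappa> \<eta> :: real
  assumes \<kappa>: "0 \<le> \<kappa>" and \<eta>: "\<eta> = (if \<kappa> \<ge> 1/2 then 1 / (4 * \<kappa>) else 1 - \<kappa>)"
  shows "0 < \<eta>" "\<kappa> / (\<kappa> + 1) \<le> 1 - \<eta>"
  using \<kappa> unfolding \<eta> by (auto simp: field_simps)

locale decomposition = quadratic_objective V a l D c\<^sub>0
  for V :: "'v::real_vector set" and a l D c\<^sub>0 +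
  fixes K :: "'v set" and \<theta> :: "nat \<Rightarrow> 'v \<Rightarrow> 'v" and M :: nat
  assumes K_subset: "K \<subseteq> V" and K_convex: "convex K" and M_pos: "1 \<le> M"
    and \<theta>_mem: "\<lbrakk>i \<in> {1..M}; x \<in> V\<rbrakk> \<Longrightarrow> \<theta> i x \<in> V"
    and \<theta>_add: "\<lbrakk>i \<in> {1..M}; x \<in> V; y \<in> V\<rbrakk> \<Longrightarrow> \<theta> i (x + y) = \<theta> i x + \<theta> i y"
    and \<theta>_scale: "\<lbrakk>i \<in> {1..M}; x \<in> V\<rbrakk> \<Longrightarrow> \<theta> i (r *\<^sub>R x) = r *\<^sub>R \<theta> i x"
    and \<theta>_sum: "x \<in> V \<Longrightarrow> (\<Sum>i=1..M. \<theta> i x) = x"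
    and K_sum: "K = {\<Sum>i=1..M. \<theta> i (q i) | q. \<forall>i\<in>{1..M}. q i \<in> K}"
begin

lemma \<theta>_diff: "\<lbrakk>i \<in> {1..M}; x \<in> V; y \<in> V\<rbrakk> \<Longrightarrow> \<theta> i (x - y) = \<theta> i x - \<theta> i y"
  using \<theta>_add[of i "x - y" y] by (simp add: V_closed)

lemma \<theta>_K_subset: "i \<in> {1..M} \<Longrightarrow> \<theta> i ` K \<subseteq> V"
  using \<theta>_mem K_subset by auto

lemma \<theta>_K_convex:
  assumes i: "i \<in> {1..M}" shows "convex (\<theta> i ` K)"
proof (rule convexI)
  fix x y :: 'v and u v :: real
  assume "x \<in> \<theta> i ` K" "y \<in> \<theta> i ` K" and uv: "0 \<le> u" "0 \<le> v" "u + v = 1"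
  then obtain x' y' where *: "x' \<in> K" "y' \<in> K" "x = \<theta> i x'" "y = \<theta> i y'" by auto
  then have "u *\<^sub>R x + v *\<^sub>R y = \<theta> i (u *\<^sub>R x' + v *\<^sub>R y')"
    using K_subset i by (simp add: \<theta>_add \<theta>_scale V_closed subset_eq)
  moreover have "u *\<^sub>R x' + v *\<^sub>R y' \<in> K" using K_convex * uv by (simp add: convex_def)
  ultimately show "u *\<^sub>R x + v *\<^sub>R y \<in> \<theta> i ` K" by blast
qed

lemma sum_\<theta>_K_mem:
  assumes "\<And>i. i \<in> {1..M} \<Longrightarrow> v i \<in> \<theta> i ` K"
  shows "(\<Sum>i=1..M. v i) \<in> K"
proof -
  obtain q where q: "\<And>i. i \<in> {1..M} \<Longrightarrow> q i \<in> K \<and> v i = \<theta> i (q i)"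
    using assms unfolding image_iff Bex_def by metis
  then have "(\<Sum>i=1..M. v i) = (\<Sum>i=1..M. \<theta> i (q i))" by (intro sum.cong) auto
  then show ?thesis by (subst K_sum) (use q in auto)
qed

lemma comparison_element:
  assumes "x \<in> K" "y \<in> K" "i \<in> {1..M}" "0 \<le> t" "t \<le> 1"
  shows "\<theta> i x + t *\<^sub>R \<theta> i (y - x) \<in> \<theta> i ` K"
proof -
  have "\<theta> i x + t *\<^sub>R \<theta> i (y - x) = \<theta> i ((1 - t) *\<^sub>R x + t *\<^sub>R y)"
    using assms K_subset by (simp add: \<theta>_add \<theta>_scale \<theta>_diff V_closed subset_eq algebra_simps)
  moreover have "(1 - t) *\<^sub>R x + t *\<^sub>R y \<in> K" using K_convex assms by (simp add: convex_alt)
  ultimately show ?thesis by blast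
qed

lemma dD_le_gap:
  assumes "x \<in> V" "y \<in> V"
  shows "D x - D y \<le> - dD x (y - x)"
  using D_add[of x "y - x"] form_nonneg[of "y - x"] assms by (simp add: V_closed)

text \<open>The partition of the identity reassembles the full derivative from the subproblem
  directions.\<close>

lemma dD_sum_\<theta>:
  assumes "x \<in> V" "d \<in> V"
  shows "(\<Sum>i=1..M. dD x (\<theta> i d)) = dD x d"
  using dD_sum[of "{1..M}" "\<lambda>i. \<theta> i d" x] assms \<theta>_mem \<theta>_sum[of d] by simp

text \<open>The update moves from \<open>x\<close> by the fraction \<open>\<sigma> * M\<close>
  towards the mean of the points reached by the undamped subproblem steps. The bound
  \<open>1 / M\<close> on \<sigma> makes this a convex combination, so convexity applies twice: to
  the mean and to the segment.\<close>

lemma parallel_step: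
  assumes x: "x \<in> K" and y: "y \<in> K" and \<sigma>: "0 < \<sigma>" "\<sigma> \<le> 1 / real M" and \<rho>: "0 \<le> \<rho>"
    and v: "\<And>i. i \<in> {1..M} \<Longrightarrow> v i \<in> \<theta> i ` K"
    and opt: "\<And>i u. \<lbrakk>i \<in> {1..M}; u \<in> \<theta> i ` K\<rbrakk> \<Longrightarrow>
      \<rho> * (D x - D (x + (u - \<theta> i x))) \<le> D x - D (x + (v i - \<theta> i x))"
    and \<Phi>: "(\<Sum>i=1..M. a (\<theta> i (y - x)) (\<theta> i (y - x))) \<le> \<Phi>\<^sup>2"
  defines "G \<equiv> \<Sum>i=1..M. D x - D (x + (v i - \<theta> i x))"
  shows "D (x + (\<Sum>i=1..M. \<sigma> *\<^sub>R (v i - \<theta> i x))) \<le> D x - \<sigma> * G" and "0 \<le> G"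
    and "\<lbrakk>0 \<le> t; t \<le> 1\<rbrakk> \<Longrightarrow> \<rho> * (t * (D x - D y) - t\<^sup>2 * \<Phi>\<^sup>2 / 2) \<le> G"
proof -
  have V: "x \<in> V" "y \<in> V" "\<And>i. i \<in> {1..M} \<Longrightarrow> v i \<in> V" "\<And>i. i \<in> {1..M} \<Longrightarrow> \<theta> i x \<in> V"
    "\<And>i. i \<in> {1..M} \<Longrightarrow> \<theta> i (y - x) \<in> V"
    using x y K_subset subsetD[OF \<theta>_K_subset v] by (auto intro!: \<theta>_mem V_closed)
  have MM: "real M \<noteq> 0" "0 < real M" using M_pos by auto
  define w where "w i = x + (v i - \<theta> i x)" for i
  have wV: "w i \<in> V" if "i \<in> {1..M}" for i using V that by (simp add: w_def V_closed)
  define m where "m = (\<Sum>i=1..M. (1 / real M) *\<^sub>R w i)"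
  have mV: "m \<in> V" using wV by (auto simp: m_def intro!: V_closed)
  have "D m \<le> (\<Sum>i=1..M. 1 / real M * D (w i))"
    unfolding m_def using M_pos wV by (intro convex_on_sum[OF _ _ D_convex]) auto
  then have Dm: "real M * D m \<le> (\<Sum>i=1..M. D (w i))"
    using MM by (simp add: sum_divide_distrib[symmetric] field_simps)
  have "m = (1 / real M) *\<^sub>R (\<Sum>i=1..M. w i)" by (simp add: m_def scaleR_sum_right)
  also have "(\<Sum>i=1..M. w i) = real M *\<^sub>R x + (\<Sum>i=1..M. v i - \<theta> i x)"
    by (simp only: w_def sum.distrib sum_constant_scaleR) simp
  finally have "m - x = (1 / real M) *\<^sub>R (\<Sum>i=1..M. v i - \<theta> i x)"
    using MM by (simp add: scaleR_add_right)
  then have "(\<Sum>i=1..M. \<sigma> *\<^sub>R (v i - \<theta> i x)) = (\<sigma> * real M) *\<^sub>R (m - x)"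
    using MM by (simp only: scaleR_sum_right[symmetric]) simp
  moreover have "0 \<le> \<sigma> * real M" "\<sigma> * real M \<le> 1" using \<sigma> MM by (auto simp: field_simps)
  ultimately have "D (x + (\<Sum>i=1..M. \<sigma> *\<^sub>R (v i - \<theta> i x))) \<le> (1 - \<sigma> * real M) * D x + \<sigma> * (real M * D m)"
    using D_line_le[of x "m - x" "\<sigma> * real M"] V mV by (simp add: V_closed mult.assoc)
  also have "\<dots> \<le> (1 - \<sigma> * real M) * D x + \<sigma> * (\<Sum>i=1..M. D (w i))"
    using Dm \<sigma> by simp
  also have "\<dots> = D x - \<sigma> * G" by (simp add: G_def w_def sum_subtractf algebra_simps)
  finally show "D (x + (\<Sum>i=1..M. \<sigma> *\<^sub>R (v i - \<theta> i x))) \<le> D x - \<sigma> * G" .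
  \<comment> \<open>The zero increment is itself a competitor, so no subproblem increases
    \<open>D\<close>.\<close>
  show "0 \<le> G"
    unfolding G_def using opt[of _ "\<theta> _ x"] x by (intro sum_nonneg) force
  show "\<rho> * (t * (D x - D y) - t\<^sup>2 * \<Phi>\<^sup>2 / 2) \<le> G" if t: "0 \<le> t" "t \<le> 1"
  proof -
    define e where "e i = \<theta> i (y - x)" for i
    have "\<rho> * (\<Sum>i=1..M. - t * dD x (e i) - t\<^sup>2 / 2 * a (e i) (e i)) \<le> G"
      unfolding G_def sum_distrib_left
    proof (rule sum_mono)
      fix i assume i: "i \<in> {1..M}"
      have "D x - D (x + t *\<^sub>R e i) = - t * dD x (e i) - t\<^sup>2 / 2 * a (e i) (e i)"
        using D_line[of x "e i" t] V i by (simp add: e_def)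
      then show "\<rho> * (- t * dD x (e i) - t\<^sup>2 / 2 * a (e i) (e i)) \<le> D x - D (x + (v i - \<theta> i x))"
        using opt[OF i comparison_element[OF x y i t]] by (simp add: e_def)
    qed
    moreover have "(\<Sum>i=1..M. - t * dD x (e i) - t\<^sup>2 / 2 * a (e i) (e i)) =
        - t * dD x (y - x) - t\<^sup>2 / 2 * (\<Sum>i=1..M. a (e i) (e i))"
      using dD_sum_\<theta>[of x "y - x"] V
      by (simp add: e_def sum_subtractf sum_negf sum_distrib_left[symmetric]
          sum_divide_distrib[symmetric] V_closed)
    moreover have "t * (D x - D y) \<le> t * (- dD x (y - x))"
      using dD_le_gap[OF V(1,2)] t(1) by (rule mult_left_mono)
    moreover have "t\<^sup>2 / 2 * (\<Sum>i=1..M. a (e i) (e i)) \<le> t\<^sup>2 / 2 * \<Phi>\<^sup>2"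
      using \<Phi> by (intro mult_left_mono) (auto simp: e_def)
    ultimately have "t * (D x - D y) - t\<^sup>2 * \<Phi>\<^sup>2 / 2 \<le>
        (\<Sum>i=1..M. - t * dD x (e i) - t\<^sup>2 / 2 * a (e i) (e i))" by linarith
    then have "\<rho> * (t * (D x - D y) - t\<^sup>2 * \<Phi>\<^sup>2 / 2) \<le>
        \<rho> * (\<Sum>i=1..M. - t * dD x (e i) - t\<^sup>2 / 2 * a (e i) (e i))"
      using \<rho> by (rule mult_left_mono)
    then show ?thesis using \<open>\<rho> * (\<Sum>i=1..M. _ i) \<le> G\<close> by linarith
  qed
qed

lemma sequential_partial_sum:
  assumes "\<And>i. i \<in> {1..M} \<Longrightarrow> q i = q (i - 1) + \<sigma> *\<^sub>R (v i - \<theta> i x)" "q 0 = x" "k \<le> M"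
  shows "q k = x + (\<Sum>i=1..k. \<sigma> *\<^sub>R (v i - \<theta> i x))"
  using assms(3)
proof (induction k)
  case (Suc k)
  then show ?case using assms(1)[of "Suc k"] by (simp add: add.assoc)
qed (use assms in simp)

text \<open>\<open>G\<close> adds the decreases of undamped subproblem steps. Convexity along each
  step secures the fraction \<sigma> of its decrease, and these fractions telescope over the
  intermediate iterates.\<close>

lemma sequential_step:
  assumes x: "x \<in> K" and y: "y \<in> K" and \<sigma>: "0 < \<sigma>" "\<sigma> \<le> 1" and \<rho>: "0 < \<rho>" "\<rho> \<le> 1"
    and v: "\<And>i. i \<in> {1..M} \<Longrightarrow> v i \<in> \<theta> i ` K"
    and q0: "q 0 = x"
    and q: "\<And>i. i \<in> {1..M} \<Longrightarrow> q i = q (i - 1) + \<sigma> *\<^sub>R (v i - \<theta> i x)"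
    and opt: "\<And>i u. \<lbrakk>i \<in> {1..M}; u \<in> \<theta> i ` K\<rbrakk> \<Longrightarrow>
      \<rho> * (D (q (i - 1)) - D (q (i - 1) + (u - \<theta> i x))) \<le> D (q (i - 1)) - D (q (i - 1) + (v i - \<theta> i x))"
    and \<Phi>: "(\<Sum>i=1..M. a (\<theta> i (y - x)) (\<theta> i (y - x))) \<le> \<Phi>\<^sup>2" "0 \<le> \<Phi>"
  defines "G \<equiv> \<Sum>i=1..M. D (q (i - 1)) - D (q (i - 1) + (v i - \<theta> i x))"
  shows "D (q M) \<le> D x - \<sigma> * G" and "0 \<le> G"
    and "\<lbrakk>0 \<le> t; t \<le> 1\<rbrakk> \<Longrightarrow> \<rho> * (t * (D x - D y) - t\<^sup>2 * \<Phi>\<^sup>2 / 2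
        - t * (real M * \<sigma> * (1 + sqrt (1 - \<rho>))) * sqrt (2 * G / \<rho>) * \<Phi>) \<le> G"
proof -
  define g where "g i = D (q (i - 1)) - D (q (i - 1) + (v i - \<theta> i x))" for i
  have V: "x \<in> V" "y \<in> V" "\<And>i. i \<in> {1..M} \<Longrightarrow> v i \<in> V" "\<And>i. i \<in> {1..M} \<Longrightarrow> \<theta> i x \<in> V"
    "\<And>i. i \<in> {1..M} \<Longrightarrow> \<theta> i (y - x) \<in> V"
    using x y K_subset subsetD[OF \<theta>_K_subset v] by (auto intro!: \<theta>_mem V_closed)
  have q_sum: "q k = x + (\<Sum>i=1..k. \<sigma> *\<^sub>R (v i - \<theta> i x))" if "k \<le> M" for k
    using sequential_partial_sum[of q \<sigma> v x] q q0 that by blast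
  have qV: "q k \<in> V" if "k \<le> M" for k
    unfolding q_sum[OF that] using V that by (auto intro!: V_closed)
  have g: "0 \<le> g i" if "i \<in> {1..M}" for i
    unfolding g_def using opt[OF that, of "\<theta> i x"] x by simp
  show G0: "0 \<le> G" unfolding G_def g_def[symmetric] by (intro sum_nonneg g)
  have "D (q k) \<le> D x - \<sigma> * (\<Sum>i=1..k. g i)" if "k \<le> M" for k
    using that
  proof (induction k)
    case (Suc k)
    have i: "Suc k \<in> {1..M}" using Suc.prems by simp
    have "D (q (Suc k)) \<le> (1 - \<sigma>) * D (q k) + \<sigma> * D (q k + (v (Suc k) - \<theta> (Suc k) x))"
      using D_line_le[of "q k" "v (Suc k) - \<theta> (Suc k) x" \<sigma>] q[OF i] qV[of k] V(3,4)[OF i] \<sigma> Suc.prems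
      by (simp add: V_closed)
    also have "\<dots> = D (q k) - \<sigma> * g (Suc k)" by (simp add: g_def algebra_simps)
    finally show ?case using Suc by (simp add: algebra_simps)
  qed (use q0 in simp)
  from this[of M] show "D (q M) \<le> D x - \<sigma> * G" by (simp add: G_def g_def)
  show "\<rho> * (t * (D x - D y) - t\<^sup>2 * \<Phi>\<^sup>2 / 2
        - t * (real M * \<sigma> * (1 + sqrt (1 - \<rho>))) * sqrt (2 * G / \<rho>) * \<Phi>) \<le> G"
    if t: "0 \<le> t" "t \<le> 1"
  proof -
    define e where "e i = \<theta> i (y - x)" for i
    have eV: "e i \<in> V" if "i \<in> {1..M}" for i using V that by (simp add: e_def)
    define \<xi> where "\<xi> i = sqrt (a (v i - \<theta> i x) (v i - \<theta> i x))" for i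
    have \<xi>0: "0 \<le> \<xi> i" if "i \<in> {1..M}" for i
      using V that form_nonneg by (simp add: \<xi>_def V_closed)
    \<comment> \<open>The mismatch between the derivatives at \<open>q (i - 1)\<close> and at
      \<open>x\<close> in direction \<open>e i\<close>.\<close>
    define c where "c i = a (q (i - 1) - x) (e i)" for i
    have c_le: "c i \<le> \<sigma> * (\<Sum>j=1..M. \<xi> j) * sqrt (a (e i) (e i))" if i: "i \<in> {1..M}" for i
    proof -
      have sub: "{1..i - 1} \<subseteq> {1..M}" "i - 1 \<le> M" using i by auto
      have step: "v j - \<theta> j x \<in> V" if "j \<in> {1..i - 1}" for j
        using V(3,4)[of j] subsetD[OF sub(1) that] by (simp add: V_closed)
      have "c i = a (\<Sum>j=1..i-1. \<sigma> *\<^sub>R (v j - \<theta> j x)) (e i)"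
        unfolding c_def q_sum[OF sub(2)] by simp
      also have "\<dots> = (\<Sum>j=1..i-1. a (\<sigma> *\<^sub>R (v j - \<theta> j x)) (e i))"
        by (intro form_sum_left eV i subspace_scale[OF subspace_V] step)
      also have "\<dots> = (\<Sum>j=1..i-1. \<sigma> * a (v j - \<theta> j x) (e i))"
        by (intro sum.cong refl form_scale eV i step)
      also have "\<dots> \<le> (\<Sum>j=1..i-1. \<sigma> * (\<xi> j * sqrt (a (e i) (e i))))"
      proof (rule sum_mono)
        fix j assume "j \<in> {1..i - 1}"
        then have j: "j \<in> {1..M}" using sub by blast
        show "\<sigma> * a (v j - \<theta> j x) (e i) \<le> \<sigma> * (\<xi> j * sqrt (a (e i) (e i)))"
          using form_Cauchy_Schwarz[of "v j - \<theta> j x" "e i"] V(3,4)[OF j] eV[OF i] \<sigma>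
          by (simp add: \<xi>_def V_closed)
      qed
      \<comment> \<open>Adding the nonnegative later terms makes the bound uniform in
        \<open>i\<close>, so that the double sum over \<open>i\<close> and \<open>j\<close>
        factors.\<close>
      also have "\<dots> \<le> (\<Sum>j=1..M. \<sigma> * (\<xi> j * sqrt (a (e i) (e i))))"
        using sub \<sigma> \<xi>0 form_nonneg[OF eV[OF i]] by (intro sum_mono2) auto
      finally show ?thesis by (simp add: sum_distrib_left sum_distrib_right mult.assoc)
    qed
    define s where "s = 1 + sqrt (1 - \<rho>)"
    have s: "0 \<le> s" using \<rho> by (simp add: s_def)
    \<comment> \<open>These are the lengths of undamped increments; the damping \<sigma> is already
      accounted for in \<open>c_le\<close>.\<close>
    have \<xi>_sum: "(\<Sum>j=1..M. \<xi> j) \<le> sqrt M * (s * sqrt (2 * G / \<rho>))"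
    proof -
      have "(\<xi> j)\<^sup>2 \<le> 2 / \<rho> * s\<^sup>2 * g j" if j: "j \<in> {1..M}" for j
      proof -
        have "a (v j - \<theta> j x) (v j - \<theta> j x) \<le> 2 / \<rho> * (1 + sqrt (1 - \<rho>))\<^sup>2 * g j"
          by (rule increment_bound[OF \<theta>_K_subset[OF j] \<theta>_K_convex[OF j] _ _ v[OF j] \<rho>, of "q (j - 1)"])
            (use j qV x opt[OF j] in \<open>auto simp: g_def\<close>)
        then show ?thesis using form_nonneg[of "v j - \<theta> j x"] V j by (simp add: \<xi>_def s_def V_closed)
      qed
      then have "(\<Sum>j=1..M. (\<xi> j)\<^sup>2) \<le> (\<Sum>j=1..M. 2 / \<rho> * s\<^sup>2 * g j)" by (rule sum_mono)
      also have "\<dots> = 2 / \<rho> * s\<^sup>2 * (\<Sum>j=1..M. g j)" by (rule sum_distrib_left[symmetric])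
      also have "\<dots> = s\<^sup>2 * (2 * G / \<rho>)" by (simp add: G_def g_def)
      finally have "sqrt (\<Sum>j=1..M. (\<xi> j)\<^sup>2) \<le> sqrt (s\<^sup>2 * (2 * G / \<rho>))" by simp
      also have "\<dots> = s * sqrt (2 * G / \<rho>)"
        using s by (simp only: real_sqrt_mult real_sqrt_abs abs_of_nonneg)
      finally have "sqrt M * sqrt (\<Sum>j=1..M. (\<xi> j)\<^sup>2) \<le> sqrt M * (s * sqrt (2 * G / \<rho>))"
        by (intro mult_left_mono) auto
      then show ?thesis using sum_le_sqrt_card[of \<xi> "{1..M}"] by simp
    qed
    have e_sum: "(\<Sum>i=1..M. sqrt (a (e i) (e i))) \<le> sqrt M * \<Phi>"
    proof -
      have "(\<Sum>i=1..M. (sqrt (a (e i) (e i)))\<^sup>2) = (\<Sum>i=1..M. a (e i) (e i))"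
        using form_nonneg[OF eV] by (intro sum.cong) auto
      then have "sqrt (\<Sum>i=1..M. (sqrt (a (e i) (e i)))\<^sup>2) \<le> \<Phi>"
        using \<Phi> by (simp add: e_def real_le_lsqrt)
      then have "sqrt M * sqrt (\<Sum>i=1..M. (sqrt (a (e i) (e i)))\<^sup>2) \<le> sqrt M * \<Phi>"
        by (intro mult_left_mono) auto
      then show ?thesis using sum_le_sqrt_card[of "\<lambda>i. sqrt (a (e i) (e i))" "{1..M}"] by simp
    qed
    have c_sum: "(\<Sum>i=1..M. c i) \<le> real M * \<sigma> * s * sqrt (2 * G / \<rho>) * \<Phi>"
    proof -
      have "(\<Sum>i=1..M. c i) \<le> \<sigma> * (\<Sum>j=1..M. \<xi> j) * (\<Sum>i=1..M. sqrt (a (e i) (e i)))"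
        unfolding sum_distrib_left by (intro sum_mono c_le[unfolded sum_distrib_left])
      also have "\<dots> \<le> \<sigma> * (sqrt M * (s * sqrt (2 * G / \<rho>))) * (sqrt M * \<Phi>)"
        using \<xi>_sum e_sum \<sigma> \<rho> s G0 \<xi>0 form_nonneg[OF eV]
        by (intro mult_mono mult_nonneg_nonneg sum_nonneg) auto
      also have "\<dots> = (sqrt M * sqrt M) * \<sigma> * s * sqrt (2 * G / \<rho>) * \<Phi>" by (simp only: ac_simps)
      finally show ?thesis by simp
    qed
    have "\<rho> * (\<Sum>i=1..M. - t * dD x (e i) - t * c i - t\<^sup>2 / 2 * a (e i) (e i)) \<le> G"
      unfolding G_def sum_distrib_left
    proof (rule sum_mono)
      fix i assume i: "i \<in> {1..M}"
      then have qi: "q (i - 1) \<in> V" by (intro qV) auto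
      have "D (q (i - 1)) - D (q (i - 1) + t *\<^sub>R e i) = - t * dD x (e i) - t * c i - t\<^sup>2 / 2 * a (e i) (e i)"
        using D_line[OF qi eV[OF i], of t] dD_diff[OF qi V(1) eV[OF i]]
        by (simp add: c_def algebra_simps)
      then show "\<rho> * (- t * dD x (e i) - t * c i - t\<^sup>2 / 2 * a (e i) (e i))
          \<le> D (q (i - 1)) - D (q (i - 1) + (v i - \<theta> i x))"
        using opt[OF i comparison_element[OF x y i t]] by (simp add: e_def)
    qed
    moreover have "(\<Sum>i=1..M. - t * dD x (e i) - t * c i - t\<^sup>2 / 2 * a (e i) (e i)) =
        - t * dD x (y - x) - t * (\<Sum>i=1..M. c i) - t\<^sup>2 / 2 * (\<Sum>i=1..M. a (e i) (e i))"
      using dD_sum_\<theta>[of x "y - x"] V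
      by (simp add: e_def sum_subtractf sum_negf sum_distrib_left[symmetric]
          sum_divide_distrib[symmetric] V_closed)
    moreover have "t * (D x - D y) \<le> t * (- dD x (y - x))"
      using dD_le_gap[OF V(1,2)] t(1) by (rule mult_left_mono)
    moreover have "t\<^sup>2 / 2 * (\<Sum>i=1..M. a (e i) (e i)) \<le> t\<^sup>2 / 2 * \<Phi>\<^sup>2"
      using \<Phi> by (intro mult_left_mono) (auto simp: e_def)
    moreover have "t * (\<Sum>i=1..M. c i) \<le> t * (real M * \<sigma> * s * sqrt (2 * G / \<rho>) * \<Phi>)"
      using c_sum t(1) by (rule mult_left_mono)
    ultimately have "t * (D x - D y) - t\<^sup>2 * \<Phi>\<^sup>2 / 2 - t * (real M * \<sigma> * s) * sqrt (2 * G / \<rho>) * \<Phi> \<le>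
        (\<Sum>i=1..M. - t * dD x (e i) - t * c i - t\<^sup>2 / 2 * a (e i) (e i))"
      by (simp add: mult.assoc)
    then have "\<rho> * (t * (D x - D y) - t\<^sup>2 * \<Phi>\<^sup>2 / 2 - t * (real M * \<sigma> * s) * sqrt (2 * G / \<rho>) * \<Phi>) \<le>
        \<rho> * (\<Sum>i=1..M. - t * dD x (e i) - t * c i - t\<^sup>2 / 2 * a (e i) (e i))"
      using \<rho> by (intro mult_left_mono) auto
    then show ?thesis using \<open>\<rho> * (\<Sum>i=1..M. _ i) \<le> G\<close> by (simp add: s_def)
  qed
qed

lemma partial_update_mem:
  assumes x: "x \<in> K" and v: "\<And>i. i \<in> {1..M} \<Longrightarrow> v i \<in> \<theta> i ` K" and \<sigma>: "0 \<le> \<sigma>" "\<sigma> \<le> 1" and k: "k \<le> M"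
  shows "x + (\<Sum>i=1..k. \<sigma> *\<^sub>R (v i - \<theta> i x)) \<in> K"
proof -
  define u where "u i = (if i \<le> k then (1 - \<sigma>) *\<^sub>R \<theta> i x + \<sigma> *\<^sub>R v i else \<theta> i x)" for i
  have "(\<Sum>i=1..M. u i) \<in> K"
  proof (rule sum_\<theta>_K_mem)
    fix i assume i: "i \<in> {1..M}"
    show "u i \<in> \<theta> i ` K"
      using convexD_alt[OF \<theta>_K_convex[OF i] _ v[OF i] \<sigma>, of "\<theta> i x"] x by (simp add: u_def)
  qed
  moreover have "(\<Sum>i=1..M. u i) = (\<Sum>i=1..M. \<theta> i x) + (\<Sum>i=1..M. if i \<le> k then \<sigma> *\<^sub>R (v i - \<theta> i x) else 0)"
    unfolding sum.distrib[symmetric] by (intro sum.cong) (auto simp: u_def algebra_simps)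
  moreover have "(\<Sum>i=1..M. if i \<le> k then \<sigma> *\<^sub>R (v i - \<theta> i x) else 0) = (\<Sum>i=1..k. \<sigma> *\<^sub>R (v i - \<theta> i x))"
    using k by (intro sum.mono_neutral_cong_right) auto
  ultimately show ?thesis using \<theta>_sum[of x] x K_subset by auto
qed

text \<open>This settles \<Phi> = 0. Components of zero energy are orthogonal to everything by
  Cauchy-Schwarz, and \<open>null\<close> removes their linear part, so \<open>D\<close> has neither
  slope nor curvature along \<open>y - x\<close>.\<close>

lemma D_eq_if_degenerate:
  assumes V: "x \<in> V" "y \<in> V" and null: "\<And>z. \<lbrakk>z \<in> V; a z z = 0\<rbrakk> \<Longrightarrow> l z = 0"
    and zero: "(\<Sum>i=1..M. a (\<theta> i (y - x)) (\<theta> i (y - x))) \<le> 0"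
  shows "D x = D y"
proof -
  define d where "d = y - x"
  have d: "d \<in> V" "\<And>i. i \<in> {1..M} \<Longrightarrow> \<theta> i d \<in> V" using V \<theta>_mem by (auto simp: d_def V_closed)
  have nonneg: "\<And>i. i \<in> {1..M} \<Longrightarrow> 0 \<le> a (\<theta> i d) (\<theta> i d)" using form_nonneg d by blast
  then have "(\<Sum>i=1..M. a (\<theta> i d) (\<theta> i d)) = 0"
    using zero sum_nonneg[of "{1..M}" "\<lambda>i. a (\<theta> i d) (\<theta> i d)"] by (simp add: d_def)
  then have a0: "a (\<theta> i d) (\<theta> i d) = 0" if "i \<in> {1..M}" for i
    using nonneg that sum_nonneg_eq_0_iff[of "{1..M}" "\<lambda>i. a (\<theta> i d) (\<theta> i d)"] by blast
  have az: "a z (\<theta> i d) = 0" if "i \<in> {1..M}" "z \<in> V" for i z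
    using form_Cauchy_Schwarz[OF that(2) d(2)[OF that(1)]] a0[OF that(1)] by simp
  have "dD x d = 0"
    using dD_sum_\<theta>[OF V(1) d(1)] az[OF _ V(1)] null[OF d(2) a0] by (simp add: dD_def)
  moreover have "a d d = 0"
  proof -
    have "a (\<Sum>i=1..M. \<theta> i d) d = (\<Sum>i=1..M. a (\<theta> i d) d)" by (intro form_sum_left d)
    also have "\<dots> = (\<Sum>i=1..M. a d (\<theta> i d))" by (intro sum.cong form_sym d refl)
    also have "\<dots> = 0" using az[OF _ d(1)] by simp
    finally show ?thesis using \<theta>_sum[OF d(1)] by simp
  qed
  ultimately show ?thesis using D_add[OF V(1) d(1)] by (simp add: d_def)
qed

text \<open>The concrete operators enter only through the energy laws for \<open>S\<close>, the
  constant \<kappa>, the property \<open>null\<close> and the bound by \<Phi>. That bound is asked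
  for on the initial sublevel set, where \<open>R\<close> controls distances.\<close>

theorem surrogate_decomposition_rate:
  fixes p :: "nat \<Rightarrow> 'v" and \<sigma> \<kappa> \<eta> \<rho> \<alpha> \<Phi> :: real
  assumes y: "y \<in> K" and min: "\<And>q. q \<in> K \<Longrightarrow> D y \<le> D q"
    and S_nonneg: "\<And>x. x \<in> V \<Longrightarrow> 0 \<le> energy_sq S (\<Lambda> x)"
    and S_scale: "\<And>t x. x \<in> V \<Longrightarrow> energy_sq S (\<Lambda> (t *\<^sub>R x)) = t\<^sup>2 * energy_sq S (\<Lambda> x)"
    and S_le: "\<And>x. x \<in> V \<Longrightarrow> energy_sq S (\<Lambda> x) \<le> \<kappa> * a x x"
    and null: "\<And>z. \<lbrakk>z \<in> V; a z z = 0\<rbrakk> \<Longrightarrow> l z = 0"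
    and \<kappa>: "0 \<le> \<kappa>" and \<eta>: "\<eta> = (if \<kappa> \<ge> 1/2 then 1 / (4 * \<kappa>) else 1 - \<kappa>)"
    and N: "1 \<le> N" and \<rho>: "\<rho> = 1 - (1 - \<eta>) ^ N"
    and p0: "p 0 \<in> K"
    and alg: "(0 < \<sigma> \<and> \<sigma> \<le> 1 / real M \<and> parallel_iterates \<Lambda> S D K \<theta> M \<sigma> N p \<and> \<alpha> = 1) \<or>
         (0 < \<sigma> \<and> \<sigma> \<le> 1 \<and> sequential_iterates \<Lambda> S D K \<theta> M \<sigma> N p \<and>
            \<alpha> = 1 + real M * \<sigma> * sqrt (2 - \<rho> + 2 * sqrt (1 - \<rho>)))"
    and \<Phi>: "0 \<le> \<Phi>" "\<And>q. \<lbrakk>q \<in> K; D q \<le> D (p 0)\<rbrakk> \<Longrightarrow>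
      (\<Sum>i=1..M. a (\<theta> i (y - q)) (\<theta> i (y - q))) \<le> \<Phi>\<^sup>2"
  defines "n\<^sub>0 \<equiv> LEAST n. D (p n) - D y < \<Phi>\<^sup>2 * \<alpha>"
  shows "(\<lambda>n. D (p n) - D y) \<longlonglongrightarrow> 0"
    and "n \<le> n\<^sub>0 \<Longrightarrow> D (p n) - D y \<le> (1 - \<rho> * \<sigma> / (2 * \<alpha>)) ^ n * (D (p 0) - D y)"
    and "n\<^sub>0 \<le> n \<Longrightarrow> D (p n) - D y \<le> 2 * \<Phi>\<^sup>2 / (\<rho> * \<sigma>) * \<alpha>\<^sup>2 * inverse (real n - real n\<^sub>0 + 1)"
proof -
  note \<eta>_props = surrogate_rate[OF \<kappa> \<eta>]
  have "0 \<le> \<kappa> / (\<kappa> + 1)" using \<kappa> by simp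
  then have one_\<eta>: "0 \<le> 1 - \<eta>" "1 - \<eta> < 1" using \<eta>_props by linarith+
  have \<rho>_bounds: "0 < \<rho>" "\<rho> \<le> 1"
    using one_\<eta> N by (auto simp: \<rho> power_less_one_iff)
  have M1: "1 / real M \<le> 1" using M_pos by simp
  have \<sigma>: "0 < \<sigma>" "\<sigma> \<le> 1" using alg M1 by auto
  have sqrt_eq: "sqrt (2 - \<rho> + 2 * sqrt (1 - \<rho>)) = 1 + sqrt (1 - \<rho>)"
    using \<rho>_bounds by (intro real_sqrt_unique) (auto simp: power2_sum)
  have \<alpha>: "1 \<le> \<alpha>" using alg sqrt_eq \<rho>_bounds by auto
  have KV: "q \<in> V" if "q \<in> K" for q using that K_subset by blast
  \<comment> \<open>A general base point and start serve both algorithms: in the parallel one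
    \<open>q\<close> is \<open>x\<close> and the start is the zero increment.\<close>
  have opt: "\<rho> * (D q - D (q + (u - \<theta> i x))) \<le> D q - D (q + (v - \<theta> i x))"
    if i: "i \<in> {1..M}" and K: "x \<in> K" "q \<in> K"
      and run: "surrogate_approx \<Lambda> S D (\<theta> i ` K) N q (\<theta> i x) w\<^sub>0 v"
      and start: "sequential_start D (\<theta> i) x q w\<^sub>0" and u: "u \<in> \<theta> i ` K" for i x q w\<^sub>0 v u
    unfolding \<rho>
  proof (rule surrogate_approx_opt[OF \<theta>_K_subset[OF i] \<theta>_K_convex[OF i] KV[OF K(2)] \<theta>_mem[OF i KV[OF K(1)]]
        _ _ \<kappa> \<eta>_props(2) less_imp_le[OF \<eta>_props(1)] S_nonneg S_scale S_le run u])
    show "w\<^sub>0 \<in> \<theta> i ` K" "D (q + (w\<^sub>0 - \<theta> i x)) \<le> D q"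
      using start K by (auto simp: sequential_start_def)
  qed
  \<comment> \<open>A common format for both algorithms; for \<alpha> = 1 the error term
    disappears.\<close>
  have step: "\<exists>G. 0 \<le> G \<and> p (Suc n) \<in> K \<and> D (p (Suc n)) \<le> D (p n) - \<sigma> * G \<and>
      (\<forall>t. 0 \<le> t \<longrightarrow> t \<le> 1 \<longrightarrow> \<rho> * (t * (D (p n) - D y) - t\<^sup>2 * \<Phi>\<^sup>2 / 2
         - t * (\<alpha> - 1) * sqrt (2 * G / \<rho>) * \<Phi>) \<le> G)"
    if pn: "p n \<in> K" "D (p n) \<le> D (p 0)" for n
    using alg
  proof (elim disjE conjE)
    assume \<sigma>M: "\<sigma> \<le> 1 / real M" and "parallel_iterates \<Lambda> S D K \<theta> M \<sigma> N p" and \<alpha>1: "\<alpha> = 1"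
    then obtain v where v: "\<And>i. i \<in> {1..M} \<Longrightarrow>
        surrogate_approx \<Lambda> S D (\<theta> i ` K) N (p n) (\<theta> i (p n)) (\<theta> i (p n)) (v i)"
      and next_p: "p (Suc n) = p n + (\<Sum>i=1..M. \<sigma> *\<^sub>R (v i - \<theta> i (p n)))"
      unfolding parallel_iterates_def by blast
    have v_mem: "v i \<in> \<theta> i ` K" if "i \<in> {1..M}" for i using surrogate_approx_mem[OF v[OF that] N] .
    have v_opt: "\<rho> * (D (p n) - D (p n + (u - \<theta> i (p n)))) \<le> D (p n) - D (p n + (v i - \<theta> i (p n)))"
      if "i \<in> {1..M}" "u \<in> \<theta> i ` K" for i u
      by (rule opt[OF that(1) pn(1) pn(1) v[OF that(1)] _ that(2)]) (simp add: sequential_start_def)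
    note par = parallel_step[of "p n" y \<sigma> \<rho> v \<Phi>, OF pn(1) y \<sigma>(1) \<sigma>M less_imp_le[OF \<rho>_bounds(1)] v_mem v_opt \<Phi>(2)[OF pn]]
    have "p (Suc n) \<in> K"
      unfolding next_p by (rule partial_update_mem[OF pn(1) v_mem]) (use \<sigma> in auto)
    then show ?thesis using par \<alpha>1 unfolding next_p by (intro exI conjI) auto
  next
    assume "sequential_iterates \<Lambda> S D K \<theta> M \<sigma> N p"
      and \<alpha>_eq: "\<alpha> = 1 + real M * \<sigma> * sqrt (2 - \<rho> + 2 * sqrt (1 - \<rho>))"
    then obtain v q where q0: "q 0 = p n" and next_p: "p (Suc n) = q M"
      and vq: "\<And>i. i \<in> {1..M} \<Longrightarrow> (\<exists>w\<^sub>0. sequential_start D (\<theta> i) (p n) (q (i - 1)) w\<^sub>0 \<and>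
              surrogate_approx \<Lambda> S D (\<theta> i ` K) N (q (i - 1)) (\<theta> i (p n)) w\<^sub>0 (v i)) \<and>
           q i = q (i - 1) + \<sigma> *\<^sub>R (v i - \<theta> i (p n))"
      unfolding sequential_iterates_def by blast
    have v_mem: "v i \<in> \<theta> i ` K" if "i \<in> {1..M}" for i using surrogate_approx_mem[OF _ N] vq[OF that] by blast
    have q_step: "q i = q (i - 1) + \<sigma> *\<^sub>R (v i - \<theta> i (p n))" if "i \<in> {1..M}" for i using vq[OF that] by blast
    have qK: "q k \<in> K" if "k \<le> M" for k
      using partial_update_mem[OF pn(1) v_mem _ _ that, of \<sigma>] \<sigma>
      by (subst sequential_partial_sum[OF q_step q0 that]) auto
    have v_opt: "\<rho> * (D (q (i - 1)) - D (q (i - 1) + (u - \<theta> i (p n)))) \<le> D (q (i - 1)) - D (q (i - 1) + (v i - \<theta> i (p n)))"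
      if i: "i \<in> {1..M}" and u: "u \<in> \<theta> i ` K" for i u
    proof -
      have "q (i - 1) \<in> K" by (rule qK) (use i in auto)
      then show ?thesis using vq[OF i] opt[OF i pn(1) _ _ _ u] by blast
    qed
    note seq = sequential_step[of "p n" y \<sigma> \<rho> v q \<Phi>, OF pn(1) y \<sigma> \<rho>_bounds v_mem q0 q_step v_opt \<Phi>(2)[OF pn] \<Phi>(1)]
    have "\<alpha> - 1 = real M * \<sigma> * (1 + sqrt (1 - \<rho>))" using \<alpha>_eq sqrt_eq by simp
    then show ?thesis using seq qK[of M] unfolding next_p by (intro exI conjI) auto
  qed
  \<comment> \<open>Monotonicity is carried along because the bound by \<Phi> is available only on
    the initial sublevel set.\<close>
  have p_mem: "p n \<in> K \<and> D (p n) \<le> D (p 0)" for n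
  proof (induction n)
    case (Suc n)
    obtain G where "0 \<le> G" "p (Suc n) \<in> K" "D (p (Suc n)) \<le> D (p n) - \<sigma> * G" using step[of n] Suc by blast
    moreover have "0 \<le> \<sigma> * G" using \<sigma> \<open>0 \<le> G\<close> by simp
    ultimately show ?case using Suc by linarith
  qed (use p0 in simp)
  have \<delta>: "0 \<le> D (p n) - D y" for n using min p_mem by simp
  have decrease: "\<Phi>\<^sup>2 * \<alpha> \<le> D (p n) - D y \<Longrightarrow> D (p (Suc n)) - D y \<le> D (p n) - D y - \<sigma> * (\<rho> * (D (p n) - D y) / (2 * \<alpha>))"
    "\<lbrakk>D (p n) - D y \<le> \<Phi>\<^sup>2 * \<alpha>; 0 < \<Phi>\<rbrakk> \<Longrightarrow>
      D (p (Suc n)) - D y \<le> D (p n) - D y - \<sigma> * (\<rho> * (D (p n) - D y)\<^sup>2 / (2 * \<Phi>\<^sup>2 * \<alpha>\<^sup>2))" for n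
  proof -
    obtain G where G: "0 \<le> G" "D (p (Suc n)) \<le> D (p n) - \<sigma> * G"
      and model: "\<And>t. \<lbrakk>0 \<le> t; t \<le> 1\<rbrakk> \<Longrightarrow> \<rho> * (t * (D (p n) - D y) - t\<^sup>2 * \<Phi>\<^sup>2 / 2
         - t * (\<alpha> - 1) * sqrt (2 * G / \<rho>) * \<Phi>) \<le> G"
      using step[of n] p_mem by blast
    show "D (p (Suc n)) - D y \<le> D (p n) - D y - \<sigma> * (\<rho> * (D (p n) - D y) / (2 * \<alpha>))"
      if far: "\<Phi>\<^sup>2 * \<alpha> \<le> D (p n) - D y"
    proof -
      have "\<rho> * (D (p n) - D y) / (2 * \<alpha>) \<le> G"
        by (rule decrease_from_model(1)[OF \<rho>_bounds(1) \<alpha> \<Phi>(1) \<delta> G(1) _ far]) (rule model)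
      from mult_left_mono[OF this, of \<sigma>] show ?thesis using \<sigma> G(2) by linarith
    qed
    show "D (p (Suc n)) - D y \<le> D (p n) - D y - \<sigma> * (\<rho> * (D (p n) - D y)\<^sup>2 / (2 * \<Phi>\<^sup>2 * \<alpha>\<^sup>2))"
      if near: "D (p n) - D y \<le> \<Phi>\<^sup>2 * \<alpha>" "0 < \<Phi>"
    proof -
      have "\<rho> * (D (p n) - D y)\<^sup>2 / (2 * \<Phi>\<^sup>2 * \<alpha>\<^sup>2) \<le> G"
        by (rule decrease_from_model(2)[OF \<rho>_bounds(1) \<alpha> \<Phi>(1) \<delta> G(1) _ near]) (rule model)
      from mult_left_mono[OF this, of \<sigma>] show ?thesis using \<sigma> G(2) by linarith
    qed
  qed
  have zero: "D (p n) - D y = 0" if "\<Phi> = 0" for n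
    using D_eq_if_degenerate[of "p n" y] \<Phi>(2)[of "p n"] p_mem[of n] that y KV null by auto
  note rate = two_phase_rate[of \<rho> \<sigma> \<alpha> \<Phi> "\<lambda>n. D (p n) - D y", OF \<rho>_bounds \<sigma> \<alpha> \<Phi>(1) \<delta> decrease zero]
  show "(\<lambda>n. D (p n) - D y) \<longlonglongrightarrow> 0" by (rule rate(1))
  show "n \<le> n\<^sub>0 \<Longrightarrow> D (p n) - D y \<le> (1 - \<rho> * \<sigma> / (2 * \<alpha>)) ^ n * (D (p 0) - D y)"
    unfolding n\<^sub>0_def by (rule rate(2))
  show "n\<^sub>0 \<le> n \<Longrightarrow> D (p n) - D y \<le> 2 * \<Phi>\<^sup>2 / (\<rho> * \<sigma>) * \<alpha>\<^sup>2 * inverse (real n - real n\<^sub>0 + 1)"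
    unfolding n\<^sub>0_def by (rule rate(3))
qed

end

section \<open>Bounded and coercive operators\<close>

lemma op_norm_ratio_bdd_above:
  assumes f: "bounded_linear_between X nX Y nY f" and nX: "\<And>x. x \<in> X \<Longrightarrow> 0 \<le> nX x"
  shows "bdd_above ((\<lambda>x. nY (f x) / nX x) ` X)"
proof -
  obtain C where C: "\<And>x. x \<in> X \<Longrightarrow> nY (f x) \<le> C * nX x"
    using f unfolding bounded_linear_between_def by blast
  \<comment> \<open>The maximum with 0 covers points where \<open>nX\<close> vanishes: there the
    quotient is 0 by convention, while \<open>C\<close> may be negative.\<close>
  have "nY (f x) / nX x \<le> max C 0" if x: "x \<in> X" for x
  proof (cases "nX x = 0")
    case False
    then have "0 < nX x" using nX[OF x] by simp
    then have "nY (f x) / nX x \<le> C" using C[OF x] by (simp add: pos_divide_le_eq)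
    then show ?thesis by simp
  qed simp
  then show ?thesis by (rule bdd_aboveI2)
qed

lemma op_norm_bound:
  assumes f: "bounded_linear_between X nX Y nY f" and nX: "\<And>x. x \<in> X \<Longrightarrow> 0 \<le> nX x" and x: "x \<in> X"
  shows "nY (f x) \<le> op_norm X nX nY f * nX x"
proof (cases "nX x = 0")
  \<comment> \<open>The quotient carries no information here; boundedness itself yields
    \<open>nY (f x) \<le> 0\<close>.\<close>
  case True
  obtain C where "nY (f x) \<le> C * nX x" using f x unfolding bounded_linear_between_def by blast
  then show ?thesis using True by simp
next
  case False
  then have pos: "0 < nX x" using nX[OF x] by simp
  have "nY (f x) / nX x \<le> op_norm X nX nY f"
    unfolding op_norm_def by (rule cSUP_upper[OF x op_norm_ratio_bdd_above[OF f nX]])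
  then show ?thesis using pos by (simp add: pos_divide_le_eq)
qed

lemma op_norm_nonneg:
  assumes f: "bounded_linear_between X nX Y nY f" and nX: "\<And>x. x \<in> X \<Longrightarrow> 0 \<le> nX x" and x: "x \<in> X"
    and nY: "0 \<le> nY (f x)"
  shows "0 \<le> op_norm X nX nY f"
proof -
  have "nY (f x) / nX x \<le> op_norm X nX nY f"
    unfolding op_norm_def by (rule cSUP_upper[OF x op_norm_ratio_bdd_above[OF f nX]])
  moreover have "0 \<le> nY (f x) / nX x" using nX[OF x] nY by simp
  ultimately show ?thesis by linarith
qed

text \<open>Lax-Milgram by Banach's fixed point theorem: \<open>B x = f\<close> holds iff
  \<open>x\<close> is a fixed point of \<open>x - t *\<^sub>R (B x - f)\<close>, which contracts for
  suitable \<open>t\<close>. Coercivity alone gives injectivity.\<close>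

lemma coercive_bij_betw:
  fixes W :: "'w::real_inner set"
  assumes W: "complete W" "subspace W" and B: "B ` W \<subseteq> W"
    and add: "\<And>x y. \<lbrakk>x \<in> W; y \<in> W\<rbrakk> \<Longrightarrow> B (x + y) = B x + B y"
    and scale: "\<And>c x. x \<in> W \<Longrightarrow> B (c *\<^sub>R x) = c *\<^sub>R B x"
    and C: "\<And>x. x \<in> W \<Longrightarrow> norm (B x) \<le> C * norm x"
    and c: "0 < c" "\<And>x. x \<in> W \<Longrightarrow> c * (norm x)\<^sup>2 \<le> x \<bullet> B x"
  shows "bij_betw B W W"
proof -
  note cl = subspace_add[OF W(2)] subspace_diff[OF W(2)] subspace_scale[OF W(2)] subspace_0[OF W(2)]
  have diff: "B (x - y) = B x - B y" if "x \<in> W" "y \<in> W" for x y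
    using add[of "x - y" y] that cl by simp
  \<comment> \<open>The maximum ensures \<open>0 < E\<close> and \<open>c / E \<le> 1\<close> even
    if \<open>W\<close> is trivial and \<open>C\<close> arbitrary.\<close>
  define E where "E = max c C"
  have E: "0 < E" "c \<le> E" using c(1) by (auto simp: E_def)
  have BE: "(norm (B x))\<^sup>2 \<le> E\<^sup>2 * (norm x)\<^sup>2" if "x \<in> W" for x
  proof -
    have "norm (B x) \<le> E * norm x"
      using C[OF that] mult_right_mono[of C E "norm x"] by (simp add: E_def)
    from power_mono[OF this, of 2] show ?thesis by (simp add: power_mult_distrib)
  qed
  \<comment> \<open>Minimizes \<open>1 - 2 * t * c + t\<^sup>2 * E\<^sup>2\<close>; the minimum
    \<open>1 - (c / E)\<^sup>2\<close> is the square of the contraction factor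
    \<open>k\<close>.\<close>
  define t where "t = c / E\<^sup>2"
  define k where "k = sqrt (1 - (c / E)\<^sup>2)"
  have cE: "0 < c / E" "c / E \<le> 1" using c(1) E by auto
  then have "(c / E)\<^sup>2 \<le> 1" "0 < (c / E)\<^sup>2" by (auto simp: power_le_one)
  then have k: "0 \<le> k" "k < 1" "k\<^sup>2 = 1 - (c / E)\<^sup>2" by (auto simp: k_def)
  have contr: "norm (x - t *\<^sub>R B x) \<le> k * norm x" if x: "x \<in> W" for x
  proof (rule power2_le_imp_le)
    have "(norm (x - t *\<^sub>R B x))\<^sup>2 = (norm x)\<^sup>2 - 2 * t * (x \<bullet> B x) + t\<^sup>2 * (norm (B x))\<^sup>2"
      unfolding power2_norm_eq_inner
      by (simp add: inner_diff_left inner_diff_right inner_commute[of "B x" x] power2_eq_square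
          algebra_simps)
    also have "\<dots> \<le> (norm x)\<^sup>2 - 2 * t * (c * (norm x)\<^sup>2) + t\<^sup>2 * (E\<^sup>2 * (norm x)\<^sup>2)"
      using BE[OF x] c(2)[OF x] c(1)
      by (intro add_mono diff_mono mult_left_mono) (auto simp: t_def)
    also have "\<dots> = (1 - (c / E)\<^sup>2) * (norm x)\<^sup>2"
      using E by (simp add: t_def power2_eq_square field_simps)
    finally show "(norm (x - t *\<^sub>R B x))\<^sup>2 \<le> (k * norm x)\<^sup>2" by (simp add: power_mult_distrib k(3))
  qed (use k in auto)
  have "inj_on B W"
  proof (rule inj_onI)
    fix x y assume xy: "x \<in> W" "y \<in> W" "B x = B y"
    then have "c * (norm (x - y))\<^sup>2 \<le> 0" using c(2)[of "x - y"] diff cl by simp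
    then show "x = y" using c(1) by (simp add: mult_le_0_iff)
  qed
  moreover have "W \<subseteq> B ` W"
  proof
    fix f assume f: "f \<in> W"
    have "\<exists>!x\<in>W. x - t *\<^sub>R (B x - f) = x"
    proof (rule Banach_fix[OF W(1) _ k(1,2)])
      show "W \<noteq> {}" using f by auto
      show "(\<lambda>x. x - t *\<^sub>R (B x - f)) ` W \<subseteq> W" using B f by (auto intro!: cl)
      fix x y assume xy: "x \<in> W" "y \<in> W"
      have eq: "x - t *\<^sub>R (B x - f) - (y - t *\<^sub>R (B y - f)) = (x - y) - t *\<^sub>R B (x - y)"
        using xy by (simp add: diff algebra_simps)
      show "dist (x - t *\<^sub>R (B x - f)) (y - t *\<^sub>R (B y - f)) \<le> k * dist x y"
        unfolding dist_norm eq by (rule contr[OF cl(2)[OF xy]])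
    qed
    then obtain x where "x \<in> W" "t *\<^sub>R (B x - f) = 0" by auto
    then have "B x = f" using c(1) E by (simp add: t_def)
    then show "f \<in> B ` W" using \<open>x \<in> W\<close> by blast
  qed
  ultimately show ?thesis using B by (auto simp: bij_betw_def)
qed

section \<open>The inverse of a coercive self-adjoint operator\<close>

locale positive_operator =
  fixes W :: "'w::real_inner set" and B :: "'w \<Rightarrow> 'w" and c\<^sub>B :: real
  assumes complete_W: "complete W" and subspace_W: "subspace W"
    and B_bounded: "bounded_linear_between W norm W norm B"
    and B_sym: "\<lbrakk>x \<in> W; y \<in> W\<rbrakk> \<Longrightarrow> B x \<bullet> y = x \<bullet> B y"
    and c\<^sub>B_pos: "0 < c\<^sub>B" and coercive: "x \<in> W \<Longrightarrow> c\<^sub>B * (norm x)\<^sup>2 \<le> x \<bullet> B x"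
begin

definition Binv :: "'w \<Rightarrow> 'w" where "Binv = inv_into W B"

lemmas W_closed = subspace_W[THEN subspace_add] subspace_W[THEN subspace_diff]
  subspace_W[THEN subspace_scale] subspace_W[THEN subspace_0]

lemma B_mem: "x \<in> W \<Longrightarrow> B x \<in> W"
  and B_add: "\<lbrakk>x \<in> W; y \<in> W\<rbrakk> \<Longrightarrow> B (x + y) = B x + B y"
  and B_scale: "x \<in> W \<Longrightarrow> B (c *\<^sub>R x) = c *\<^sub>R B x"
  using B_bounded by (auto simp: bounded_linear_between_def)

lemma B_bij: "bij_betw B W W"
proof (rule coercive_bij_betw[OF complete_W subspace_W _ B_add B_scale _ c\<^sub>B_pos coercive])
  show "B ` W \<subseteq> W" using B_mem by blast
  show "norm (B x) \<le> op_norm W norm norm B * norm x" if "x \<in> W" for x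
    by (rule op_norm_bound[OF B_bounded _ that]) simp
qed

lemma Binv_mem: "w \<in> W \<Longrightarrow> Binv w \<in> W"
  and B_Binv: "w \<in> W \<Longrightarrow> B (Binv w) = w"
  and Binv_B: "x \<in> W \<Longrightarrow> Binv (B x) = x"
  using bij_betwE[OF bij_betw_inv_into[OF B_bij]] bij_betw_inv_into_right[OF B_bij]
    bij_betw_inv_into_left[OF B_bij]
  by (auto simp: Binv_def)

lemma Binv_add: "\<lbrakk>w \<in> W; z \<in> W\<rbrakk> \<Longrightarrow> Binv (w + z) = Binv w + Binv z"
  using Binv_B[of "Binv w + Binv z"] by (simp add: B_add Binv_mem B_Binv W_closed)

lemma Binv_scale: "w \<in> W \<Longrightarrow> Binv (c *\<^sub>R w) = c *\<^sub>R Binv w"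
  using Binv_B[of "c *\<^sub>R Binv w"] by (simp add: B_scale Binv_mem B_Binv W_closed)

lemma Binv_diff: "\<lbrakk>w \<in> W; z \<in> W\<rbrakk> \<Longrightarrow> Binv (w - z) = Binv w - Binv z"
  using Binv_add[of "w - z" z] by (simp add: W_closed)

lemma Binv_sym: "\<lbrakk>w \<in> W; z \<in> W\<rbrakk> \<Longrightarrow> w \<bullet> Binv z = z \<bullet> Binv w"
  using B_sym[of "Binv w" "Binv z"] by (simp add: Binv_mem B_Binv inner_commute)

text \<open>Coercivity at \<open>Binv w\<close> combined with Cauchy-Schwarz gives the bound
  \<open>1 / c\<^sub>B\<close>.\<close>

lemma Binv_bounded: "bounded_linear_between W norm W norm Binv"
proof -
  have "norm (Binv w) \<le> 1 / c\<^sub>B * norm w" if w: "w \<in> W" for w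
  proof (cases "Binv w = 0")
    case False
    have "c\<^sub>B * (norm (Binv w))\<^sup>2 \<le> Binv w \<bullet> w"
      using coercive[OF Binv_mem[OF w]] w by (simp add: B_Binv)
    also have "\<dots> \<le> norm (Binv w) * norm w" by (rule norm_cauchy_schwarz)
    finally have "norm (Binv w) * (c\<^sub>B * norm (Binv w)) \<le> norm (Binv w) * norm w"
      by (simp add: power2_eq_square ac_simps)
    then have "c\<^sub>B * norm (Binv w) \<le> norm w" using False by simp
    then show ?thesis using c\<^sub>B_pos by (simp add: field_simps)
  qed (use c\<^sub>B_pos in simp)
  then have "\<exists>C. \<forall>w\<in>W. norm (Binv w) \<le> C * norm w" by blast
  then show ?thesis
    unfolding bounded_linear_between_def by (auto simp: Binv_mem Binv_add Binv_scale)
qed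

lemma Binv_inner_nonneg:
  assumes w: "w \<in> W" shows "0 \<le> w \<bullet> Binv w"
proof -
  have "0 \<le> c\<^sub>B * (norm (Binv w))\<^sup>2" using c\<^sub>B_pos by simp
  also have "\<dots> \<le> Binv w \<bullet> w" using coercive[OF Binv_mem[OF w]] w by (simp add: B_Binv)
  finally show ?thesis by (simp add: inner_commute)
qed

lemma Binv_inner_le: "w \<in> W \<Longrightarrow> w \<bullet> Binv w \<le> op_norm W norm norm Binv * (norm w)\<^sup>2"
proof -
  assume w: "w \<in> W"
  have "w \<bullet> Binv w \<le> norm w * norm (Binv w)" by (rule norm_cauchy_schwarz)
  also have "\<dots> \<le> norm w * (op_norm W norm norm Binv * norm w)"
    by (intro mult_left_mono op_norm_bound[OF Binv_bounded _ w]) auto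
  finally show ?thesis by (simp add: power2_eq_square ac_simps)
qed

lemma op_norm_B_nonneg: "0 \<le> op_norm W norm norm B"
  by (rule op_norm_nonneg[OF B_bounded _ W_closed(4)]) auto

lemma op_norm_Binv_nonneg: "0 \<le> op_norm W norm norm Binv"
  by (rule op_norm_nonneg[OF Binv_bounded _ W_closed(4)]) auto

text \<open>With \<open>x = B\<^sup>-\<^sup>1 w\<close> this is \<open>\<bar>B x\<bar>\<^sup>2 \<le> \<bar>B\<bar> \<langle>x, B x\<rangle>\<close>, the Cauchy-Schwarz inequality of the form
  \<open>\<langle>\<cdot>, B \<cdot>\<rangle>\<close> applied to \<open>x\<close> and \<open>B x\<close>.\<close>

lemma norm_sq_le_Binv_inner:
  assumes w: "w \<in> W" shows "(norm w)\<^sup>2 \<le> op_norm W norm norm B * (w \<bullet> Binv w)"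
proof (cases "w = 0")
  case False
  \<comment> \<open>Interpreted for the sake of its Cauchy-Schwarz inequality; the linear part is
    trivial.\<close>
  interpret F: quadratic_objective W "\<lambda>x y. x \<bullet> B y" "\<lambda>_. 0" "\<lambda>x. (x \<bullet> B x) / 2" 0
  proof
    show "x \<bullet> B y = y \<bullet> B x" if "x \<in> W" "y \<in> W" for x y
      using B_sym[OF that] by (simp add: inner_commute)
    show "0 \<le> x \<bullet> B x" if "x \<in> W" for x
      using order_trans[OF _ coercive[OF that]] c\<^sub>B_pos by simp
  qed (auto simp: subspace_W inner_add_left)
  have "(Binv w \<bullet> B w)\<^sup>2 \<le> (Binv w \<bullet> B (Binv w)) * (w \<bullet> B w)"
    by (rule F.form_Cauchy_Schwarz_sq[OF Binv_mem[OF w] w])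
  moreover have "Binv w \<bullet> B w = (norm w)\<^sup>2"
    using B_sym[OF Binv_mem[OF w] w] w by (simp add: B_Binv power2_norm_eq_inner)
  moreover have "w \<bullet> B w \<le> op_norm W norm norm B * (norm w)\<^sup>2"
  proof -
    have "w \<bullet> B w \<le> norm w * norm (B w)" by (rule norm_cauchy_schwarz)
    also have "\<dots> \<le> norm w * (op_norm W norm norm B * norm w)"
      by (intro mult_left_mono op_norm_bound[OF B_bounded _ w]) auto
    finally show ?thesis by (simp add: power2_eq_square ac_simps)
  qed
  then have "(w \<bullet> Binv w) * (w \<bullet> B w) \<le> (w \<bullet> Binv w) * (op_norm W norm norm B * (norm w)\<^sup>2)"
    using Binv_inner_nonneg[OF w] by (intro mult_left_mono)
  ultimately have "(norm w)\<^sup>2 * (norm w)\<^sup>2 \<le> (op_norm W norm norm B * (w \<bullet> Binv w)) * (norm w)\<^sup>2"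
    using w by (simp add: B_Binv inner_commute power2_eq_square ac_simps)
  then show ?thesis by (rule mult_right_le_imp_le) (use False in simp)
qed simp

lemma shifted_Binv_bounded: "bounded_linear_between W norm W norm (\<lambda>w. \<tau> *\<^sub>R w - Binv w)"
proof -
  have "norm (\<tau> *\<^sub>R w - Binv w) \<le> (\<bar>\<tau>\<bar> + op_norm W norm norm Binv) * norm w" if "w \<in> W" for w
    using norm_triangle_ineq4[of "\<tau> *\<^sub>R w" "Binv w"] op_norm_bound[OF Binv_bounded _ that]
    by (simp add: distrib_right)
  then have "\<exists>C. \<forall>w\<in>W. norm (\<tau> *\<^sub>R w - Binv w) \<le> C * norm w" by blast
  then show ?thesis
    unfolding bounded_linear_between_def
    by (auto simp: Binv_mem Binv_add Binv_scale W_closed scaleR_add_right scaleR_diff_right)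
qed

lemma energy_shifted_Binv_nonneg:
  assumes "op_norm W norm norm Binv < \<tau>" "w \<in> W"
  shows "0 \<le> energy_sq (\<lambda>w. \<tau> *\<^sub>R w - Binv w) w"
proof -
  have "op_norm W norm norm Binv * (norm w)\<^sup>2 \<le> \<tau> * (norm w)\<^sup>2" using assms(1) by (intro mult_right_mono) auto
  then show ?thesis
    using Binv_inner_le[OF assms(2)] by (simp add: energy_sq_def inner_diff_right power2_norm_eq_inner)
qed

text \<open>In the order of quadratic forms, \<open>S\<close> is at most its norm times the
  identity, and the identity is at most the norm of \<open>B\<close> times \<open>Binv\<close>. The
  product of the two norms is \<kappa>.\<close>

lemma energy_shifted_Binv_le:
  fixes \<tau> :: real
  assumes w: "w \<in> W"
  defines "S \<equiv> \<lambda>w. \<tau> *\<^sub>R w - Binv w"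
  shows "energy_sq S w \<le> op_norm W norm norm S * op_norm W norm norm B * (w \<bullet> Binv w)"
proof -
  note S = shifted_Binv_bounded[of \<tau>, folded S_def]
  have "energy_sq S w \<le> norm w * norm (S w)" unfolding energy_sq_def by (rule norm_cauchy_schwarz)
  also have "\<dots> \<le> norm w * (op_norm W norm norm S * norm w)"
    by (intro mult_left_mono op_norm_bound[OF S _ w]) auto
  also have "\<dots> = op_norm W norm norm S * (norm w)\<^sup>2" by (simp add: power2_eq_square)
  also have "\<dots> \<le> op_norm W norm norm S * (op_norm W norm norm B * (w \<bullet> Binv w))"
    by (intro mult_left_mono norm_sq_le_Binv_inner w op_norm_nonneg[OF S _ w]) auto
  finally show ?thesis by (simp add: mult.assoc)
qed

end

text \<open>Through the adjoint, \<open>u \<bullet> Tadj (T u)\<close> is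
  \<open>(norm (T u))\<^sup>2\<close>, so the assumed lower bound is exactly coercivity.\<close>

lemma positive_operator_normal:
  fixes T :: "'w::real_inner \<Rightarrow> 'h::real_inner"
  assumes W: "complete W" "subspace W"
    and T: "bounded_linear_between W norm H norm T" and Tadj: "bounded_linear_between H norm W norm Tadj"
    and adj: "\<And>u h. \<lbrakk>u \<in> W; h \<in> H\<rbrakk> \<Longrightarrow> T u \<bullet> h = u \<bullet> Tadj h"
    and c: "0 < c" "\<And>u. u \<in> W \<Longrightarrow> c * (norm u)\<^sup>2 \<le> (norm (T u))\<^sup>2 + \<beta> * (norm u)\<^sup>2"
  shows "positive_operator W (\<lambda>u. Tadj (T u) + \<beta> *\<^sub>R u) c"
proof
  note cl = subspace_add[OF W(2)] subspace_scale[OF W(2)]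
  have TH: "T u \<in> H" if "u \<in> W" for u using T that by (auto simp: bounded_linear_between_def)
  have TW: "Tadj h \<in> W" if "h \<in> H" for h using Tadj that by (auto simp: bounded_linear_between_def)
  have T_lin: "\<And>x y. \<lbrakk>x \<in> W; y \<in> W\<rbrakk> \<Longrightarrow> T (x + y) = T x + T y"
    "\<And>x r. x \<in> W \<Longrightarrow> T (r *\<^sub>R x) = r *\<^sub>R T x"
    using T by (auto simp: bounded_linear_between_def)
  have Tadj_lin: "\<And>h k. \<lbrakk>h \<in> H; k \<in> H\<rbrakk> \<Longrightarrow> Tadj (h + k) = Tadj h + Tadj k"
    "\<And>h r. h \<in> H \<Longrightarrow> Tadj (r *\<^sub>R h) = r *\<^sub>R Tadj h"
    using Tadj by (auto simp: bounded_linear_between_def)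
  have "norm (Tadj (T u) + \<beta> *\<^sub>R u) \<le>
      (op_norm H norm norm Tadj * op_norm W norm norm T + \<bar>\<beta>\<bar>) * norm u" if u: "u \<in> W" for u
  proof -
    have "norm (Tadj (T u)) \<le> op_norm H norm norm Tadj * norm (T u)"
      by (rule op_norm_bound[OF Tadj _ TH[OF u]]) simp
    also have "\<dots> \<le> op_norm H norm norm Tadj * (op_norm W norm norm T * norm u)"
      by (intro mult_left_mono op_norm_bound[OF T _ u] op_norm_nonneg[OF Tadj _ TH[OF u]]) auto
    finally show ?thesis
      using norm_triangle_ineq[of "Tadj (T u)" "\<beta> *\<^sub>R u"] by (simp add: distrib_right mult.assoc)
  qed
  then have "\<exists>C. \<forall>u\<in>W. norm (Tadj (T u) + \<beta> *\<^sub>R u) \<le> C * norm u" by blast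
  then show "bounded_linear_between W norm W norm (\<lambda>u. Tadj (T u) + \<beta> *\<^sub>R u)"
    unfolding bounded_linear_between_def
    by (auto simp: T_lin Tadj_lin TH TW cl scaleR_add_right mult.commute)
  show "(Tadj (T x) + \<beta> *\<^sub>R x) \<bullet> y = x \<bullet> (Tadj (T y) + \<beta> *\<^sub>R y)" if "x \<in> W" "y \<in> W" for x y
    using adj[OF that(1) TH[OF that(2)]] adj[OF that(2) TH[OF that(1)]]
    by (simp add: inner_add_left inner_add_right inner_commute)
  show "c * (norm x)\<^sup>2 \<le> x \<bullet> (Tadj (T x) + \<beta> *\<^sub>R x)" if "x \<in> W" for x
    using c(2)[OF that] adj[OF that TH[OF that]]
    by (simp add: inner_add_right power2_norm_eq_inner)
qed (use W c in auto)

text \<open>Expansion of the square; the symmetry of \<open>Binv\<close> merges both cross terms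
  into the linear part.\<close>

lemma (in positive_operator) quadratic_objective_energy:
  fixes V :: "'v::real_vector set"
  assumes V: "subspace V" and \<Lambda>_mem: "\<And>x. x \<in> V \<Longrightarrow> \<Lambda> x \<in> W"
    and \<Lambda>_add: "\<And>x y. \<lbrakk>x \<in> V; y \<in> V\<rbrakk> \<Longrightarrow> \<Lambda> (x + y) = \<Lambda> x + \<Lambda> y"
    and \<Lambda>_scale: "\<And>x r. x \<in> V \<Longrightarrow> \<Lambda> (r *\<^sub>R x) = r *\<^sub>R \<Lambda> x"
    and f: "f \<in> W"
  shows "quadratic_objective V (\<lambda>x y. \<Lambda> x \<bullet> Binv (\<Lambda> y)) (\<lambda>x. \<Lambda> x \<bullet> Binv f)
    (\<lambda>q. 1/2 * energy_sq Binv (\<Lambda> q - f)) (1/2 * energy_sq Binv f)"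
proof
  show "1/2 * energy_sq Binv (\<Lambda> x - f) = \<Lambda> x \<bullet> Binv (\<Lambda> x) / 2 - \<Lambda> x \<bullet> Binv f + 1/2 * energy_sq Binv f"
    if "x \<in> V" for x
    using Binv_sym[OF f \<Lambda>_mem[OF that]] f \<Lambda>_mem[OF that]
    by (simp add: energy_sq_def Binv_diff inner_diff_left inner_diff_right)
qed (use V Binv_sym Binv_inner_nonneg \<Lambda>_mem in \<open>auto simp: \<Lambda>_add \<Lambda>_scale inner_add_left\<close>)

section \<open>Completeness of the space of square-integrable functions\<close>

lemma sq_integrable_rep_L2: "sq_integrable (rep_L2 f)"
  using Quotient3_rep_reflp[OF Quotient3_L2, of f] by (simp add: L2_rel_def)

lemma rep_abs_L2:
  assumes "sq_integrable f" shows "AE x in lebesgue. rep_L2 (abs_L2 f) x = f x"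
  using Quotient3_rep_abs[OF Quotient3_L2, of f] assms by (simp add: L2_rel_def)

lemma L2_eq_iff_AE: "f = g \<longleftrightarrow> (AE x in lebesgue. rep_L2 f x = rep_L2 g x)"
  using Quotient3_rel_rep[OF Quotient3_L2, of f g]
  by (auto simp: L2_rel_def sq_integrable_rep_L2)

lemma rep_L2_zero: "AE x in lebesgue. rep_L2 0 x = 0"
  unfolding zero_L2_def by (simp add: rep_abs_L2 sq_integrable_zero)

lemma rep_L2_add: "AE x in lebesgue. rep_L2 (f + g) x = rep_L2 f x + rep_L2 g x"
  using rep_abs_L2[OF sq_integrable_add[OF sq_integrable_rep_L2[of f] sq_integrable_rep_L2[of g]]]
  by (simp add: plus_L2_def)

lemma rep_L2_scaleR: "AE x in lebesgue. rep_L2 (c *\<^sub>R f) x = c *\<^sub>R rep_L2 f x"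
  using rep_abs_L2[OF sq_integrable_scaleR[OF sq_integrable_rep_L2[of f]]]
  by (simp add: scaleR_L2_def)

lemma rep_L2_diff: "AE x in lebesgue. rep_L2 (f - g) x = rep_L2 f x - rep_L2 g x"
  using rep_L2_add[of f "- 1 *\<^sub>R g"] rep_L2_scaleR[of "-1" g] by eventually_elim simp

lemma inner_L2_eq: "f \<bullet> g = (LINT x|lebesgue. rep_L2 f x \<bullet> rep_L2 g x)"
  by (simp add: inner_L2_def)

lemma norm_L2_sq: "(norm (f :: ('a::euclidean_space, 'b::euclidean_space) L2))\<^sup>2 = (LINT x|lebesgue. (norm (rep_L2 f x))\<^sup>2)"
  by (simp add: power2_norm_eq_inner inner_L2_eq)

lemma rep_L2_measurable [measurable]: "rep_L2 f \<in> borel_measurable lebesgue"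
  using sq_integrable_rep_L2 by (auto simp: sq_integrable_def)

lemma integrable_norm_sq_rep_L2: "integrable lebesgue (\<lambda>x. (norm (rep_L2 f x))\<^sup>2)"
  using sq_integrable_rep_L2 by (auto simp: sq_integrable_def)

text \<open>In \<open>ennreal\<close>, so that Fatou's lemma and almost-everywhere comparison apply
  before integrability is known.\<close>

lemma norm_L2_nn:
  "ennreal ((norm (f :: ('a::euclidean_space, 'b::euclidean_space) L2))\<^sup>2) = (\<integral>\<^sup>+x. ennreal ((norm (rep_L2 f x))\<^sup>2) \<partial>lebesgue)"
  by (simp add: norm_L2_sq nn_integral_eq_integral integrable_norm_sq_rep_L2)

lemma norm_diff_L2_nn:
  "(\<integral>\<^sup>+x. ennreal ((norm (rep_L2 f x - rep_L2 g x))\<^sup>2) \<partial>lebesgue)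
    = ennreal ((norm (f - g :: ('a::euclidean_space, 'b::euclidean_space) L2))\<^sup>2)"
  unfolding norm_L2_nn by (rule nn_integral_cong_AE) (use rep_L2_diff[of f g] in eventually_elim, simp)

lemma norm_sq_diff_abs_L2:
  assumes "sq_integrable F"
  shows "ennreal ((norm (abs_L2 F - g))\<^sup>2) = (\<integral>\<^sup>+x. ennreal ((norm (F x - rep_L2 g x))\<^sup>2) \<partial>lebesgue)"
  unfolding norm_diff_L2_nn[symmetric]
  by (rule nn_integral_cong_AE) (use rep_abs_L2[OF assms] in eventually_elim, simp)

lemma Cauchy_fast_subseq:
  fixes X :: "nat \<Rightarrow> 'a::real_normed_vector" and e :: "nat \<Rightarrow> real"
  assumes "Cauchy X" and e: "\<And>n. 0 < e n"
  obtains r where "strict_mono r" "\<And>n. norm (X (r (Suc n)) - X (r n)) < e n"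
proof -
  obtain N where N: "\<And>k m n. \<lbrakk>N k \<le> m; N k \<le> n\<rbrakk> \<Longrightarrow> norm (X m - X n) < e k"
    using CauchyD[OF assms(1) e] by metis
  \<comment> \<open>The sum dominates \<open>N k\<close>, also at \<open>Suc k\<close>; the summand
    \<open>k\<close> makes \<open>r\<close> strictly increasing.\<close>
  define r where "r k = k + (\<Sum>j\<le>k. N j)" for k
  have "N k \<le> (\<Sum>j\<le>k. N j)" for k by (intro member_le_sum) auto
  then have "N k \<le> r k" "N k \<le> r (Suc k)" for k by (auto simp: r_def intro: le_SucI trans_le_add1 trans_le_add2)
  moreover have "strict_mono r" by (auto simp: r_def strict_mono_Suc_iff)
  ultimately show ?thesis using that N by blast
qed

text \<open>Along a subsequence with increments at most \<open>4\<^sup>-\<^sup>n\<close>, the increments \<open>d\<^sub>n\<close> satisfy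
  \<open>\<Sum> 2\<^sup>n \<bar>d\<^sub>n\<bar>\<^sup>2 < \<infinity>\<close> almost everywhere, and \<open>2 \<bar>d\<^sub>n\<bar> \<le> 2\<^sup>n \<bar>d\<^sub>n\<bar>\<^sup>2 + 2\<^sup>-\<^sup>n\<close>.\<close>

lemma L2_fast_subseq_AE_convergent:
  fixes Y :: "nat \<Rightarrow> ('a::euclidean_space, 'b::euclidean_space) L2"
  assumes Y: "\<And>n. norm (Y (Suc n) - Y n) < (1/4)^n"
  shows "AE x in lebesgue. convergent (\<lambda>n. rep_L2 (Y n) x)"
proof -
  define d where "d n x = rep_L2 (Y (Suc n)) x - rep_L2 (Y n) x" for n x
  define u where "u n x = 2^n * (norm (d n x))\<^sup>2" for n x
  have [measurable]: "u n \<in> borel_measurable lebesgue" for n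
    unfolding u_def d_def by measurable
  have u0: "0 \<le> u n x" for n x by (simp add: u_def)
  have "(\<integral>\<^sup>+x. ennreal (u n x) \<partial>lebesgue) \<le> ennreal ((1/8)^n)" for n
  proof -
    have "(\<integral>\<^sup>+x. ennreal (u n x) \<partial>lebesgue) = ennreal (2^n) * (\<integral>\<^sup>+x. ennreal ((norm (d n x))\<^sup>2) \<partial>lebesgue)"
      unfolding u_def by (subst nn_integral_cmult[symmetric]) (auto simp: d_def ennreal_mult)
    also have "\<dots> = ennreal (2^n * (norm (Y (Suc n) - Y n))\<^sup>2)"
      unfolding d_def norm_diff_L2_nn by (simp add: ennreal_mult)
    also have "\<dots> \<le> ennreal (2^n * ((1/4)^n)\<^sup>2)"
      using Y[of n] by (intro ennreal_leI mult_left_mono power_mono) auto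
    also have "2^n * ((1/4)^n)\<^sup>2 = ((1/8)^n :: real)"
      by (simp add: power2_eq_square power_mult_distrib[symmetric])
    finally show ?thesis .
  qed
  then have "(\<Sum>n. \<integral>\<^sup>+x. ennreal (u n x) \<partial>lebesgue) \<le> (\<Sum>n. ennreal ((1/8)^n))"
    by (intro suminf_le) auto
  also have "\<dots> < \<infinity>"
    by (subst suminf_ennreal2) (auto intro: summable_geometric)
  finally have "(\<integral>\<^sup>+x. (\<Sum>n. ennreal (u n x)) \<partial>lebesgue) < \<infinity>"
    by (subst nn_integral_suminf) auto
  then have "AE x in lebesgue. (\<Sum>n. ennreal (u n x)) \<noteq> \<infinity>"
    by (intro nn_integral_PInf_AE) auto
  then show ?thesis
  proof eventually_elim
    case (elim x)
    then have s: "summable (\<lambda>n. u n x)"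
      using u0 by (intro summable_suminf_not_top) (auto simp: top_unique)
    have "summable (\<lambda>n. (u n x + (1/2)^n) / 2)"
      by (intro summable_divide summable_add s summable_geometric) auto
    moreover have "norm (d n x) \<le> (u n x + (1/2)^n) / 2" for n
    proof -
      have "0 \<le> (2^n * norm (d n x) - 1)\<^sup>2" by simp
      then have "2 * 2^n * norm (d n x) \<le> 2^n * 2^n * (norm (d n x))\<^sup>2 + 1"
        by (simp add: power2_eq_square algebra_simps)
      then have "(1/2)^n * (2 * 2^n * norm (d n x)) \<le> (1/2)^n * (2^n * 2^n * (norm (d n x))\<^sup>2 + 1)"
        by (intro mult_left_mono) auto
      then show ?thesis by (simp add: u_def power_one_over field_simps)
    qed
    ultimately have "summable (\<lambda>n. d n x)" by (rule summable_comparison_test'[where N = 0])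
    then have "(\<lambda>n. rep_L2 (Y 0) x + (\<Sum>k<n. d k x)) \<longlonglongrightarrow> rep_L2 (Y 0) x + (\<Sum>k. d k x)"
      by (intro tendsto_add tendsto_const summable_LIMSEQ)
    moreover have "rep_L2 (Y 0) x + (\<Sum>k<n. d k x) = rep_L2 (Y n) x" for n
      using sum_lessThan_telescope[of "\<lambda>n. rep_L2 (Y n) x" n] by (simp add: d_def)
    ultimately show ?case by (auto simp: convergent_def)
  qed
qed

text \<open>Riesz-Fischer: the pointwise limit \<open>F\<close> is also the limit in norm, because
  Fatou's lemma in \<open>m\<close> transfers the Cauchy bound on \<open>Y m - Y n\<close> to
  \<open>F\<close> minus \<open>Y n\<close>.\<close>

lemma L2_convergent_if_fast:
  fixes Y :: "nat \<Rightarrow> ('a::euclidean_space, 'b::euclidean_space) L2"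
  assumes "Cauchy Y" and Y: "\<And>n. norm (Y (Suc n) - Y n) < (1/4)^n"
  shows "convergent Y"
proof -
  \<comment> \<open>Where no limit exists the value is unspecified; this affects only a null set,
    and \<open>F\<close> is measurable all the same.\<close>
  define F where "F x = lim (\<lambda>n. rep_L2 (Y n) x)" for x
  have F_meas [measurable]: "F \<in> borel_measurable lebesgue"
    unfolding F_def by measurable
  have AE: "AE x in lebesgue. (\<lambda>n. rep_L2 (Y n) x) \<longlonglongrightarrow> F x"
    using L2_fast_subseq_AE_convergent[OF Y]
    by eventually_elim (simp add: F_def convergent_LIMSEQ_iff)
  have bound: "(\<integral>\<^sup>+x. ennreal ((norm (F x - rep_L2 (Y n) x))\<^sup>2) \<partial>lebesgue) \<le> ennreal (e\<^sup>2)"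
    if e: "\<And>m. N \<le> m \<Longrightarrow> norm (Y m - Y n) < e" for e n N
  proof -
    have "(\<integral>\<^sup>+x. ennreal ((norm (F x - rep_L2 (Y n) x))\<^sup>2) \<partial>lebesgue) =
       (\<integral>\<^sup>+x. liminf (\<lambda>m. ennreal ((norm (rep_L2 (Y m) x - rep_L2 (Y n) x))\<^sup>2)) \<partial>lebesgue)"
    proof (rule nn_integral_cong_AE, use AE in eventually_elim)
      case (elim x)
      then have "(\<lambda>m. ennreal ((norm (rep_L2 (Y m) x - rep_L2 (Y n) x))\<^sup>2))
          \<longlonglongrightarrow> ennreal ((norm (F x - rep_L2 (Y n) x))\<^sup>2)"
        by (intro tendsto_intros tendsto_ennrealI)
      then show ?case by (rule lim_imp_Liminf[OF sequentially_bot, symmetric])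
    qed
    also have "\<dots> \<le> liminf (\<lambda>m. \<integral>\<^sup>+x. ennreal ((norm (rep_L2 (Y m) x - rep_L2 (Y n) x))\<^sup>2) \<partial>lebesgue)"
      by (rule nn_integral_liminf) measurable
    also have "\<dots> \<le> ennreal (e\<^sup>2)"
    proof (rule Liminf_le)
      have "(norm (Y m - Y n))\<^sup>2 \<le> e\<^sup>2" if "N \<le> m" for m
        using e[OF that] by (intro power_mono) auto
      then show "\<forall>\<^sub>F m in sequentially. (\<integral>\<^sup>+x. ennreal ((norm (rep_L2 (Y m) x - rep_L2 (Y n) x))\<^sup>2) \<partial>lebesgue) \<le> ennreal (e\<^sup>2)"
        unfolding norm_diff_L2_nn eventually_sequentially by (blast intro: ennreal_leI)
    qed simp
    finally show ?thesis .
  qed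
  \<comment> \<open>One Cauchy bound already shows \<open>F\<close> to be square integrable, as the
    sum of \<open>Y N\<^sub>1\<close> and a square-integrable difference.\<close>
  obtain N\<^sub>1 where N\<^sub>1: "\<And>m n. \<lbrakk>N\<^sub>1 \<le> m; N\<^sub>1 \<le> n\<rbrakk> \<Longrightarrow> norm (Y m - Y n) < 1"
    using CauchyD[OF assms(1), of 1] by auto
  have "(\<integral>\<^sup>+x. ennreal ((norm (F x - rep_L2 (Y N\<^sub>1) x))\<^sup>2) \<partial>lebesgue) \<le> ennreal (1\<^sup>2)"
    by (rule bound[of N\<^sub>1]) (use N\<^sub>1 in auto)
  then have "integrable lebesgue (\<lambda>x. (norm (F x - rep_L2 (Y N\<^sub>1) x))\<^sup>2)"
    by (intro integrableI_nonneg) (auto intro: le_less_trans)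
  then have "sq_integrable (\<lambda>x. F x - rep_L2 (Y N\<^sub>1) x)" by (simp add: sq_integrable_def)
  from sq_integrable_add[OF this sq_integrable_rep_L2[of "Y N\<^sub>1"]]
  have F: "sq_integrable F" by simp
  have "Y \<longlonglongrightarrow> abs_L2 F"
  proof (rule LIMSEQ_I)
    fix e :: real assume "0 < e"
    then obtain N where N: "\<And>m n. \<lbrakk>N \<le> m; N \<le> n\<rbrakk> \<Longrightarrow> norm (Y m - Y n) < e / 2"
      using CauchyD[OF assms(1), of "e / 2"] by auto
    have "norm (Y n - abs_L2 F) < e" if "N \<le> n" for n
    proof -
      have "ennreal ((norm (abs_L2 F - Y n))\<^sup>2) \<le> ennreal ((e / 2)\<^sup>2)"
        unfolding norm_sq_diff_abs_L2[OF F] by (rule bound[of N]) (use N that in auto)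
      then have "(norm (abs_L2 F - Y n))\<^sup>2 \<le> (e / 2)\<^sup>2" by simp
      then have "norm (abs_L2 F - Y n) \<le> e / 2" by (rule power2_le_imp_le) (use \<open>0 < e\<close> in simp)
      then show ?thesis using \<open>0 < e\<close> by (simp add: norm_minus_commute)
    qed
    then show "\<exists>N. \<forall>n\<ge>N. norm (Y n - abs_L2 F) < e" by blast
  qed
  then show ?thesis by (auto simp: convergent_def)
qed

instance L2 :: (euclidean_space, euclidean_space) complete_space
proof
  fix X :: "nat \<Rightarrow> ('a, 'b) L2" assume X: "Cauchy X"
  obtain r where r: "strict_mono r" "\<And>n. norm (X (r (Suc n)) - X (r n)) < (1/4)^n"
    using Cauchy_fast_subseq[OF X, of "\<lambda>n. (1/4)^n"] by auto
  have "convergent (X \<circ> r)"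
    using L2_convergent_if_fast[OF Cauchy_subseq_Cauchy[OF X r(1)]] r(2) by simp
  then obtain F where "(X \<circ> r) \<longlonglongrightarrow> F" by (auto simp: convergent_def)
  then show "convergent X"
    using Cauchy_converges_subseq[OF X r(1)] by (auto simp: convergent_def)
qed

lemma subspace_L2_on: "subspace (L2_on \<Omega> :: ('a::euclidean_space, 'b::euclidean_space) L2 set)"
proof (rule subspaceI)
  show "0 \<in> L2_on \<Omega>"
    unfolding L2_on_def using rep_L2_zero by (auto elim!: eventually_mono)
  fix f g :: "('a, 'b) L2" assume "f \<in> L2_on \<Omega>" "g \<in> L2_on \<Omega>"
  then have "AE x in lebesgue. x \<notin> \<Omega> \<longrightarrow> rep_L2 f x = 0" "AE x in lebesgue. x \<notin> \<Omega> \<longrightarrow> rep_L2 g x = 0"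
    by (auto simp: L2_on_def)
  with rep_L2_add[of f g] have "AE x in lebesgue. x \<notin> \<Omega> \<longrightarrow> rep_L2 (f + g) x = 0"
    by eventually_elim auto
  then show "f + g \<in> L2_on \<Omega>" by (simp add: L2_on_def)
next
  fix f :: "('a, 'b) L2" and c assume "f \<in> L2_on \<Omega>"
  then have "AE x in lebesgue. x \<notin> \<Omega> \<longrightarrow> rep_L2 f x = 0" by (simp add: L2_on_def)
  with rep_L2_scaleR[of c f] have "AE x in lebesgue. x \<notin> \<Omega> \<longrightarrow> rep_L2 (c *\<^sub>R f) x = 0"
    by eventually_elim auto
  then show "c *\<^sub>R f \<in> L2_on \<Omega>" by (simp add: L2_on_def)
qed

text \<open>Closedness suffices: each \<open>X n\<close> vanishes outside \<Omega>, so the mass of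
  the limit \<open>f\<close> there is at most \<open>(norm (f - X n))\<^sup>2\<close>.\<close>

lemma complete_L2_on:
  fixes \<Omega> :: "'a::euclidean_space set"
  assumes [measurable]: "\<Omega> \<in> sets lebesgue"
  shows "complete (L2_on \<Omega> :: ('a, 'b::euclidean_space) L2 set)"
  unfolding complete_eq_closed closed_sequential_limits
proof (intro allI impI, elim conjE)
  fix X and f :: "('a, 'b) L2"
  assume X: "\<forall>n. X n \<in> L2_on \<Omega>" and lim: "X \<longlonglongrightarrow> f"
  define w where "w x = ennreal (indicator (- \<Omega>) x * (norm (rep_L2 f x))\<^sup>2)" for x
  have [measurable]: "w \<in> borel_measurable lebesgue" unfolding w_def by measurable
  have "integral\<^sup>N lebesgue w \<le> ennreal ((norm (f - X n))\<^sup>2)" for n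
    unfolding norm_diff_L2_nn[symmetric]
  proof (rule nn_integral_mono_AE)
    have "AE x in lebesgue. x \<notin> \<Omega> \<longrightarrow> rep_L2 (X n) x = 0" using X by (auto simp: L2_on_def)
    then show "AE x in lebesgue. w x \<le> ennreal ((norm (rep_L2 f x - rep_L2 (X n) x))\<^sup>2)"
      by eventually_elim (auto simp: w_def indicator_def)
  qed
  moreover have "(\<lambda>n. ennreal ((norm (f - X n))\<^sup>2)) \<longlonglongrightarrow> ennreal ((norm (f - f))\<^sup>2)"
    using lim by (intro tendsto_intros tendsto_ennrealI)
  ultimately have "integral\<^sup>N lebesgue w \<le> ennreal ((norm (f - f))\<^sup>2)"
    by (intro LIMSEQ_le_const) auto
  then have "AE x in lebesgue. w x = 0" by (simp add: nn_integral_0_iff_AE)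
  then have "AE x in lebesgue. x \<notin> \<Omega> \<longrightarrow> rep_L2 f x = 0"
    by eventually_elim (auto simp: w_def indicator_def)
  then show "f \<in> L2_on \<Omega>" by (simp add: L2_on_def)
qed

section \<open>The fundamental lemma of the calculus of variations\<close>

text \<open>The classical flat function is the case \<open>k = 0\<close>. The powers of
  \<open>1 / t\<close> make the span of the family closed under differentiation, so smoothness is a
  single induction.\<close>

definition flat_exp :: "nat \<Rightarrow> real \<Rightarrow> real" where
  "flat_exp k t = (if 0 < t then exp (- (1 / t)) / t ^ k else 0)"

lemma flat_exp_tendsto_0: "(flat_exp k \<longlongrightarrow> 0) (at 0)"
  unfolding filterlim_split_at_real
proof (intro filterlim_split_at)
  show "(flat_exp k \<longlongrightarrow> 0) (at_left 0)"
    by (rule tendsto_eventually) (auto simp: flat_exp_def eventually_at_left_field intro: exI[of _ "-1"])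
  have "((\<lambda>t. inverse t ^ k / exp (inverse t)) \<longlongrightarrow> (0::real)) (at_right 0)"
    by (rule filterlim_compose[OF tendsto_power_div_exp_0 filterlim_inverse_at_top_right])
  moreover have "\<forall>\<^sub>F t in at_right 0. inverse t ^ k / exp (inverse t) = flat_exp k t"
    using eventually_at_right_less[of "0::real"]
    by eventually_elim (simp add: flat_exp_def exp_minus field_simps)
  ultimately show "(flat_exp k \<longlongrightarrow> 0) (at_right 0)" by (rule Lim_transform_eventually)
qed

lemma flat_exp_DERIV:
  "(flat_exp k has_real_derivative flat_exp (k + 2) t - real k * flat_exp (k + 1) t) (at t)"
proof -
  consider "0 < t" | "t < 0" | "t = 0" by linarith
  then show ?thesis
  proof cases
    case 1
    have "((\<lambda>t. exp (- (1 / t)) / t ^ k) has_real_derivative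
        (exp (- (1 / t)) * (1 / (t * t)) * t ^ k - exp (- (1 / t)) * (real k * t ^ (k - 1))) / (t ^ k * t ^ k)) (at t)"
      using 1 by (auto intro!: derivative_eq_intros)
    also have "(exp (- (1 / t)) * (1 / (t * t)) * t ^ k - exp (- (1 / t)) * (real k * t ^ (k - 1))) / (t ^ k * t ^ k)
        = flat_exp (k + 2) t - real k * flat_exp (k + 1) t"
      using 1 by (cases k) (simp_all add: flat_exp_def field_simps)
    finally have "((\<lambda>t. exp (- (1 / t)) / t ^ k) has_real_derivative
        flat_exp (k + 2) t - real k * flat_exp (k + 1) t) (at t)" .
    then show ?thesis
      by (rule has_field_derivative_transform_within_open[of _ _ _ "{0<..}"]) (use 1 in \<open>auto simp: flat_exp_def\<close>)
  next
    case 2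
    have "((\<lambda>t. 0) has_real_derivative flat_exp (k + 2) t - real k * flat_exp (k + 1) t) (at t)"
      using 2 by (simp add: flat_exp_def)
    then show ?thesis
      by (rule has_field_derivative_transform_within_open[of _ _ _ "{..<0}"]) (use 2 in \<open>auto simp: flat_exp_def\<close>)
  next
    case 3
    \<comment> \<open>The difference quotient at 0 is the next member of the family, whose limit is
      already known.\<close>
    have "\<forall>\<^sub>F t in at 0. flat_exp (k + 1) t = (flat_exp k t - flat_exp k 0) / (t - 0)"
      by (auto simp: flat_exp_def eventually_at intro!: exI[of _ 1])
    with flat_exp_tendsto_0 have "((\<lambda>t. (flat_exp k t - flat_exp k 0) / (t - 0)) \<longlongrightarrow> 0) (at 0)"
      by (rule Lim_transform_eventually)
    then show ?thesis using 3 by (simp add: has_field_derivative_iff flat_exp_def)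
  qed
qed

section \<open>Closure properties of \<open>Ck\<close> and smooth bumps\<close>

lemma gradient_nth:
  assumes "(f has_derivative f') (at x)" shows "gradient f x $ i = f' (axis i 1)"
  by (simp add: gradient_def frechet_derivative_at[OF assms, symmetric])

lemma Ck_SucD: "Ck (Suc k) f \<Longrightarrow> Ck k f"
proof (induction k arbitrary: f)
  case 0
  then show ?case
    by (auto simp: continuous_on_eq_continuous_at intro!: differentiable_imp_continuous_within)
next
  case (Suc k)
  then show ?case by (metis Ck.simps(2))
qed

lemma Ck_const: "Ck k (\<lambda>x :: real^'d. c)"
proof (induction k arbitrary: c)
  case (Suc k)
  have "gradient (\<lambda>x. c) x $ i = 0" for x :: "real^'d" and i
    by (subst gradient_nth[OF has_derivative_const]) simp
  then show ?case using Suc[of 0] by simp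
qed simp

lemma Ck_add: "Ck k f \<Longrightarrow> Ck k g \<Longrightarrow> Ck k (\<lambda>x. f x + g x)"
proof (induction k arbitrary: f g)
  case (Suc k)
  have "gradient (\<lambda>x. f x + g x) x $ i = gradient f x $ i + gradient g x $ i" for x i
  proof -
    obtain f' g' where d: "(f has_derivative f') (at x)" "(g has_derivative g') (at x)"
      using Suc.prems unfolding Ck.simps differentiable_def by blast
    show ?thesis using gradient_nth[OF has_derivative_add[OF d]] by (simp add: gradient_nth[OF d(1)] gradient_nth[OF d(2)])
  qed
  then show ?case using Suc by auto
qed (auto intro: continuous_on_add)

lemma Ck_mult: "Ck k f \<Longrightarrow> Ck k g \<Longrightarrow> Ck k (\<lambda>x. f x * g x)"
proof (induction k arbitrary: f g)
  case (Suc k)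
  have "gradient (\<lambda>x. f x * g x) x $ i = f x * gradient g x $ i + gradient f x $ i * g x" for x i
  proof -
    obtain f' g' where d: "(f has_derivative f') (at x)" "(g has_derivative g') (at x)"
      using Suc.prems unfolding Ck.simps differentiable_def by blast
    show ?thesis using gradient_nth[OF has_derivative_mult[OF d]] by (simp add: gradient_nth[OF d(1)] gradient_nth[OF d(2)])
  qed
  moreover have "Ck k (\<lambda>x. f x * gradient g x $ i + gradient f x $ i * g x)" for i
    using Suc.prems Suc.prems[THEN Ck_SucD] by (intro Ck_add Suc.IH) auto
  ultimately show ?case using Suc.prems by auto
qed (auto intro: continuous_on_mult)

lemma Ck_prod: "(\<And>i. i \<in> I \<Longrightarrow> Ck k (f i)) \<Longrightarrow> Ck k (\<lambda>x. \<Prod>i\<in>I. f i x)"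
  by (induction I rule: infinite_finite_induct) (auto intro: Ck_const Ck_mult)

text \<open>The induction must range over all \<open>m\<close>, because differentiation raises the
  exponent.\<close>

lemma Ck_flat_exp: "Ck k (\<lambda>x :: real^'d. flat_exp m (c * x $ j + b))"
proof (induction k arbitrary: m)
  case 0
  have "continuous_on UNIV (flat_exp m)"
    by (intro DERIV_continuous_on) (auto intro: has_field_derivative_at_within[OF flat_exp_DERIV])
  then show ?case
    unfolding Ck.simps by (rule continuous_on_compose2) (auto intro!: continuous_intros)
next
  case (Suc k)
  define F where "F x = flat_exp (m + 2) (c * x $ j + b) - real m * flat_exp (m + 1) (c * x $ j + b)" for x :: "real^'d"
  have d: "((\<lambda>x. flat_exp m (c * x $ j + b)) has_derivative (\<lambda>h. F x * (c * h $ j))) (at x)" for x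
    unfolding F_def
    by (rule has_derivative_compose[OF _ flat_exp_DERIV[THEN has_field_derivative_imp_has_derivative]])
      (auto intro!: derivative_eq_intros bounded_linear.has_derivative[OF bounded_linear_vec_nth])
  have "gradient (\<lambda>x. flat_exp m (c * x $ j + b)) x $ i = (c * axis i 1 $ j) * F x" for x i
    by (subst gradient_nth[OF d]) simp
  moreover have "Ck k (\<lambda>x. r * F x)" for r
  proof -
    have "r * F x = r * (flat_exp (m + 2) (c * x $ j + b) + (- real m) * flat_exp (m + 1) (c * x $ j + b))" for x
      by (simp add: F_def)
    then show ?thesis by (simp only:) (intro Ck_mult Ck_const Ck_add Suc.IH)
  qed
  ultimately have "Ck k (\<lambda>x. gradient (\<lambda>x. flat_exp m (c * x $ j + b)) x $ i)" for i
    by (simp only:)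
  then show ?case using d unfolding Ck.simps differentiable_def by blast
qed

text \<open>Inside the box every factor \<open>exp (- 1 / (n * s))\<close> tends to 1, outside some
  factor is 0: smooth approximations of the indicator of an open box, bounded by 1.\<close>

definition box_bump :: "real^'d \<Rightarrow> real^'d \<Rightarrow> nat \<Rightarrow> real^'d \<Rightarrow> real" where
  "box_bump a b n x = (\<Prod>i\<in>UNIV. flat_exp 0 (real n * (x $ i - a $ i)) * flat_exp 0 (real n * (b $ i - x $ i)))"

lemma flat_exp_0_bounds: "0 \<le> flat_exp 0 t" "flat_exp 0 t \<le> 1"
  by (auto simp: flat_exp_def)

lemma box_bump_bounds: "0 \<le> box_bump a b n x" "box_bump a b n x \<le> 1"
  by (auto simp: box_bump_def flat_exp_0_bounds intro!: prod_nonneg prod_le_1 mult_le_one)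

lemma box_bump_outside:
  assumes "x \<notin> box a b" shows "box_bump a b n x = 0"
proof -
  obtain i where "\<not> a $ i < x $ i \<or> \<not> x $ i < b $ i" using assms by (auto simp: mem_box_cart)
  then have "flat_exp 0 (real n * (x $ i - a $ i)) * flat_exp 0 (real n * (b $ i - x $ i)) = 0"
    by (auto simp: flat_exp_def zero_less_mult_iff)
  then show ?thesis unfolding box_bump_def by (intro prod_zero) auto
qed

text \<open>The compact set required of a test function is the closed box, hence the assumption on
  \<open>cbox a b\<close>.\<close>

lemma test_fun_box_bump:
  assumes "cbox a b \<subseteq> \<Omega>" shows "test_fun \<Omega> (box_bump a b n)"
proof -
  have "Ck k (box_bump a b n)" for k
  proof -
    define F where "F i x = flat_exp 0 (real n * x $ i + (- real n * a $ i)) * flat_exp 0 ((- real n) * x $ i + real n * b $ i)"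
      for i and x :: "real^'a"
    have "Ck k (F i)" for i
      unfolding F_def[abs_def] by (rule Ck_mult[OF Ck_flat_exp Ck_flat_exp])
    then have "Ck k (\<lambda>x. \<Prod>i\<in>UNIV. F i x)" by (intro Ck_prod)
    then show ?thesis by (simp add: F_def box_bump_def[abs_def] algebra_simps)
  qed
  moreover have "\<forall>x. x \<notin> cbox a b \<longrightarrow> box_bump a b n x = 0"
    using box_bump_outside box_subset_cbox by blast
  ultimately show ?thesis unfolding test_fun_def using assms compact_cbox by blast
qed

lemma box_bump_tendsto: "(\<lambda>n. box_bump a b n x) \<longlonglongrightarrow> indicator (box a b) x"
proof (cases "x \<in> box a b")
  case True
  have *: "(\<lambda>n. flat_exp 0 (real n * t)) \<longlonglongrightarrow> 1" if "0 < t" for t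
  proof -
    have "(\<lambda>n. exp (- (1 / t * (1 / real n)))) \<longlonglongrightarrow> exp (- (1 / t * 0))"
      by (intro tendsto_intros lim_1_over_n)
    then have "(\<lambda>n. exp (- (1 / t * (1 / real n)))) \<longlonglongrightarrow> 1" by simp
    moreover have "\<forall>\<^sub>F n in sequentially. exp (- (1 / t * (1 / real n))) = flat_exp 0 (real n * t)"
      using eventually_gt_at_top[of 0] by eventually_elim (use that in \<open>simp add: flat_exp_def ac_simps\<close>)
    ultimately show ?thesis by (rule Lim_transform_eventually)
  qed
  have "(\<lambda>n. box_bump a b n x) \<longlonglongrightarrow> (\<Prod>i\<in>(UNIV :: 'a set). 1 * 1)"
    unfolding box_bump_def using True by (intro tendsto_prod tendsto_mult *) (auto simp: mem_box_cart)
  then show ?thesis using True by simp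
qed (simp add: box_bump_outside)

text \<open>Boxes are stable under intersection and generate the Borel sets, so the integral
  vanishes over every Borel set, then over every Lebesgue set, in particular over the sets where
  \<open>f\<close> has a fixed sign.\<close>

lemma zero_AE_if_zero_on_boxes:
  fixes f :: "'a::euclidean_space \<Rightarrow> real"
  assumes f: "integrable lebesgue f" and f0: "(LINT x|lebesgue. f x) = 0"
    and boxes: "\<And>a b. (LINT x:box a b|lebesgue. f x) = 0"
  shows "AE x in lebesgue. f x = 0"
proof -
  have [measurable]: "f \<in> borel_measurable lebesgue" using f by auto
  have si: "set_integrable lebesgue A f" if "A \<in> sets lebesgue" for A
    unfolding set_integrable_def using that f by (rule integrable_mult_indicator)
  define E where "E = range (\<lambda>(a, b). box a b :: 'a set)"
  have borel_E: "sets borel = sigma_sets UNIV E"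
    by (simp add: borel_eq_box E_def)
  have E_sets: "A \<in> sets lebesgue" if "A \<in> sigma_sets UNIV E" for A
    using that by (simp add: borel_E[symmetric] sets_completionI_sets)
  have "Int_stable E"
    unfolding E_def Int_stable_def by (auto simp: box_Int_box)
  moreover have "E \<subseteq> Pow UNIV" by simp
  ultimately have borel: "(LINT x:A|lebesgue. f x) = 0" if "A \<in> sigma_sets UNIV E" for A
    using that
  proof (induction rule: sigma_sets_induct_disjoint)
    case (basic A)
    then show ?case using boxes by (auto simp: E_def)
  next
    case (compl A)
    have A: "A \<in> sets lebesgue" by (rule E_sets[OF compl(1)])
    have "(LINT x:A \<union> (UNIV - A)|lebesgue. f x) = (LINT x:A|lebesgue. f x) + (LINT x:UNIV - A|lebesgue. f x)"
      using A by (intro set_integral_Un si) auto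
    \<comment> \<open>The vanishing total integral is what gives closure under complements.\<close>
    then show ?case using compl(2) f0 by (simp add: set_lebesgue_integral_def)
  next
    case (union A)
    have A: "A i \<in> sets lebesgue" for i using union(2) by (intro E_sets) auto
    have "(LINT x:(\<Union>i. A i)|lebesgue. f x) = (\<Sum>i. (LINT x:A i|lebesgue. f x))"
      using union(1) A by (intro lebesgue_integral_countable_add si) (auto simp: disjoint_family_on_def)
    then show ?case using union by simp
  qed (simp add: set_lebesgue_integral_def)
  have zero: "(LINT x:A|lebesgue. f x) = 0" if A: "A \<in> sets lebesgue" for A
  proof -
    \<comment> \<open>A Lebesgue set differs from a Borel set by a null set, which the integral
      ignores.\<close>
    obtain S N where SN: "S \<in> sets borel" "negligible N" "S \<union> N = A"
      using sets_lebesgue_almost_borel[OF A] by blast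
    have S: "S \<in> sets lebesgue" using SN by (simp add: sets_completionI_sets)
    have "AE x in lebesgue. x \<notin> N"
      using SN(2) by (simp add: negligible_iff_null_sets AE_not_in)
    then have "AE x in lebesgue. x \<in> S \<longleftrightarrow> x \<in> A" by eventually_elim (use SN(3) in auto)
    then have "(LINT x:A|lebesgue. f x) = (LINT x:S|lebesgue. f x)"
      using A S by (intro set_integral_cong_set) (auto simp: set_borel_measurable_def)
    then show ?thesis using borel[of S] SN(1) by (simp add: borel_E)
  qed
  \<comment> \<open>The scalar \<open>s\<close> is a sign, so that one argument treats both the
    positive and the negative part.\<close>
  have part: "AE x in lebesgue. indicator A x *\<^sub>R f x = 0"
    if A: "A \<in> sets lebesgue" and pos: "\<And>x. x \<in> A \<Longrightarrow> 0 \<le> s * f x" and s: "s \<noteq> 0" for A and s :: real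
  proof -
    have "integrable lebesgue (\<lambda>x. s * (indicator A x *\<^sub>R f x))"
      using si[OF A] by (simp add: set_integrable_def)
    moreover have "(LINT x|lebesgue. s * (indicator A x *\<^sub>R f x)) = 0"
      using zero[OF A] by (simp add: set_lebesgue_integral_def)
    moreover have "0 \<le> s * (indicator A x *\<^sub>R f x)" for x using pos by (simp add: indicator_def)
    ultimately have "AE x in lebesgue. s * (indicator A x *\<^sub>R f x) = 0"
      by (subst (asm) integral_nonneg_eq_0_iff_AE) auto
    then show ?thesis using s by simp
  qed
  have "{x \<in> space lebesgue. 0 < f x} \<in> sets lebesgue" "{x \<in> space lebesgue. f x < 0} \<in> sets lebesgue"
    by measurable
  then have "AE x in lebesgue. indicator {x. 0 < f x} x *\<^sub>R f x = 0"
    "AE x in lebesgue. indicator {x. f x < 0} x *\<^sub>R f x = 0"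
    using part[of "{x. 0 < f x}" 1] part[of "{x. f x < 0}" "-1"] by simp_all
  then show ?thesis by eventually_elim (auto simp: indicator_def split: if_splits)
qed

text \<open>Bumps and dominated convergence turn the test condition into vanishing integrals over
  open boxes with closure in \<Omega>; countably many such closures exhaust \<Omega>.\<close>

lemma fundamental_lemma_calculus_of_variations:
  fixes u :: "real^'d \<Rightarrow> real"
  assumes \<Omega>: "open \<Omega>" and u [measurable]: "u \<in> borel_measurable lebesgue"
    and loc: "\<And>a b. cbox a b \<subseteq> \<Omega> \<Longrightarrow> set_integrable lebesgue (cbox a b) u"
    and test: "\<And>\<phi>. test_fun \<Omega> \<phi> \<Longrightarrow> (LINT x:\<Omega>|lebesgue. u x * \<phi> x) = 0"
  shows "AE x in lebesgue. x \<in> \<Omega> \<longrightarrow> u x = 0"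
proof -
  have [measurable]: "\<Omega> \<in> sets lebesgue" using \<Omega> by (simp add: borel_open sets_completionI_sets)
  have box_zero: "(LINT x:box a b|lebesgue. u x) = 0" if ab: "cbox a b \<subseteq> \<Omega>" for a b
  proof -
    have [measurable]: "box a b \<in> sets lebesgue" "cbox a b \<in> sets lebesgue" by auto
    have [measurable]: "box_bump a b n \<in> borel_measurable lebesgue" for n
    proof -
      have "Ck 0 (box_bump a b n)" using test_fun_box_bump[OF ab] by (simp add: test_fun_def)
      then show ?thesis by (auto intro!: measurable_completion borel_measurable_continuous_onI)
    qed
    have "(\<lambda>n. LINT x|lebesgue. indicator \<Omega> x *\<^sub>R (u x * box_bump a b n x))
      \<longlonglongrightarrow> (LINT x|lebesgue. indicator (box a b) x *\<^sub>R u x)"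
    proof (rule integral_dominated_convergence[where w = "\<lambda>x. norm (indicator (cbox a b) x *\<^sub>R u x)"])
      show "integrable lebesgue (\<lambda>x. norm (indicator (cbox a b) x *\<^sub>R u x))"
        using loc[OF ab] by (simp only: set_integrable_def integrable_norm)
      show "AE x in lebesgue. (\<lambda>n. indicator \<Omega> x *\<^sub>R (u x * box_bump a b n x)) \<longlonglongrightarrow> indicator (box a b) x *\<^sub>R u x"
      proof (rule AE_I2)
        fix x
        have eq: "indicator (box a b) x *\<^sub>R u x = indicator \<Omega> x * u x * indicator (box a b) x"
          using ab box_subset_cbox[of a b] by (auto simp: indicator_def)
        show "(\<lambda>n. indicator \<Omega> x *\<^sub>R (u x * box_bump a b n x)) \<longlonglongrightarrow> indicator (box a b) x *\<^sub>R u x"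
          unfolding eq unfolding real_scaleR_def mult.assoc[symmetric]
          by (intro tendsto_mult tendsto_const box_bump_tendsto)
      qed
      show "AE x in lebesgue. norm (indicator \<Omega> x *\<^sub>R (u x * box_bump a b n x)) \<le> norm (indicator (cbox a b) x *\<^sub>R u x)" for n
      proof (rule AE_I2)
        fix x
        have "x \<in> cbox a b" if "box_bump a b n x \<noteq> 0"
          using box_bump_outside[of x a b n] that box_subset_cbox by blast
        then show "norm (indicator \<Omega> x *\<^sub>R (u x * box_bump a b n x)) \<le> norm (indicator (cbox a b) x *\<^sub>R u x)"
          using box_bump_bounds[of a b n x]
          by (cases "box_bump a b n x = 0") (auto simp: indicator_def abs_mult mult_left_le)
      qed
    qed measurable
    moreover have "(LINT x|lebesgue. indicator \<Omega> x *\<^sub>R (u x * box_bump a b n x)) = 0" for n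
      using test[OF test_fun_box_bump[OF ab]] by (simp add: set_lebesgue_integral_def)
    ultimately show ?thesis by (simp add: set_lebesgue_integral_def LIMSEQ_const_iff)
  qed
  have on_box: "AE x in lebesgue. x \<in> cbox a b \<longrightarrow> u x = 0" if ab: "cbox a b \<subseteq> \<Omega>" for a b
  proof -
    \<comment> \<open>Only local integrability of \<open>u\<close> is available; cutting off to a
      box gives an integrable function on the whole space.\<close>
    define f where "f x = indicator (box a b) x *\<^sub>R u x" for x
    have "set_integrable lebesgue (box a b) u"
      by (rule set_integrable_subset[OF loc[OF ab]]) (auto simp: box_subset_cbox)
    then have f: "integrable lebesgue f" by (simp add: set_integrable_def f_def[abs_def])
    have "AE x in lebesgue. f x = 0"
    proof (rule zero_AE_if_zero_on_boxes[OF f])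
      show "(LINT x|lebesgue. f x) = 0" using box_zero[OF ab] by (simp add: f_def set_lebesgue_integral_def)
      fix c d
      \<comment> \<open>Corners of the intersection: an arbitrary box meets \<open>box a b\<close>
        in a box whose closure still lies in \<Omega>.\<close>
      define p q where "p = (\<Sum>i\<in>Basis. max (a\<bullet>i) (c\<bullet>i) *\<^sub>R i)" and "q = (\<Sum>i\<in>Basis. min (b\<bullet>i) (d\<bullet>i) *\<^sub>R i)"
      have pq: "box a b \<inter> box c d = box p q" "cbox a b \<inter> cbox c d = cbox p q"
        unfolding p_def q_def by (rule box_Int_box, rule Int_interval)
      have "(LINT x:box c d|lebesgue. f x) = (LINT x:box p q|lebesgue. u x)"
        unfolding set_lebesgue_integral_def f_def pq(1)[symmetric]
        by (intro Bochner_Integration.integral_cong) (auto simp: indicator_def)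
      also have "\<dots> = 0" using pq(2) ab by (intro box_zero) auto
      finally show "(LINT x:box c d|lebesgue. f x) = 0" .
    qed
    \<comment> \<open>The exhaustion below uses closed boxes, while the integrals concern open ones;
      the boundary is a null set.\<close>
    moreover have "AE x in lebesgue. x \<notin> cbox a b - box a b"
      by (rule AE_not_in) (use negligible_frontier_interval[of a b] in \<open>simp add: negligible_iff_null_sets\<close>)
    ultimately show ?thesis by eventually_elim (auto simp: f_def indicator_def)
  qed
  obtain \<D> where \<D>: "countable \<D>" "\<D> \<subseteq> Pow \<Omega>" "\<And>X. X \<in> \<D> \<Longrightarrow> \<exists>a b. X = cbox a b" "\<Union>\<D> = \<Omega>"
    using open_countable_Union_open_cbox[OF \<Omega>] by blast
  have "AE x in lebesgue. \<forall>X\<in>\<D>. x \<in> X \<longrightarrow> u x = 0"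
    unfolding AE_ball_countable[OF \<D>(1)] using \<D>(2,3) on_box by blast
  then show ?thesis by eventually_elim (use \<D>(4) in blast)
qed

section \<open>The weak divergence\<close>

lemma sq_integrable_bounded_linear:
  assumes h: "bounded_linear h" and f: "sq_integrable f"
  shows "sq_integrable (\<lambda>x. h (f x))"
proof -
  obtain C where C: "\<And>x. norm (h x) \<le> norm x * C"
    using bounded_linear.bounded[OF h] by blast
  have [measurable]: "f \<in> borel_measurable lebesgue" "h \<in> borel_measurable borel"
    using f by (auto simp: sq_integrable_def linear_continuous_on[OF h] intro: borel_measurable_continuous_onI)
  have le: "(norm (h y))\<^sup>2 \<le> (norm y)\<^sup>2 * C\<^sup>2" for y
    using power_mono[OF C[of y], of 2] by (simp add: power_mult_distrib)
  have "integrable lebesgue (\<lambda>x. (norm (f x))\<^sup>2 * C\<^sup>2)" using f by (auto simp: sq_integrable_def)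
  then have "integrable lebesgue (\<lambda>x. (norm (h (f x)))\<^sup>2)"
    by (rule Bochner_Integration.integrable_bound) (use le in auto)
  then show ?thesis by (simp add: sq_integrable_def)
qed

lemma sq_integrable_compact_support:
  fixes f :: "'a::euclidean_space \<Rightarrow> 'b::euclidean_space"
  assumes f: "continuous_on UNIV f" and S: "compact S" "\<And>x. x \<notin> S \<Longrightarrow> f x = 0"
  shows "sq_integrable f"
proof -
  have [measurable]: "f \<in> borel_measurable lebesgue"
    using borel_measurable_continuous_onI[OF f] by (intro measurable_completion) simp
  have "continuous_on S (\<lambda>x. (norm (f x))\<^sup>2)"
    by (intro continuous_intros continuous_on_subset[OF f]) simp
  from borel_integrable_compact[OF S(1) this]
  have "integrable lebesgue (\<lambda>x. indicator S x *\<^sub>R (norm (f x))\<^sup>2)"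
    by (simp add: integrable_completion borel_measurable_integrable)
  also have "(\<lambda>x. indicator S x *\<^sub>R (norm (f x))\<^sup>2) = (\<lambda>x. (norm (f x))\<^sup>2)"
    using S(2) by (auto simp: indicator_def fun_eq_iff)
  finally show ?thesis by (simp add: sq_integrable_def)
qed

lemma sq_integrable_test_fun:
  assumes "test_fun \<Omega> \<phi>"
  shows "sq_integrable \<phi>" "sq_integrable (gradient \<phi>)"
proof -
  obtain S where S: "compact S" "\<And>x. x \<notin> S \<Longrightarrow> \<phi> x = 0" and Ck: "\<And>k. Ck k \<phi>"
    using assms unfolding test_fun_def by blast
  show "sq_integrable \<phi>" using Ck[of 0] S by (intro sq_integrable_compact_support) auto
  have "continuous_on UNIV (\<lambda>x. \<chi> i. gradient \<phi> x $ i)"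
    using Ck[of "Suc 0"] by (intro continuous_on_vec_lambda) auto
  moreover have "gradient \<phi> x = 0" if "x \<notin> S" for x
  proof -
    have "((\<lambda>x. 0) has_derivative (\<lambda>x. 0)) (at x)" by simp
    then have "(\<phi> has_derivative (\<lambda>x. 0)) (at x)"
      by (rule has_derivative_transform_within_open[of _ _ _ _ "- S"]) (use S that compact_imp_closed in auto)
    then show ?thesis by (simp add: vec_eq_iff gradient_nth)
  qed
  ultimately show "sq_integrable (gradient \<phi>)" using S(1) by (intro sq_integrable_compact_support) auto
qed

lemma bounded_linear_column: "bounded_linear (column j :: real^'m^'d \<Rightarrow> real^'d)"
  unfolding linear_conv_bounded_linear[symmetric] by (auto intro!: linearI simp: column_def vec_eq_iff)

lemma sq_integrable_indicator:
  assumes "\<Omega> \<in> lmeasurable" shows "sq_integrable (indicator \<Omega> :: _ \<Rightarrow> real)"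
proof -
  have "(\<lambda>x. (norm (indicator \<Omega> x :: real))\<^sup>2) = indicator \<Omega>" by (auto simp: indicator_def)
  then show ?thesis using assms lmeasurable_iff_integrable[of \<Omega>] by (auto simp: sq_integrable_def)
qed

text \<open>A common shape for both sides of the weak divergence and both terms of the normal trace:
  \<open>h\<close> selects a column or a component, and \<psi> is a test function, its gradient or a
  representative. Linearity is thus proved once.\<close>

definition L2_pairing ::
    "'a::euclidean_space set \<Rightarrow> ('b::euclidean_space \<Rightarrow> 'c::euclidean_space) \<Rightarrow> ('a \<Rightarrow> 'c) \<Rightarrow> ('a, 'b) L2 \<Rightarrow> real" where
  "L2_pairing \<Omega> h \<psi> f = (LINT x:\<Omega>|lebesgue. h (rep_L2 f x) \<bullet> \<psi> x)"

context
  fixes \<Omega> :: "'a::euclidean_space set" and h :: "'b::euclidean_space \<Rightarrow> 'c::euclidean_space" and \<psi> :: "'a \<Rightarrow> 'c"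
  assumes \<Omega> [measurable]: "\<Omega> \<in> sets lebesgue" and h: "bounded_linear h" and \<psi>: "sq_integrable \<psi>"
begin

lemma set_integrable_L2_pairing: "set_integrable lebesgue \<Omega> (\<lambda>x. h (rep_L2 f x) \<bullet> \<psi> x)"
  unfolding set_integrable_def
  by (intro integrable_mult_indicator \<Omega> sq_integrable_inner sq_integrable_bounded_linear[OF h] sq_integrable_rep_L2 \<psi>)

text \<open>Needed because \<open>rep_L2\<close> respects the vector operations only almost
  everywhere.\<close>

lemma L2_pairing_cong_AE:
  assumes "AE x in lebesgue. rep_L2 f x = F x" "F \<in> borel_measurable lebesgue"
  shows "L2_pairing \<Omega> h \<psi> f = (LINT x:\<Omega>|lebesgue. h (F x) \<bullet> \<psi> x)"
proof -
  have [measurable]: "h \<in> borel_measurable borel" "\<psi> \<in> borel_measurable lebesgue" "F \<in> borel_measurable lebesgue"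
    using \<psi> assms(2) by (auto simp: sq_integrable_def linear_continuous_on[OF h] intro: borel_measurable_continuous_onI)
  show ?thesis
    unfolding L2_pairing_def set_lebesgue_integral_def
    by (rule integral_cong_AE) (use assms(1) in \<open>auto elim: eventually_mono\<close>)
qed

lemma L2_pairing_add: "L2_pairing \<Omega> h \<psi> (f + g) = L2_pairing \<Omega> h \<psi> f + L2_pairing \<Omega> h \<psi> g"
proof -
  have "L2_pairing \<Omega> h \<psi> (f + g) = (LINT x:\<Omega>|lebesgue. h (rep_L2 f x + rep_L2 g x) \<bullet> \<psi> x)"
    by (rule L2_pairing_cong_AE[OF rep_L2_add]) measurable
  also have "\<dots> = (LINT x:\<Omega>|lebesgue. h (rep_L2 f x) \<bullet> \<psi> x + h (rep_L2 g x) \<bullet> \<psi> x)"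
    by (simp add: linear_add[OF bounded_linear.linear[OF h]] inner_add_left)
  finally show ?thesis
    by (simp only: set_integral_add(2)[OF set_integrable_L2_pairing set_integrable_L2_pairing]) (simp add: L2_pairing_def)
qed

lemma L2_pairing_scaleR: "L2_pairing \<Omega> h \<psi> (c *\<^sub>R f) = c * L2_pairing \<Omega> h \<psi> f"
proof -
  have "L2_pairing \<Omega> h \<psi> (c *\<^sub>R f) = (LINT x:\<Omega>|lebesgue. h (c *\<^sub>R rep_L2 f x) \<bullet> \<psi> x)"
    by (rule L2_pairing_cong_AE[OF rep_L2_scaleR]) measurable
  also have "\<dots> = (LINT x:\<Omega>|lebesgue. c * (h (rep_L2 f x) \<bullet> \<psi> x))"
    by (simp add: linear_scale[OF bounded_linear.linear[OF h]])
  finally show ?thesis by (simp add: L2_pairing_def)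
qed

lemma L2_pairing_zero: "L2_pairing \<Omega> h \<psi> 0 = 0"
  using L2_pairing_scaleR[of 0 0] by simp

end

section \<open>Uniqueness and linearity of the weak divergence\<close>

lemma has_weak_div_iff_L2_pairing:
  "has_weak_div \<Omega> p v \<longleftrightarrow> (\<forall>\<phi>. test_fun \<Omega> \<phi> \<longrightarrow> (\<forall>j.
     L2_pairing \<Omega> (column j) (gradient \<phi>) p = - L2_pairing \<Omega> (\<lambda>y. y $ j) \<phi> v))"
  by (simp add: has_weak_div_def L2_pairing_def)

lemma normal_trace_eq_L2_pairing:
  "normal_trace \<Omega> p j u G = L2_pairing \<Omega> (column j) (rep_L2 G) p + L2_pairing \<Omega> (\<lambda>y. y $ j) (rep_L2 u) (weak_div \<Omega> p)"
  by (simp add: normal_trace_def L2_pairing_def)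

lemma sets_lebesgue_open: "open \<Omega> \<Longrightarrow> \<Omega> \<in> sets lebesgue"
  by (simp add: borel_open sets_completionI_sets)

lemma has_weak_div_add:
  assumes "open \<Omega>" "has_weak_div \<Omega> p v" "has_weak_div \<Omega> q w"
  shows "has_weak_div \<Omega> (p + q) (v + w)"
  using assms(2,3) unfolding has_weak_div_iff_L2_pairing
  by (simp add: L2_pairing_add sets_lebesgue_open[OF assms(1)] bounded_linear_column bounded_linear_vec_nth
      sq_integrable_test_fun)

lemma has_weak_div_scaleR:
  assumes "open \<Omega>" "has_weak_div \<Omega> p v"
  shows "has_weak_div \<Omega> (c *\<^sub>R p) (c *\<^sub>R v)"
  using assms(2) unfolding has_weak_div_iff_L2_pairing
  by (simp add: L2_pairing_scaleR sets_lebesgue_open[OF assms(1)] bounded_linear_column bounded_linear_vec_nth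
      sq_integrable_test_fun)

text \<open>Test functions see the difference only inside \<Omega>, where the fundamental lemma is
  applied to each component; outside, membership in \<open>L2_on \<Omega>\<close> makes it
  vanish.\<close>

lemma has_weak_div_unique:
  fixes \<Omega> :: "(real^'d) set" and p :: "(real^'d, real^'m^'d) L2"
  assumes \<Omega>: "open \<Omega>" and v: "v \<in> L2_on \<Omega>" "w \<in> L2_on \<Omega>" and div: "has_weak_div \<Omega> p v" "has_weak_div \<Omega> p w"
  shows "v = w"
proof -
  define z where "z = v + (- 1) *\<^sub>R w"
  have zero: "L2_pairing \<Omega> (\<lambda>y. y $ j) \<phi> z = 0" if "test_fun \<Omega> \<phi>" for \<phi> j
  proof -
    note hyps = sets_lebesgue_open[OF \<Omega>] bounded_linear_vec_nth sq_integrable_test_fun(1)[OF that]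
    show ?thesis
      using div that unfolding z_def L2_pairing_add[OF hyps] L2_pairing_scaleR[OF hyps]
        has_weak_div_iff_L2_pairing by simp
  qed
  have "AE x in lebesgue. x \<in> \<Omega> \<longrightarrow> rep_L2 z x $ j = 0" for j
  proof (rule fundamental_lemma_calculus_of_variations[OF \<Omega>])
    have sq: "sq_integrable (\<lambda>x. rep_L2 z x $ j)"
      by (rule sq_integrable_bounded_linear[OF bounded_linear_vec_nth sq_integrable_rep_L2])
    then show "(\<lambda>x. rep_L2 z x $ j) \<in> borel_measurable lebesgue" by (simp add: sq_integrable_def)
    show "set_integrable lebesgue (cbox a b) (\<lambda>x. rep_L2 z x $ j)" for a b
      using sq_integrable_inner[OF sq_integrable_indicator[OF lmeasurable_cbox] sq]
      by (simp add: set_integrable_def)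
    show "(LINT x:\<Omega>|lebesgue. rep_L2 z x $ j * \<phi> x) = 0" if "test_fun \<Omega> \<phi>" for \<phi>
      using zero[OF that] by (simp add: L2_pairing_def)
  qed
  then have "AE x in lebesgue. \<forall>j. x \<in> \<Omega> \<longrightarrow> rep_L2 z x $ j = 0" by (subst AE_all_countable) blast
  moreover have "AE x in lebesgue. x \<notin> \<Omega> \<longrightarrow> rep_L2 z x = 0"
  proof -
    have "z \<in> L2_on \<Omega>"
      unfolding z_def using v subspace_L2_on by (intro subspace_add subspace_scale) auto
    then show ?thesis by (simp add: L2_on_def)
  qed
  ultimately have "AE x in lebesgue. rep_L2 z x = rep_L2 0 x"
    using rep_L2_zero[where 'a = "real^'d" and 'b = "real^'m"] by eventually_elim (auto simp: vec_eq_iff)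
  then have "z = 0" by (simp add: L2_eq_iff_AE)
  then show ?thesis by (simp add: z_def)
qed

lemma weak_div_eqI:
  assumes "open \<Omega>" "v \<in> L2_on \<Omega>" "has_weak_div \<Omega> p v"
  shows "weak_div \<Omega> p = v"
  unfolding weak_div_def using assms has_weak_div_unique by (intro the_equality) auto

lemma Hdiv_weak_div:
  assumes "open \<Omega>" "p \<in> Hdiv \<Omega>"
  shows "weak_div \<Omega> p \<in> L2_on \<Omega>" "has_weak_div \<Omega> p (weak_div \<Omega> p)"
  using assms weak_div_eqI by (auto simp: Hdiv_def)

lemma
  fixes \<Omega> :: "(real^'d) set" and p q :: "(real^'d, real^'m^'d) L2"
  assumes \<Omega>: "open \<Omega>" and p: "p \<in> Hdiv \<Omega>" and q: "q \<in> Hdiv \<Omega>"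
  shows Hdiv_add: "p + q \<in> Hdiv \<Omega>"
    and weak_div_add: "weak_div \<Omega> (p + q) = weak_div \<Omega> p + weak_div \<Omega> q"
proof -
  have *: "weak_div \<Omega> p + weak_div \<Omega> q \<in> L2_on \<Omega>" "has_weak_div \<Omega> (p + q) (weak_div \<Omega> p + weak_div \<Omega> q)"
    using Hdiv_weak_div[OF \<Omega> p] Hdiv_weak_div[OF \<Omega> q]
    by (auto intro: subspace_add[OF subspace_L2_on] has_weak_div_add[OF \<Omega>])
  moreover have "p + q \<in> L2_on \<Omega>" using p q by (auto simp: Hdiv_def intro: subspace_add[OF subspace_L2_on])
  ultimately show "p + q \<in> Hdiv \<Omega>" by (auto simp: Hdiv_def)
  show "weak_div \<Omega> (p + q) = weak_div \<Omega> p + weak_div \<Omega> q" by (rule weak_div_eqI[OF \<Omega> *])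
qed

lemma
  fixes \<Omega> :: "(real^'d) set" and p :: "(real^'d, real^'m^'d) L2"
  assumes \<Omega>: "open \<Omega>" and p: "p \<in> Hdiv \<Omega>"
  shows Hdiv_scaleR: "c *\<^sub>R p \<in> Hdiv \<Omega>"
    and weak_div_scaleR: "weak_div \<Omega> (c *\<^sub>R p) = c *\<^sub>R weak_div \<Omega> p"
proof -
  have *: "c *\<^sub>R weak_div \<Omega> p \<in> L2_on \<Omega>" "has_weak_div \<Omega> (c *\<^sub>R p) (c *\<^sub>R weak_div \<Omega> p)"
    using Hdiv_weak_div[OF \<Omega> p]
    by (auto intro: subspace_scale[OF subspace_L2_on] has_weak_div_scaleR[OF \<Omega>])
  moreover have "c *\<^sub>R p \<in> L2_on \<Omega>" using p by (auto simp: Hdiv_def intro: subspace_scale[OF subspace_L2_on])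
  ultimately show "c *\<^sub>R p \<in> Hdiv \<Omega>" by (auto simp: Hdiv_def)
  show "weak_div \<Omega> (c *\<^sub>R p) = c *\<^sub>R weak_div \<Omega> p" by (rule weak_div_eqI[OF \<Omega> *])
qed

lemma zero_mem_Hdiv:
  fixes \<Omega> :: "(real^'d) set"
  assumes "open \<Omega>" shows "(0 :: (real^'d, real^'m^'d) L2) \<in> Hdiv \<Omega>"
proof -
  have "has_weak_div \<Omega> (0 :: (real^'d, real^'m^'d) L2) 0"
    by (simp add: has_weak_div_iff_L2_pairing L2_pairing_zero sets_lebesgue_open[OF assms]
        bounded_linear_column bounded_linear_vec_nth sq_integrable_test_fun)
  then show ?thesis by (auto simp: Hdiv_def subspace_0[OF subspace_L2_on] intro!: bexI[of _ 0])
qed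

lemma subspace_Hdiv0:
  fixes \<Omega> :: "(real^'d) set"
  assumes \<Omega>: "open \<Omega>"
  shows "subspace (Hdiv0 \<Omega> :: (real^'d, real^'m^'d) L2 set)"
proof -
  have add: "normal_trace \<Omega> (p + q) j u G = normal_trace \<Omega> p j u G + normal_trace \<Omega> q j u G"
    if "p \<in> Hdiv \<Omega>" "q \<in> Hdiv \<Omega>" for p q :: "(real^'d, real^'m^'d) L2" and j u G
    by (simp add: normal_trace_eq_L2_pairing weak_div_add[OF \<Omega> that] L2_pairing_add
        sets_lebesgue_open[OF \<Omega>] bounded_linear_column bounded_linear_vec_nth sq_integrable_rep_L2)
  have scale: "normal_trace \<Omega> (c *\<^sub>R p) j u G = c * normal_trace \<Omega> p j u G"
    if "p \<in> Hdiv \<Omega>" for c and p :: "(real^'d, real^'m^'d) L2" and j u G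
    by (simp add: normal_trace_eq_L2_pairing weak_div_scaleR[OF \<Omega> that] L2_pairing_scaleR
        sets_lebesgue_open[OF \<Omega>] bounded_linear_column bounded_linear_vec_nth sq_integrable_rep_L2 algebra_simps)
  have "normal_trace \<Omega> (0 :: (real^'d, real^'m^'d) L2) j u G = 0" for j u G
    using scale[OF zero_mem_Hdiv[OF \<Omega>], of 0] by simp
  then show ?thesis
    by (intro subspaceI) (simp_all add: Hdiv0_def zero_mem_Hdiv[OF \<Omega>] Hdiv_add[OF \<Omega>] Hdiv_scaleR[OF \<Omega>] add scale)
qed

lemma Hdiv0_subset: "Hdiv0 \<Omega> \<subseteq> Hdiv \<Omega>"
  by (auto simp: Hdiv0_def)

section \<open>The admissible set and the norm of \<open>V\<close>\<close>

lemma convex_admissible: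
  fixes \<Omega> :: "(real^'d) set"
  assumes \<Omega>: "open \<Omega>"
  shows "convex (admissible \<Omega> lam :: (real^'d, real^'m^'d) L2 set)"
proof (rule convexI)
  fix p q :: "(real^'d, real^'m^'d) L2" and s t :: real
  assume pq: "p \<in> admissible \<Omega> lam" "q \<in> admissible \<Omega> lam" and st: "0 \<le> s" "0 \<le> t" "s + t = 1"
  have "s *\<^sub>R p + t *\<^sub>R q \<in> Hdiv0 \<Omega>"
    using pq by (auto simp: admissible_def intro!: subspace_add[OF subspace_Hdiv0[OF \<Omega>]] subspace_scale[OF subspace_Hdiv0[OF \<Omega>]])
  moreover have "AE x in lebesgue. x \<in> \<Omega> \<longrightarrow> norm (rep_L2 (s *\<^sub>R p + t *\<^sub>R q) x) \<le> lam"
  proof -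
    have "AE x in lebesgue. x \<in> \<Omega> \<longrightarrow> norm (rep_L2 p x) \<le> lam" "AE x in lebesgue. x \<in> \<Omega> \<longrightarrow> norm (rep_L2 q x) \<le> lam"
      using pq by (auto simp: admissible_def)
    with rep_L2_add[of "s *\<^sub>R p" "t *\<^sub>R q"] rep_L2_scaleR[of s p] rep_L2_scaleR[of t q]
    show ?thesis
    proof eventually_elim
      case (elim x)
      show ?case
      proof
        assume "x \<in> \<Omega>"
        have "norm (rep_L2 (s *\<^sub>R p + t *\<^sub>R q) x) \<le> s * norm (rep_L2 p x) + t * norm (rep_L2 q x)"
          using elim st norm_triangle_ineq[of "s *\<^sub>R rep_L2 p x" "t *\<^sub>R rep_L2 q x"] by simp
        also have "\<dots> \<le> s * lam + t * lam"
          using elim \<open>x \<in> \<Omega>\<close> st by (intro add_mono mult_left_mono) auto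
        finally show "norm (rep_L2 (s *\<^sub>R p + t *\<^sub>R q) x) \<le> lam"
          using st by (simp add: distrib_right[symmetric])
      qed
    qed
  qed
  ultimately show "s *\<^sub>R p + t *\<^sub>R q \<in> admissible \<Omega> lam" by (simp add: admissible_def)
qed

text \<open>The pointwise constraint on a bounded domain; it supplies the \<open>L2\<close> half of
  the finiteness of \<open>R\<close>.\<close>

lemma norm_admissible_le:
  fixes \<Omega> :: "(real^'d) set" and p :: "(real^'d, real^'m^'d) L2"
  assumes \<Omega>: "open \<Omega>" "bounded \<Omega>" and p: "p \<in> admissible \<Omega> lam" and lam: "0 \<le> lam"
  shows "norm p \<le> lam * sqrt (measure lebesgue \<Omega>)"
proof (rule power2_le_imp_le)
  have lm: "\<Omega> \<in> lmeasurable" using \<Omega> by (simp add: bounded_set_imp_lmeasurable sets_lebesgue_open)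
  have "AE x in lebesgue. x \<notin> \<Omega> \<longrightarrow> rep_L2 p x = 0" "AE x in lebesgue. x \<in> \<Omega> \<longrightarrow> norm (rep_L2 p x) \<le> lam"
    using p by (auto simp: admissible_def Hdiv0_def Hdiv_def L2_on_def)
  then have "AE x in lebesgue. (norm (rep_L2 p x))\<^sup>2 \<le> lam\<^sup>2 * indicator \<Omega> x"
    by eventually_elim (auto simp: indicator_def power_mono)
  then have "(norm p)\<^sup>2 \<le> (LINT x|lebesgue. lam\<^sup>2 * indicator \<Omega> x)"
    unfolding norm_L2_sq using lm
    by (intro integral_mono_AE integrable_norm_sq_rep_L2) (auto simp: fmeasurable_def)
  also have "\<dots> = (lam * sqrt (measure lebesgue \<Omega>))\<^sup>2" using lm by (simp add: power_mult_distrib)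
  finally show "(norm p)\<^sup>2 \<le> (lam * sqrt (measure lebesgue \<Omega>))\<^sup>2" .
qed (use lam in simp)

lemma Hdiv_norm_nonneg: "0 \<le> Hdiv_norm \<Omega> p"
  by (simp add: Hdiv_norm_def)

lemma norm_weak_div_le_Hdiv_norm: "norm (weak_div \<Omega> p) \<le> Hdiv_norm \<Omega> p"
  by (simp add: Hdiv_norm_def real_le_rsqrt)

lemma weak_div_diff:
  assumes "open \<Omega>" "p \<in> Hdiv \<Omega>" "q \<in> Hdiv \<Omega>"
  shows "weak_div \<Omega> (p - q) = weak_div \<Omega> p - weak_div \<Omega> q"
  using weak_div_add[OF assms(1,2) Hdiv_scaleR[OF assms(1,3), of "-1"]] weak_div_scaleR[OF assms(1,3), of "-1"]
  by simp

lemma Hdiv_norm_minus_commute: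
  assumes "open \<Omega>" "p \<in> Hdiv \<Omega>" "q \<in> Hdiv \<Omega>"
  shows "Hdiv_norm \<Omega> (p - q) = Hdiv_norm \<Omega> (q - p)"
  by (simp add: Hdiv_norm_def weak_div_diff[OF assms(1)] assms norm_minus_commute)

section \<open>Convergence of the decomposition algorithms\<close>

theorem corollary6p4:
  fixes \<Omega> :: "(real^'d) set"
    and lam \<beta> \<tau> \<sigma> \<eta> \<rho> \<alpha> R \<Phi> C\<^sub>\<theta> :: real
    and g :: "(real^'d, real) L2"
    and T :: "(real^'d, real^'m) L2 \<Rightarrow> (real^'d, real) L2"
    and Tadj :: "(real^'d, real) L2 \<Rightarrow> (real^'d, real^'m) L2"
    and W :: "(real^'d, real^'m) L2 set"
    and V K :: "(real^'d, real^'m^'d) L2 set"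
    and B Binv S :: "(real^'d, real^'m) L2 \<Rightarrow> (real^'d, real^'m) L2"
    and \<Lambda> :: "(real^'d, real^'m^'d) L2 \<Rightarrow> (real^'d, real^'m) L2"
    and normV D :: "(real^'d, real^'m^'d) L2 \<Rightarrow> real"
    and M N\<^sub>s\<^sub>u\<^sub>r n\<^sub>0 :: nat
    and \<theta> :: "nat \<Rightarrow> (real^'d, real^'m^'d) L2 \<Rightarrow> (real^'d, real^'m^'d) L2"
    and p :: "nat \<Rightarrow> (real^'d, real^'m^'d) L2"
    and p_hat :: "(real^'d, real^'m^'d) L2"
  assumes "open \<Omega>" and "bounded \<Omega>" and "simply_connected \<Omega>" and "lipschitz_boundary \<Omega>"
    and "lam > 0" and "\<beta> \<ge> 0"
    and "W = L2_on \<Omega>" and "V = Hdiv0 \<Omega>" and "normV = Hdiv_norm \<Omega>" and "\<Lambda> = weak_div \<Omega>"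
    and "K = admissible \<Omega> lam"
    and "g \<in> L2_on \<Omega>"
    and "bounded_linear_between W norm (L2_on \<Omega>) norm T"
    and "bounded_linear_between (L2_on \<Omega>) norm W norm Tadj"
    and "\<forall>u\<in>W. \<forall>h\<in>L2_on \<Omega>. T u \<bullet> h = u \<bullet> Tadj h"
    and "\<exists>c\<^sub>B>0. \<forall>u\<in>W. (norm (T u))\<^sup>2 + \<beta> * (norm u)\<^sup>2 \<ge> c\<^sub>B * (norm u)\<^sup>2"
    and "B = (\<lambda>u. Tadj (T u) + \<beta> *\<^sub>R u)"
    and "Binv = inv_into W B"
    and "D = (\<lambda>q. 1/2 * energy_sq Binv (\<Lambda> q - Tadj g))"
    \<comment> \<open>decomposition\<close>
    and "M \<ge> 1"
    and "\<forall>i\<in>{1..M}. bounded_linear_between V normV V normV (\<theta> i)"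
    and "\<forall>q\<in>V. q = (\<Sum>i=1..M. \<theta> i q)"
    and "K = {\<Sum>i=1..M. \<theta> i (q i) | q. \<forall>i\<in>{1..M}. q i \<in> K}"
    \<comment> \<open>iterates\<close>
    and "N\<^sub>s\<^sub>u\<^sub>r \<ge> 1"
    and "\<tau> > op_norm W norm norm Binv"
    and "S = (\<lambda>w. \<tau> *\<^sub>R w - Binv w)"
    and "p 0 \<in> K"
    and "(0 < \<sigma> \<and> \<sigma> \<le> 1 / real M \<and> parallel_iterates \<Lambda> S D K \<theta> M \<sigma> N\<^sub>s\<^sub>u\<^sub>r p \<and> \<alpha> = 1) \<or>
         (0 < \<sigma> \<and> \<sigma> \<le> 1 \<and> sequential_iterates \<Lambda> S D K \<theta> M \<sigma> N\<^sub>s\<^sub>u\<^sub>r p \<and>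
            \<alpha> = 1 + real M * \<sigma> * sqrt (2 - \<rho> + 2 * sqrt (1 - \<rho>)))"
    and "is_arg_min D (\<lambda>q. q \<in> K) p_hat"
    \<comment> \<open>constants\<close>
    and "\<eta> = (if op_norm W norm norm S * op_norm W norm norm B \<ge> 1/2
              then 1 / (4 * op_norm W norm norm S * op_norm W norm norm B)
              else 1 - op_norm W norm norm S * op_norm W norm norm B)"
    and "\<rho> = 1 - (1 - \<eta>) ^ N\<^sub>s\<^sub>u\<^sub>r"
    and "C\<^sub>\<theta> = sqrt (\<Sum>i=1..M. (op_norm V normV normV (\<theta> i))\<^sup>2)"
    and "R = Sup {normV (q - p_hat) | q. q \<in> K \<and> D q \<le> D (p 0)}"
    and "\<Phi> = sqrt (op_norm W norm norm Binv) * op_norm V normV norm \<Lambda> * C\<^sub>\<theta> * R"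
    and "n\<^sub>0 = (LEAST n. D (p n) - D p_hat < \<Phi>\<^sup>2 * \<alpha>)"
  shows "bdd_above {normV (q - p_hat) | q. q \<in> K \<and> D q \<le> D (p 0)} \<and>
    (\<lambda>n. D (p n)) \<longlonglongrightarrow> D p_hat \<and>
    (\<forall>n. (n \<le> n\<^sub>0 \<longrightarrow>
             D (p n) - D p_hat \<le> (1 - \<rho> * \<sigma> / (2 * \<alpha>)) ^ n * (D (p 0) - D p_hat)) \<and>
         (n \<ge> n\<^sub>0 \<longrightarrow>
             D (p n) - D p_hat \<le> 2 * \<Phi>\<^sup>2 / (\<rho> * \<sigma>) * \<alpha>\<^sup>2 * inverse (real n - real n\<^sub>0 + 1)))"
proof -
  have \<Omega>: "open \<Omega>" "bounded \<Omega>" using assms(1,2) by auto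
  obtain c\<^sub>B where c\<^sub>B: "0 < c\<^sub>B" "\<And>u. u \<in> W \<Longrightarrow> c\<^sub>B * (norm u)\<^sup>2 \<le> (norm (T u))\<^sup>2 + \<beta> * (norm u)\<^sup>2"
    using assms(16) by blast
  interpret P: positive_operator W B c\<^sub>B
    unfolding assms(17)
    by (rule positive_operator_normal[OF _ _ assms(13,14) _ c\<^sub>B])
      (use assms(15) in \<open>auto simp: assms(7) complete_L2_on[OF sets_lebesgue_open[OF \<Omega>(1)]] subspace_L2_on\<close>)
  have Binv: "Binv = P.Binv" by (simp add: assms(18) P.Binv_def)
  define f where "f = Tadj g"
  have f: "f \<in> W" using assms(12,14) by (auto simp: f_def bounded_linear_between_def)
  have D: "D = (\<lambda>q. 1/2 * energy_sq P.Binv (\<Lambda> q - f))" by (simp add: assms(19) Binv f_def)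
  have V_Hdiv: "x \<in> Hdiv \<Omega>" if "x \<in> V" for x using that Hdiv0_subset by (auto simp: assms(8))
  have V: "subspace V" unfolding assms(8) by (rule subspace_Hdiv0[OF \<Omega>(1)])
  have \<Lambda>_mem: "\<Lambda> x \<in> W" if "x \<in> V" for x
    unfolding assms(7,10) by (rule Hdiv_weak_div(1)[OF \<Omega>(1) V_Hdiv[OF that]])
  have \<Lambda>_add: "\<Lambda> (x + y) = \<Lambda> x + \<Lambda> y" if "x \<in> V" "y \<in> V" for x y
    unfolding assms(10) by (rule weak_div_add[OF \<Omega>(1) V_Hdiv V_Hdiv]) (use that in auto)
  have \<Lambda>_scale: "\<Lambda> (r *\<^sub>R x) = r *\<^sub>R \<Lambda> x" if "x \<in> V" for r x
    unfolding assms(10) by (rule weak_div_scaleR[OF \<Omega>(1) V_Hdiv[OF that]])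
  have KV: "K \<subseteq> V" by (auto simp: assms(8,11) admissible_def)
  have \<theta>: "bounded_linear_between V normV V normV (\<theta> i)" if "i \<in> {1..M}" for i
    using assms(21) that by blast
  have normV_nonneg: "0 \<le> normV x" for x by (simp add: assms(9) Hdiv_norm_nonneg)
  define a where "a x y = \<Lambda> x \<bullet> P.Binv (\<Lambda> y)" for x y
  define l where "l x = \<Lambda> x \<bullet> P.Binv f" for x
  interpret Q: quadratic_objective V a l D "1/2 * energy_sq P.Binv f"
    unfolding a_def[abs_def] l_def[abs_def] D
    by (rule P.quadratic_objective_energy[OF V \<Lambda>_mem \<Lambda>_add \<Lambda>_scale f])
  interpret Q: decomposition V a l D "1/2 * energy_sq P.Binv f" K \<theta> M
  proof
    show "K \<subseteq> V" by (rule KV)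
    show "convex K" unfolding assms(11) by (rule convex_admissible[OF \<Omega>(1)])
    show "1 \<le> M" by (rule assms(20))
    show "\<theta> i x \<in> V" if "i \<in> {1..M}" "x \<in> V" for i x
      using \<theta>[OF that(1)] that by (auto simp: bounded_linear_between_def)
    show "\<theta> i (x + y) = \<theta> i x + \<theta> i y" if "i \<in> {1..M}" "x \<in> V" "y \<in> V" for i x y
      using \<theta>[OF that(1)] that by (auto simp: bounded_linear_between_def)
    show "\<theta> i (r *\<^sub>R x) = r *\<^sub>R \<theta> i x" if "i \<in> {1..M}" "x \<in> V" for i x r
      using \<theta>[OF that(1)] that by (auto simp: bounded_linear_between_def)
    show "(\<Sum>i=1..M. \<theta> i x) = x" if "x \<in> V" for x using assms(22) that by simp
    show "K = {\<Sum>i=1..M. \<theta> i (q i) |q. \<forall>i\<in>{1..M}. q i \<in> K}" by (rule assms(23))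
  qed
  define \<kappa> where "\<kappa> = op_norm W norm norm S * op_norm W norm norm B"
  have S: "S = (\<lambda>w. \<tau> *\<^sub>R w - P.Binv w)" by (simp add: assms(26) Binv)
  have S_scale: "energy_sq S (\<Lambda> (t *\<^sub>R x)) = t\<^sup>2 * energy_sq S (\<Lambda> x)" if "x \<in> V" for t x
    using that \<Lambda>_mem
    by (simp add: S energy_sq_def \<Lambda>_scale P.Binv_scale power2_eq_square inner_diff_right algebra_simps)
  have S_nonneg: "0 \<le> energy_sq S (\<Lambda> x)" if "x \<in> V" for x
    unfolding S by (rule P.energy_shifted_Binv_nonneg[OF _ \<Lambda>_mem[OF that]]) (use assms(25) Binv in simp)
  have S_le: "energy_sq S (\<Lambda> x) \<le> \<kappa> * a x x" if "x \<in> V" for x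
    unfolding S \<kappa>_def a_def by (rule P.energy_shifted_Binv_le[OF \<Lambda>_mem[OF that]])
  have \<kappa>: "0 \<le> \<kappa>"
    unfolding \<kappa>_def S
    by (intro mult_nonneg_nonneg P.op_norm_B_nonneg op_norm_nonneg[OF P.shifted_Binv_bounded _ P.W_closed(4)]) auto
  have y: "p_hat \<in> K" and min: "\<And>q. q \<in> K \<Longrightarrow> D p_hat \<le> D q"
    using assms(29) by (auto simp: is_arg_min_linorder)
  \<comment> \<open>The other half of the finiteness of \<open>R\<close>: on the sublevel set the
    dual energy bounds the divergence, at the price of the norm of \<open>B\<close>.\<close>
  have \<Lambda>_le: "norm (\<Lambda> q - f) \<le> sqrt (2 * op_norm W norm norm B * D (p 0))"
    if "q \<in> K" "D q \<le> D (p 0)" for q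
  proof -
    have "\<Lambda> q - f \<in> W" using \<Lambda>_mem KV f that by (auto intro: P.W_closed)
    from P.norm_sq_le_Binv_inner[OF this]
    have "(norm (\<Lambda> q - f))\<^sup>2 \<le> 2 * op_norm W norm norm B * D q" by (simp add: D energy_sq_def)
    also have "\<dots> \<le> 2 * op_norm W norm norm B * D (p 0)"
      using that(2) P.op_norm_B_nonneg by (intro mult_left_mono) auto
    finally show ?thesis by (rule real_le_rsqrt)
  qed
  define E where "E = {normV (q - p_hat) | q. q \<in> K \<and> D q \<le> D (p 0)}"
  have bdd: "bdd_above E"
  proof (rule bdd_aboveI)
    fix r assume "r \<in> E"
    then obtain q where q: "q \<in> K" "D q \<le> D (p 0)" and r: "r = normV (q - p_hat)" by (auto simp: E_def)
    define c\<^sub>1 c\<^sub>2 where "c\<^sub>1 = 2 * (lam * sqrt (measure lebesgue \<Omega>))"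
      and "c\<^sub>2 = 2 * sqrt (2 * op_norm W norm norm B * D (p 0))"
    have "norm (q - p_hat) \<le> c\<^sub>1"
      using norm_triangle_ineq4[of q p_hat] norm_admissible_le[OF \<Omega>, of q lam] norm_admissible_le[OF \<Omega>, of p_hat lam]
        q(1) y assms(5,11) by (simp add: c\<^sub>1_def)
    moreover have "norm (weak_div \<Omega> (q - p_hat)) \<le> c\<^sub>2"
    proof -
      \<comment> \<open>Inserting \<open>f\<close> makes the sublevel estimate usable for both
        terms; \<open>p_hat\<close> is in the sublevel set by minimality.\<close>
      have "weak_div \<Omega> (q - p_hat) = (\<Lambda> q - f) - (\<Lambda> p_hat - f)"
        using weak_div_diff[OF \<Omega>(1) V_Hdiv V_Hdiv, of q p_hat] q(1) y KV by (auto simp: assms(10))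
      then show ?thesis
        using norm_triangle_ineq4[of "\<Lambda> q - f" "\<Lambda> p_hat - f"] \<Lambda>_le[OF q] \<Lambda>_le[OF y min[OF assms(27)]]
        by (simp only: c\<^sub>2_def)
    qed
    ultimately show "r \<le> sqrt (c\<^sub>1\<^sup>2 + c\<^sub>2\<^sup>2)"
      unfolding r assms(9) Hdiv_norm_def by (intro real_sqrt_le_mono add_mono power_mono) auto
  qed
  have R_upper: "normV (q - p_hat) \<le> R" if "q \<in> K" "D q \<le> D (p 0)" for q
    unfolding assms(33) E_def[symmetric] by (rule cSup_upper[OF _ bdd]) (use that in \<open>auto simp: E_def\<close>)
  \<comment> \<open>The set under the supremum is nonempty, since it contains the distance of
    \<open>p 0\<close>.\<close>
  have R: "0 \<le> R" using order_trans[OF normV_nonneg R_upper[OF assms(27)]] by simp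
  have \<Lambda>_bounded: "bounded_linear_between V normV W norm \<Lambda>"
    unfolding bounded_linear_between_def
    using \<Lambda>_mem \<Lambda>_add \<Lambda>_scale norm_weak_div_le_Hdiv_norm[of \<Omega>]
    by (auto simp: assms(9,10) intro!: exI[of _ 1])
  have op_\<Lambda>: "0 \<le> op_norm V normV norm \<Lambda>"
    by (rule op_norm_nonneg[OF \<Lambda>_bounded normV_nonneg subspace_0[OF V]]) simp
  have op_\<theta>: "0 \<le> op_norm V normV normV (\<theta> i)" if "i \<in> {1..M}" for i
    by (rule op_norm_nonneg[OF \<theta>[OF that] normV_nonneg subspace_0[OF V] normV_nonneg])
  have C\<^sub>\<theta>: "0 \<le> C\<^sub>\<theta>" "C\<^sub>\<theta>\<^sup>2 = (\<Sum>i=1..M. (op_norm V normV normV (\<theta> i))\<^sup>2)"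
    by (simp_all add: assms(32) sum_nonneg)
  have \<Phi>_nonneg: "0 \<le> \<Phi>"
    unfolding assms(34) using op_\<Lambda> C\<^sub>\<theta>(1) R P.op_norm_Binv_nonneg Binv by simp
  have \<Phi>_bound: "(\<Sum>i=1..M. a (\<theta> i (p_hat - q)) (\<theta> i (p_hat - q))) \<le> \<Phi>\<^sup>2"
    if q: "q \<in> K" "D q \<le> D (p 0)" for q
  proof -
    have d: "p_hat - q \<in> V" using y q KV by (auto intro: subspace_diff[OF V])
    have "normV (p_hat - q) = normV (q - p_hat)"
      unfolding assms(9) by (rule Hdiv_norm_minus_commute[OF \<Omega>(1) V_Hdiv V_Hdiv]) (use y q KV in auto)
    then have dR: "normV (p_hat - q) \<le> R" using R_upper[OF q] by simp
    \<comment> \<open>One norm per factor of \<Phi>: \<open>Binv\<close> in the energy, then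
      \<Lambda>, then \<open>\<theta> i\<close>, then \<open>R\<close>. Summing the squares over
      \<open>i\<close> produces \<open>C\<^sub>\<theta>\<^sup>2\<close>.\<close>
    have "a (\<theta> i (p_hat - q)) (\<theta> i (p_hat - q)) \<le> op_norm W norm norm Binv *
        (op_norm V normV norm \<Lambda> * (op_norm V normV normV (\<theta> i) * R))\<^sup>2" if i: "i \<in> {1..M}" for i
    proof -
      have \<theta>d: "\<theta> i (p_hat - q) \<in> V" by (rule Q.\<theta>_mem[OF i d])
      have "norm (\<Lambda> (\<theta> i (p_hat - q))) \<le> op_norm V normV norm \<Lambda> * normV (\<theta> i (p_hat - q))"
        by (rule op_norm_bound[OF \<Lambda>_bounded normV_nonneg \<theta>d])
      also have "\<dots> \<le> op_norm V normV norm \<Lambda> * (op_norm V normV normV (\<theta> i) * normV (p_hat - q))"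
        by (intro mult_left_mono op_\<Lambda> op_norm_bound[OF \<theta>[OF i] normV_nonneg d])
      also have "\<dots> \<le> op_norm V normV norm \<Lambda> * (op_norm V normV normV (\<theta> i) * R)"
        by (intro mult_left_mono op_\<Lambda> op_\<theta>[OF i] dR)
      finally have "(norm (\<Lambda> (\<theta> i (p_hat - q))))\<^sup>2 \<le> (op_norm V normV norm \<Lambda> * (op_norm V normV normV (\<theta> i) * R))\<^sup>2"
        by (intro power_mono) auto
      from mult_left_mono[OF this P.op_norm_Binv_nonneg] show ?thesis
        using P.Binv_inner_le[OF \<Lambda>_mem[OF \<theta>d]] by (simp add: a_def Binv)
    qed
    then have "(\<Sum>i=1..M. a (\<theta> i (p_hat - q)) (\<theta> i (p_hat - q))) \<le>
        (\<Sum>i=1..M. op_norm W norm norm Binv * (op_norm V normV norm \<Lambda> * (op_norm V normV normV (\<theta> i) * R))\<^sup>2)"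
      by (rule sum_mono)
    also have "\<dots> = op_norm W norm norm Binv * (op_norm V normV norm \<Lambda>)\<^sup>2 * C\<^sub>\<theta>\<^sup>2 * R\<^sup>2"
      unfolding C\<^sub>\<theta>(2) sum_distrib_left sum_distrib_right
      by (intro sum.cong) (simp_all add: power_mult_distrib)
    also have "\<dots> = \<Phi>\<^sup>2"
      using P.op_norm_Binv_nonneg by (simp add: assms(34) power_mult_distrib Binv)
    finally show ?thesis .
  qed
  \<comment> \<open>Zero energy forces \<open>\<Lambda> z = 0\<close>, and \<open>l\<close> depends
    on \<open>z\<close> only through \<open>\<Lambda> z\<close>.\<close>
  have null: "l z = 0" if "z \<in> V" "a z z = 0" for z
    using P.norm_sq_le_Binv_inner[OF \<Lambda>_mem[OF that(1)]] that(2) by (simp add: a_def l_def)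
  have \<eta>: "\<eta> = (if \<kappa> \<ge> 1/2 then 1 / (4 * \<kappa>) else 1 - \<kappa>)"
    unfolding assms(30) \<kappa>_def by (simp add: mult.assoc)
  note rate = Q.surrogate_decomposition_rate[OF y min S_nonneg S_scale S_le null \<kappa> \<eta> assms(24,31,27,28)
      \<Phi>_nonneg \<Phi>_bound, folded assms(35)]
  show ?thesis
  proof (intro conjI allI impI)
    show "bdd_above {normV (q - p_hat) |q. q \<in> K \<and> D q \<le> D (p 0)}"
      using bdd unfolding E_def .
    show "(\<lambda>n. D (p n)) \<longlonglongrightarrow> D p_hat" by (rule LIM_zero_cancel[OF rate(1)])
    fix n
    show "D (p n) - D p_hat \<le> (1 - \<rho> * \<sigma> / (2 * \<alpha>)) ^ n * (D (p 0) - D p_hat)" if "n \<le> n\<^sub>0"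
      by (rule rate(2)) (use that in auto)
    show "D (p n) - D p_hat \<le> 2 * \<Phi>\<^sup>2 / (\<rho> * \<sigma>) * \<alpha>\<^sup>2 * inverse (real n - real n\<^sub>0 + 1)" if "n\<^sub>0 \<le> n"
      by (rule rate(3)) (use that in auto)
  qed
qed

end
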